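(* There exists $\varepsilon>0$ such that, for every $p\in(2,2+\varepsilon)$ and every $\mu>0$, up to multiplication by a constant complex phase and the reflection $x\mapsto1-x$, there exists a unique energy ground state of $E_p$ on $[0,1]$ with mass $\mu$.
   Context: Let $E_p(u)=\frac12\|u'\|_{L^2(0,1)}^2-\frac1p\|u\|_{L^p(0,1)}^p$ and $H^1_\mu(0,1)=\{u\in H^1(0,1):\|u\|_{L^2(0,1)}^2=\mu\}$ (functions may be complex-valued). An energy ground state of $E_p$ on $[0,1]$ with mass $\mu$ is a function $u\in H^1_\mu(0,1)$ such that $E_p(u)=\inf_{v\in H^1_\mu(0,1)}E_p(v)$. *)

theory Defs
  imports "HOL-Analysis.Analysis"
begin

text \<open>
  Functions on the interval \<open>(0,1)\<close> are represented by functions on the whole real line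
  of which only the values on \<open>(0,1)\<close> matter; elements of Lebesgue and Sobolev spaces are
  such functions, identified when they agree almost everywhere on \<open>(0,1)\<close>.
\<close>

abbreviation unit_meas :: "real measure" where
  "unit_meas \<equiv> lebesgue_on {0<..<1}"

definition in_Lp :: "real \<Rightarrow> (real \<Rightarrow> complex) \<Rightarrow> bool" where
  "in_Lp p u \<longleftrightarrow> u \<in> borel_measurable unit_meas \<and> integrable unit_meas (\<lambda>x. cmod (u x) powr p)"

definition Lp_norm :: "real \<Rightarrow> (real \<Rightarrow> complex) \<Rightarrow> real" where
  "Lp_norm p u = (LINT x|unit_meas. cmod (u x) powr p) powr (1 / p)"

definition test_function :: "(real \<Rightarrow> real) \<Rightarrow> bool" where
  "test_function \<phi> \<longleftrightarrow>
     (\<forall>k x. (deriv ^^ k) \<phi> differentiable (at x)) \<and>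
     compact (closure {x. \<phi> x \<noteq> 0}) \<and> closure {x. \<phi> x \<noteq> 0} \<subseteq> {0<..<1}"

text \<open>Real test functions suffice: complex ones give the same notion, by linearity.\<close>

definition has_weak_deriv :: "(real \<Rightarrow> complex) \<Rightarrow> (real \<Rightarrow> complex) \<Rightarrow> bool" where
  "has_weak_deriv u v \<longleftrightarrow>
     (\<forall>\<phi>. test_function \<phi> \<longrightarrow>
        (LINT x|unit_meas. deriv \<phi> x *\<^sub>R u x) = - (LINT x|unit_meas. \<phi> x *\<^sub>R v x))"

definition H1 :: "(real \<Rightarrow> complex) set" where
  "H1 = {u. in_Lp 2 u \<and> (\<exists>v. in_Lp 2 v \<and> has_weak_deriv u v)}"

text \<open>A representative of the weak derivative, which is unique up to null sets.\<close>

definition weak_deriv :: "(real \<Rightarrow> complex) \<Rightarrow> real \<Rightarrow> complex" where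
  "weak_deriv u = (SOME v. in_Lp 2 v \<and> has_weak_deriv u v)"

definition H1_mass :: "real \<Rightarrow> (real \<Rightarrow> complex) set" where
  "H1_mass \<mu> = {u \<in> H1. (Lp_norm 2 u)\<^sup>2 = \<mu>}"

definition energy :: "real \<Rightarrow> (real \<Rightarrow> complex) \<Rightarrow> real" where
  "energy p u = 1 / 2 * (Lp_norm 2 (weak_deriv u))\<^sup>2 - 1 / p * Lp_norm p u powr p"

text \<open>
  The infimum is taken in the extended reals, since the infimum in type \<open>real\<close> of a set
  that is not bounded below is an unspecified number.
\<close>

definition energy_ground_state :: "real \<Rightarrow> real \<Rightarrow> (real \<Rightarrow> complex) \<Rightarrow> bool" where
  "energy_ground_state p \<mu> u \<longleftrightarrow>
     u \<in> H1_mass \<mu> \<and> ereal (energy p u) = (INF v\<in>H1_mass \<mu>. ereal (energy p v))"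

definition eq_up_to_phase_reflection :: "(real \<Rightarrow> complex) \<Rightarrow> (real \<Rightarrow> complex) \<Rightarrow> bool" where
  "eq_up_to_phase_reflection u v \<longleftrightarrow>
     (\<exists>c. cmod c = 1 \<and>
        ((AE x in unit_meas. v x = c * u x) \<or> (AE x in unit_meas. v x = c * u (1 - x))))"

end

theory Submission
  imports Defs "HOL-Complex_Analysis.Great_Picard"
begin

text \<open>Write \<open>p = 2 + d\<close> with small \<open>d\<close>; the bound on \<open>d\<close> that works below is \<open>1/4\<close>.

Existence is the direct method. Since \<open>p \<le> 3\<close>, the energy controls the kinetic energy, and a minimising sequence has a uniformly
convergent subsequence. The midpoints of its late members almost have the right mass, so their kinetic energy is almost as large as
that of the members themselves; the parallelogram identity then makes the derivatives converge strongly
(\<open>minimiser_exists\<close>).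

A ground state is a constant phase times a positive solution \<open>R\<close> of \<open>R'' = lam R - R^(p - 1)\<close> with \<open>R' = 0\<close> at both ends
(\<open>minimiser_phase\<close>). A critical point of \<open>R\<close> inside the interval is a centre of symmetry; unfolding the symmetric piece into a
monotone one of the same length preserves the mass and the potential term, and divides the kinetic energy on that piece by four. So \<open>R\<close> is constant or strictly
monotone (\<open>minimiser_constant_or_monotone\<close>), and after a reflection it is constant or strictly decreasing. It remains to see
that for each mass there is only one candidate.

After the scaling \<open>U = R / lam^(1/d)\<close> a decreasing solution is half of a periodic orbit of \<open>U'' = - l^2 f(U)\<close> around the equilibrium
\<open>1\<close>, where \<open>f(x) = (x^(1 + d) - x) / d\<close> and \<open>l^2 = lam d\<close>. Let \<open>V\<close> be the primitive of \<open>f\<close> that vanishes at \<open>1\<close>, and let \<open>A^2\<close> be the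
energy of the orbit. That the orbit takes length one for half a turn means that
\<open>l\<close> is the half period \<open>T(A)\<close> of \<open>U'' = - f(U)\<close>, and with \<open>M(A)\<close> the integral of \<open>U^2\<close> over that half period the mass is
\<open>(T^2/d)^(2/d) M / T\<close>. Its logarithm is, up to a constant, \<open>(4/d - 1) ln T + ln M\<close>. The factor \<open>4/d - 1\<close> is
large, and this is why uniqueness holds near \<open>p = 2\<close>: the half period increases strictly,
\<open>T' \<ge> A T^2 / (6 pi)\<close>, while \<open>M\<close> is at least \<open>pi/2\<close> and decreases at most at the rate \<open>2 d A T\<close>
(\<open>half_period'_ge\<close>, \<open>orbit_mass_ge\<close>, \<open>orbit_mass_has_derivative\<close>), so that the mass is
strictly increasing in \<open>A\<close> (\<open>log_mass_strict_mono\<close>). The bound on \<open>T'\<close> is a quantitative form of Chicone's criterion: the quotient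
\<open>V / f^2\<close> has an explicit integral representation (\<open>potential_eq_chicone\<close>), which exhibits its convexity with constants that do not depend
on \<open>d\<close> (\<open>chicone'_gap\<close>). Hence the mass determines \<open>A\<close>, then \<open>lam\<close> and \<open>R 0\<close>, then \<open>R\<close>.

For \<open>A = 0\<close> one has \<open>T = M = pi\<close>, so every decreasing solution satisfies \<open>d \<mu>^(d/2) > pi^2\<close> (\<open>decreasing_solution_mass\<close>). A constant
can be a minimiser only if \<open>d \<mu>^(d/2) \<le> pi^2\<close>, since otherwise a small rotation towards the function \<open>cos (pi x)\<close> lowers its energy
(\<open>constant_minimiser_mass\<close>). So a constant and a nonconstant ground state never have the same mass.\<close>

section \<open>Smooth bump functions\<close>

definition smooth :: "(real \<Rightarrow> real) \<Rightarrow> bool" where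
  "smooth f \<longleftrightarrow> (\<forall>k x. (deriv ^^ k) f differentiable (at x))"

text \<open>Closure of a family under differentiation replaces a formula for iterated derivatives.\<close>

lemma smooth_if_closed_under_deriv:
  assumes "f \<in> S" "\<And>g. g \<in> S \<Longrightarrow> \<exists>g'\<in>S. \<forall>x. (g has_real_derivative g' x) (at x)"
  shows "smooth f"
proof -
  have "(deriv ^^ k) f \<in> S" for k
  proof (induction k)
    case (Suc k)
    obtain g' where g': "g' \<in> S" "\<forall>x. ((deriv ^^ k) f has_real_derivative g' x) (at x)"
      using assms(2)[OF Suc] by blast
    then have "deriv ((deriv ^^ k) f) = g'"
      by (auto intro: DERIV_imp_deriv)
    then show ?case using g' by simp
  qed (use assms in auto)
  then show ?thesis
    unfolding smooth_def using assms(2) real_differentiable_def by blast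
qed

lemma smooth_antiderivative:
  assumes "smooth f" "\<And>x. (F has_real_derivative f x) (at x)"
  shows "smooth F"
proof -
  have dF: "deriv F = f"
    using assms(2) by (auto intro: DERIV_imp_deriv)
  show ?thesis
    unfolding smooth_def
  proof (intro allI)
    fix k x
    show "(deriv ^^ k) F differentiable at x"
    proof (cases k)
      case 0
      then show ?thesis using assms(2) real_differentiable_def by auto
    next
      case (Suc j)
      then have "(deriv ^^ k) F = (deriv ^^ j) f"
        by (simp add: funpow_swap1 dF)
      then show ?thesis using assms(1) by (simp add: smooth_def)
    qed
  qed
qed

text \<open>The functions \<open>t^(-i) exp (- c / t)\<close>, which vanish to infinite order at \<open>0\<close>; the exponent \<open>i\<close> is a parameter because differentiation raises it.\<close>

definition flat :: "real \<Rightarrow> nat \<Rightarrow> real \<Rightarrow> real" where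
  "flat c i t = (if t > 0 then (1 / t) ^ i * exp (- c / t) else 0)"

lemma flat_has_derivative:
  assumes "c > 0"
  shows "(flat c i has_real_derivative (c * flat c (i + 2) t - real i * flat c (i + 1) t)) (at t)"
proof -
  consider "t > 0" | "t < 0" | "t = 0" by linarith
  then show ?thesis
  proof cases
    case 1
    have "((\<lambda>t. (1 / t) ^ i * exp (- c / t)) has_real_derivative
        (c * flat c (i + 2) t - real i * flat c (i + 1) t)) (at t)"
    proof (rule DERIV_cong[OF DERIV_mult])
      show "((\<lambda>t. (1 / t) ^ i) has_real_derivative real i * ((1 / t) ^ (i - Suc 0) * (- ((1 / t)^2)))) (at t)"
        using 1 by (intro DERIV_cong[OF DERIV_power[where D = "- ((1 / t)^2)"]])
          (auto intro!: derivative_eq_intros simp: power2_eq_square field_simps)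
      show "((\<lambda>t. exp (- c / t)) has_real_derivative c * (1 / t)^2 * exp (- c / t)) (at t)"
        using 1 by (auto intro!: derivative_eq_intros simp: power2_eq_square field_simps)
      have "real i * ((1 / t) ^ (i - Suc 0) * (- ((1 / t)^2))) = - real i * (1 / t) ^ (i + 1)"
        by (cases i) (simp_all add: power2_eq_square algebra_simps add_divide_distrib diff_divide_distrib)
      then show "real i * ((1 / t) ^ (i - Suc 0) * (- ((1 / t)^2))) * exp (- c / t)
          + c * (1 / t)^2 * exp (- c / t) * (1 / t) ^ i =
          c * flat c (i + 2) t - real i * flat c (i + 1) t"
        using 1 by (simp add: flat_def power2_eq_square algebra_simps)
    qed
    then show ?thesis
      by (rule has_field_derivative_transform_within_open[of _ _ _ "{0<..}"]) (use 1 in \<open>auto simp: flat_def\<close>)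
  next
    case 2
    have "((\<lambda>t. 0) has_real_derivative (c * flat c (i + 2) t - real i * flat c (i + 1) t)) (at t)"
      using 2 by (simp add: flat_def)
    then show ?thesis
      by (rule has_field_derivative_transform_within_open[of _ _ _ "{..<0}"]) (use 2 in \<open>auto simp: flat_def\<close>)
  next
    case 3
    have "((\<lambda>s::real. s ^ Suc i / exp s) \<longlongrightarrow> 0) at_top" by (rule tendsto_power_div_exp_0)
    moreover have "filterlim (\<lambda>t. c * inverse t) at_top (at_right 0)"
      by (intro filterlim_tendsto_pos_mult_at_top[OF tendsto_const assms] filterlim_inverse_at_top_right)
    ultimately have "((\<lambda>t. (c * inverse t) ^ Suc i / exp (c * inverse t)) \<longlongrightarrow> 0) (at_right 0)"
      using filterlim_compose by blast
    then have "((\<lambda>t. (c * inverse t) ^ Suc i / exp (c * inverse t) / c ^ Suc i) \<longlongrightarrow> 0) (at_right 0)"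
      using tendsto_divide_zero by blast
    moreover have "\<forall>\<^sub>F t in at_right 0. (c * inverse t) ^ Suc i / exp (c * inverse t) / c ^ Suc i = flat c i t / t"
      using eventually_at_right_less[of 0]
    proof eventually_elim
      case (elim t)
      then show ?case using assms
        by (simp add: flat_def power_mult_distrib exp_minus field_simps)
    qed
    ultimately have r: "((\<lambda>t. flat c i t / t) \<longlongrightarrow> 0) (at_right 0)"
      by (rule Lim_transform_eventually)
    have l: "((\<lambda>t. flat c i t / t) \<longlongrightarrow> 0) (at_left 0)"
      by (rule Lim_transform_eventually[OF tendsto_const])
        (auto simp: flat_def eventually_at intro!: exI[of _ 1])
    have "((\<lambda>t. flat c i t / t) \<longlongrightarrow> 0) (at 0)"
      using l r filterlim_split_at by blast
    then show ?thesis
      using 3 by (simp add: has_field_derivative_iff flat_def)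
  qed
qed

text \<open>The linear span of the products of flat functions at the two ends of \<open>(a, b)\<close> is closed under
  differentiation, which is why all its members are smooth.\<close>

inductive_set flat_span :: "real \<Rightarrow> real \<Rightarrow> real \<Rightarrow> (real \<Rightarrow> real) set" for c a b where
  flat_span_base: "(\<lambda>x. flat c i (x - a) * flat c j (b - x)) \<in> flat_span c a b"
| flat_span_add: "f \<in> flat_span c a b \<Longrightarrow> g \<in> flat_span c a b \<Longrightarrow> (\<lambda>x. f x + g x) \<in> flat_span c a b"
| flat_span_mult: "f \<in> flat_span c a b \<Longrightarrow> (\<lambda>x. r * f x) \<in> flat_span c a b"

lemma flat_span_has_derivative:
  assumes "f \<in> flat_span c a b" "c > 0"
  shows "\<exists>f'\<in>flat_span c a b. \<forall>x. (f has_real_derivative f' x) (at x)"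
  using assms
proof induction
  case (flat_span_base i j)
  let ?f = "\<lambda>i j x. flat c i (x - a) * flat c j (b - x)"
  let ?f' = "\<lambda>x. (c * ?f (i + 2) j x + (- real i) * ?f (i + 1) j x)
     + ((- c) * ?f i (j + 2) x + real j * ?f i (j + 1) x)"
  have "?f' \<in> flat_span c a b"
    by (intro flat_span.intros)
  moreover have "(?f i j has_real_derivative ?f' x) (at x)" for x
  proof -
    have 1: "((\<lambda>x. flat c i (x - a)) has_real_derivative
        (c * flat c (i + 2) (x - a) - real i * flat c (i + 1) (x - a)) * 1) (at x)"
      by (rule DERIV_chain2[OF flat_has_derivative[OF flat_span_base]]) (auto intro!: derivative_eq_intros)
    have 2: "((\<lambda>x. flat c j (b - x)) has_real_derivative
        (c * flat c (j + 2) (b - x) - real j * flat c (j + 1) (b - x)) * (-1)) (at x)"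
      by (rule DERIV_chain2[OF flat_has_derivative[OF flat_span_base]]) (auto intro!: derivative_eq_intros)
    show ?thesis
      by (rule DERIV_cong[OF DERIV_mult[OF 1 2]]) (simp add: algebra_simps)
  qed
  ultimately show ?case by (rule bexI[of _ ?f', rotated, OF _ allI])
next
  case (flat_span_add f g)
  then obtain f' g' where "f' \<in> flat_span c a b" "\<forall>x. (f has_real_derivative f' x) (at x)"
    "g' \<in> flat_span c a b" "\<forall>x. (g has_real_derivative g' x) (at x)" by auto
  then show ?case
    by (intro bexI[of _ "\<lambda>x. f' x + g' x"] flat_span.flat_span_add) (simp_all add: DERIV_add)
next
  case (flat_span_mult f r)
  then obtain f' where "f' \<in> flat_span c a b" "\<forall>x. (f has_real_derivative f' x) (at x)" by auto
  then show ?case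
    by (intro bexI[of _ "\<lambda>x. r * f' x"] flat_span.flat_span_mult) (simp_all add: DERIV_cmult)
qed

text \<open>The rates \<open>1 / (n + 1)\<close> tend to zero, so the bumps tend pointwise to the indicator of \<open>(a, b)\<close> without a change of support.
  In the limit an integral against a test function becomes an integral over an interval, and mollification is avoided.\<close>

definition bump :: "nat \<Rightarrow> real \<Rightarrow> real \<Rightarrow> real \<Rightarrow> real" where
  "bump n a b x = flat (1 / Suc n) 0 (x - a) * flat (1 / Suc n) 0 (b - x)"

lemma smooth_bump: "smooth (bump n a b)"
proof (rule smooth_if_closed_under_deriv)
  show "bump n a b \<in> flat_span (1 / Suc n) a b"
    unfolding bump_def by (rule flat_span_base)
qed (rule flat_span_has_derivative, simp_all)

lemma smooth_bump_lincomb: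
  "smooth (\<lambda>x. r * bump n a b x + s * bump n a' b' x)"
proof (rule smooth_if_closed_under_deriv)
  let ?c = "1 / real (Suc n)"
  let ?S = "{\<lambda>x. f x + g x |f g. f \<in> flat_span ?c a b \<and> g \<in> flat_span ?c a' b'}"
  have "(\<lambda>x. r * bump n a b x) \<in> flat_span ?c a b" "(\<lambda>x. s * bump n a' b' x) \<in> flat_span ?c a' b'"
    unfolding bump_def by (intro flat_span.intros)+
  then show "(\<lambda>x. r * bump n a b x + s * bump n a' b' x) \<in> ?S"
    by (intro CollectI exI[of _ "\<lambda>x. r * bump n a b x"] exI[of _ "\<lambda>x. s * bump n a' b' x"] conjI) simp_all
  fix h assume "h \<in> ?S"
  then obtain f g where h: "h = (\<lambda>x. f x + g x)" "f \<in> flat_span ?c a b" "g \<in> flat_span ?c a' b'" by blast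
  obtain f' g' where "f' \<in> flat_span ?c a b" "g' \<in> flat_span ?c a' b'"
    "\<forall>x. (f has_real_derivative f' x) (at x)" "\<forall>x. (g has_real_derivative g' x) (at x)"
    using flat_span_has_derivative[OF h(2)] flat_span_has_derivative[OF h(3)] by auto
  then have "(\<lambda>x. f' x + g' x) \<in> ?S" "\<forall>x. (h has_real_derivative f' x + g' x) (at x)"
    unfolding h(1) by (blast, simp add: DERIV_add)
  then show "\<exists>h'\<in>?S. \<forall>x. (h has_real_derivative h' x) (at x)"
    by (intro bexI[of _ "\<lambda>x. f' x + g' x"])
qed

lemma bump_eq_0: "x \<notin> {a<..<b} \<Longrightarrow> bump n a b x = 0"
  by (auto simp: bump_def flat_def)

lemma bump_range: "0 \<le> bump n a b x" "bump n a b x \<le> 1"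
  by (auto simp: bump_def flat_def intro!: mult_le_one)

lemma bump_tendsto_indicator: "(\<lambda>n. bump n a b x) \<longlonglongrightarrow> indicator {a<..<b} x"
proof (cases "x \<in> {a<..<b}")
  case True
  have "(\<lambda>n. exp (- ((1 / Suc n) / (x - a))) * exp (- ((1 / Suc n) / (b - x)))) \<longlonglongrightarrow>
      exp (- (0 / (x - a))) * exp (- (0 / (b - x)))"
    using True by (intro tendsto_intros LIMSEQ_Suc[OF lim_1_over_n]) auto
  then show ?thesis using True by (simp add: bump_def flat_def)
next
  case False
  then show ?thesis by (simp add: bump_eq_0)
qed

lemma continuous_on_smooth: "smooth f \<Longrightarrow> continuous_on UNIV f"
  unfolding smooth_def
  by (metis continuous_at_imp_continuous_on differentiable_imp_continuous_within funpow_0)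

lemma test_function_support:
  assumes "smooth f" "0 < a" "b < 1" "\<And>x. x \<notin> {a..b} \<Longrightarrow> f x = 0"
  shows "test_function f"
proof -
  have sub: "closure {x. f x \<noteq> 0} \<subseteq> {a..b}"
    by (rule closure_minimal) (use assms(4) in force)+
  then have "compact (closure {x. f x \<noteq> 0})"
    by (metis Int_absorb1 closed_closure compact_Icc compact_Int_closed)
  moreover have "closure {x. f x \<noteq> 0} \<subseteq> {0<..<1}"
    using sub assms(2,3) by force
  ultimately show ?thesis using assms(1) by (simp add: test_function_def smooth_def)
qed

section \<open>Primitives of integrable functions\<close>

lemma finite_measure_unit: "finite_measure unit_meas"
  by (rule finite_measureI) (simp add: emeasure_restrict_space)

lemma measure_unit: "measure unit_meas {0<..<1} = 1"
  by (simp add: measure_restrict_space)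

lemma sigma_finite_unit: "sigma_finite_measure unit_meas"
  using finite_measure_unit finite_measure.axioms(1) by blast

lemma id_measurable_unit [measurable]: "(\<lambda>x. x) \<in> borel_measurable unit_meas"
  by (metis continuous_imp_measurable_on_sets_lebesgue continuous_on_id greaterThanLessThan_borel sets_completionI_sets sets_lborel lmeasurable_box box_real(1) fmeasurableD)

lemma integrable_unit_bounded:
  fixes f :: "real \<Rightarrow> 'a::{banach, second_countable_topology}"
  assumes "f \<in> borel_measurable unit_meas" "\<And>x. x \<in> {0<..<1} \<Longrightarrow> norm (f x) \<le> B"
  shows "integrable unit_meas f"
proof -
  interpret finite_measure unit_meas by (rule finite_measure_unit)
  show ?thesis
    by (rule integrable_const_bound[of _ B]) (use assms in \<open>auto intro!: AE_I2\<close>)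
qed

lemma integrable_unit_const [simp]:
  fixes c :: "'a::{banach, second_countable_topology}"
  shows "integrable unit_meas (\<lambda>x. c)"
  by (rule integrable_unit_bounded[of _ "norm c"]) auto

text \<open>Integrating over the unit interval with an indicator, rather than from \<open>0\<close> to \<open>x\<close>, makes the primitive a function on the whole line that
  is constant outside \<open>[0, 1]\<close>, and makes its measurability and Fubini's theorem immediate.\<close>

definition prim :: "(real \<Rightarrow> 'a::{banach, second_countable_topology}) \<Rightarrow> real \<Rightarrow> 'a" where
  "prim v x = (LINT y|unit_meas. indicat_real {..x} y *\<^sub>R v y)"

lemma borel_measurable_indicator_unit [measurable]:
  "A \<in> sets borel \<Longrightarrow> indicat_real A \<in> borel_measurable unit_meas"
  using measurable_compose[OF id_measurable_unit, of "indicat_real A" borel] by simp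

lemma integrable_indicator_unit:
  fixes v :: "real \<Rightarrow> 'a::{banach, second_countable_topology}"
  assumes "integrable unit_meas v" "A \<in> sets borel"
  shows "integrable unit_meas (\<lambda>y. indicat_real A y *\<^sub>R v y)"
proof (rule Bochner_Integration.integrable_bound[OF assms(1)])
  show "(\<lambda>y. indicat_real A y *\<^sub>R v y) \<in> borel_measurable unit_meas"
    using borel_measurable_integrable[OF assms(1)] assms(2) by measurable
qed (auto simp: indicator_def)

lemma prim_nonpos: "x \<le> 0 \<Longrightarrow> prim v x = 0"
  unfolding prim_def by (rule integral_eq_zero_AE) (auto intro!: AE_I2)

lemma prim_ge_1:
  assumes "x \<ge> 1" shows "prim v x = (LINT y|unit_meas. v y)"
  unfolding prim_def by (rule Bochner_Integration.integral_cong) (use assms in auto)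

lemma norm_prim_le:
  assumes v: "integrable unit_meas v"
  shows "norm (prim v x) \<le> (LINT y|unit_meas. norm (v y))"
proof -
  have "norm (prim v x) \<le> (LINT y|unit_meas. norm (indicat_real {..x} y *\<^sub>R v y))"
    unfolding prim_def by (rule integral_norm_bound)
  also have "\<dots> \<le> (LINT y|unit_meas. norm (v y))"
    by (rule integral_mono[OF integrable_norm[OF integrable_indicator_unit[OF v]] integrable_norm[OF v]])
      (auto simp: indicator_def)
  finally show ?thesis .
qed

lemma prim_add:
  assumes "integrable unit_meas v" "integrable unit_meas w"
  shows "prim (\<lambda>x. v x + w x) x = prim v x + prim w x"
  unfolding prim_def
  by (simp add: scaleR_add_right Bochner_Integration.integral_add integrable_indicator_unit assms)

lemma prim_diff:
  assumes "integrable unit_meas v" "integrable unit_meas w"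
  shows "prim (\<lambda>x. v x - w x) x = prim v x - prim w x"
  unfolding prim_def
  by (simp add: scaleR_diff_right Bochner_Integration.integral_diff integrable_indicator_unit assms)

lemma prim_bounded_linear:
  assumes "bounded_linear L" "integrable unit_meas v"
  shows "prim (\<lambda>x. L (v x)) x = L (prim v x)"
proof -
  interpret bounded_linear L by fact
  show ?thesis
    unfolding prim_def
    using integral_bounded_linear[OF assms(1) integrable_indicator_unit[OF assms(2), of "{..x}"]]
    by (simp add: scaleR)
qed

lemma prim_minus_prim:
  fixes v :: "real \<Rightarrow> 'a::{banach, second_countable_topology}"
  assumes "integrable unit_meas v" "x \<le> y"
  shows "prim v y - prim v x = (LINT z|unit_meas. indicat_real {x<..y} z *\<^sub>R v z)"
proof -
  have "prim v y - prim v x = (LINT z|unit_meas. indicat_real {..y} z *\<^sub>R v z - indicat_real {..x} z *\<^sub>R v z)"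
    unfolding prim_def
    by (simp add: Bochner_Integration.integral_diff integrable_indicator_unit assms)
  also have "\<dots> = (LINT z|unit_meas. indicat_real {x<..y} z *\<^sub>R v z)"
    by (rule Bochner_Integration.integral_cong) (use assms in \<open>auto simp: indicator_def\<close>)
  finally show ?thesis .
qed

lemma AE_unit_neq: "AE x in unit_meas. x \<noteq> c"
proof -
  have "AE x in lebesgue. x \<noteq> c"
    using AE_lborel_singleton[of c] by (rule AE_completion)
  then show ?thesis
    by (subst AE_restrict_space_iff) auto
qed

lemma continuous_prim:
  fixes v :: "real \<Rightarrow> 'a::{banach, second_countable_topology}"
  assumes "integrable unit_meas v"
  shows "continuous_on UNIV (prim v)"
proof (rule continuous_at_imp_continuous_on, intro ballI)
  fix x :: real
  have "(\<lambda>n. prim v (X n)) \<longlonglongrightarrow> prim v x" if X: "X \<longlonglongrightarrow> x" for X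
    unfolding prim_def
  proof (rule integral_dominated_convergence[where w = "\<lambda>y. norm (v y)"])
    show "AE y in unit_meas. (\<lambda>n. indicat_real {..X n} y *\<^sub>R v y) \<longlonglongrightarrow> indicat_real {..x} y *\<^sub>R v y"
      using AE_unit_neq[of x]
    proof eventually_elim
      case (elim y)
      then consider "y < x" | "x < y" by linarith
      then have "\<forall>\<^sub>F n in sequentially. indicat_real {..X n} y *\<^sub>R v y = indicat_real {..x} y *\<^sub>R v y"
      proof cases
        case 1
        show ?thesis using order_tendstoD(1)[OF X 1] 1 by (auto elim: eventually_mono)
      next
        case 2
        show ?thesis using order_tendstoD(2)[OF X 2] 2 by (auto elim: eventually_mono)
      qed
      then show ?case by (rule tendsto_eventually)
    qed
    show "(\<lambda>y. indicat_real {..x} y *\<^sub>R v y) \<in> borel_measurable unit_meas"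
      "\<And>n. (\<lambda>y. indicat_real {..X n} y *\<^sub>R v y) \<in> borel_measurable unit_meas"
      by (auto intro!: borel_measurable_integrable integrable_indicator_unit assms)
  qed (use assms in \<open>auto simp: indicator_def\<close>)
  then show "isCont (prim v) x"
    by (simp add: continuous_at_sequentially o_def)
qed

text \<open>Half lines form an intersection-stable generator of the Borel sets.\<close>

lemma integral_indicator_zero_if_prim_zero:
  fixes w :: "real \<Rightarrow> 'a::{banach, second_countable_topology}"
  assumes w: "integrable unit_meas w" and z: "\<And>x. prim w x = 0" and A: "A \<in> sets borel"
  shows "(LINT y|unit_meas. indicat_real A y *\<^sub>R w y) = 0"
proof -
  let ?G = "range (\<lambda>a::real. {..a})"
  have st: "Int_stable ?G"
    by (auto simp: Int_stable_def Int_atMost)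
  have sub: "?G \<subseteq> Pow UNIV" by simp
  have borel: "sigma_sets UNIV ?G = sets borel"
    by (simp add: borel_eq_atMost)
  then have "A \<in> sigma_sets UNIV ?G" using A by simp
  with st sub show ?thesis
  proof (induction rule: sigma_sets_induct_disjoint)
    case (basic A)
    then show ?case using z by (auto simp: prim_def)
  next
    case empty
    then show ?case by simp
  next
    case (compl A)
    have "(LINT y|unit_meas. indicat_real (UNIV - A) y *\<^sub>R w y)
        = (LINT y|unit_meas. w y - indicat_real A y *\<^sub>R w y)"
      by (rule Bochner_Integration.integral_cong) (auto simp: indicator_def)
    also have "\<dots> = (LINT y|unit_meas. w y) - (LINT y|unit_meas. indicat_real A y *\<^sub>R w y)"
      using compl(1) borel by (intro Bochner_Integration.integral_diff w integrable_indicator_unit) auto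
    finally show ?case using compl z[of 1] prim_ge_1[of 1 w] by simp
  next
    case (union A)
    have meas: "A i \<in> sets borel" for i using union(2) borel by auto
    have "(\<lambda>n. LINT y|unit_meas. (\<Sum>i<n. indicat_real (A i) y) *\<^sub>R w y) \<longlonglongrightarrow>
        (LINT y|unit_meas. indicat_real (\<Union>i. A i) y *\<^sub>R w y)"
    proof (rule integral_dominated_convergence[where w = "\<lambda>y. norm (w y)"])
      show "AE y in unit_meas. (\<lambda>n. (\<Sum>i<n. indicat_real (A i) y) *\<^sub>R w y) \<longlonglongrightarrow>
          indicat_real (\<Union>i. A i) y *\<^sub>R w y"
        using indicator_sums[of A] union(1) unfolding sums_def disjoint_family_on_def
        by (intro AE_I2 tendsto_intros) simp
      show "AE y in unit_meas. norm ((\<Sum>i<n. indicat_real (A i) y) *\<^sub>R w y) \<le> norm (w y)" for n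
      proof (intro AE_I2)
        fix y
        have "(\<Sum>i<n. indicat_real (A i) y) = indicat_real (\<Union>i<n. A i) y"
          by (subst indicator_UN_disjoint) (use union(1) in \<open>auto simp: disjoint_family_on_def\<close>)
        then show "norm ((\<Sum>i<n. indicat_real (A i) y) *\<^sub>R w y) \<le> norm (w y)"
          by (auto simp: indicator_def)
      qed
      have "integrable unit_meas (\<lambda>y. \<Sum>i<n. indicat_real (A i) y *\<^sub>R w y)" for n
        by (intro Bochner_Integration.integrable_sum integrable_indicator_unit w meas)
      then show "(\<lambda>y. (\<Sum>i<n. indicat_real (A i) y) *\<^sub>R w y) \<in> borel_measurable unit_meas" for n
        by (simp add: scaleR_sum_left borel_measurable_integrable)
      show "(\<lambda>y. indicat_real (\<Union> (range A)) y *\<^sub>R w y) \<in> borel_measurable unit_meas"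
        by (intro borel_measurable_integrable integrable_indicator_unit w) (use meas in auto)
    qed (use w in auto)
    moreover have "(LINT y|unit_meas. (\<Sum>i<n. indicat_real (A i) y) *\<^sub>R w y) = 0" for n
      using union(3) unfolding scaleR_sum_left
      by (subst Bochner_Integration.integral_sum) (auto intro!: integrable_indicator_unit w meas)
    ultimately show ?case
      by (simp add: LIMSEQ_const_iff)
  qed
qed

text \<open>A Lebesgue measurable set differs from a Borel set by a null set.\<close>

lemma AE_zero_if_prim_zero:
  fixes w :: "real \<Rightarrow> 'a::{banach, second_countable_topology}"
  assumes w: "integrable unit_meas w" and z: "\<And>x. prim w x = 0"
  shows "AE x in unit_meas. w x = 0"
proof (rule sigma_finite_measure.density_unique_banach[OF sigma_finite_unit w])
  show "integrable unit_meas (\<lambda>x. 0 :: 'a)" by simp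
  fix A assume A: "A \<in> sets unit_meas"
  then obtain B where B: "B \<in> sets lebesgue" "A = {0<..<1} \<inter> B"
    by (auto simp: sets_restrict_space)
  from B(1) obtain S N N' where SN: "B = S \<union> N" "N \<subseteq> N'" "N' \<in> null_sets lborel" "S \<in> sets lborel"
    by (rule sets_completionE)
  have "AE x in lborel. x \<notin> N'" using SN(3) by (rule AE_not_in)
  then have "AE x in lebesgue. x \<notin> N'" by (rule AE_completion)
  then have "AE x in unit_meas. x \<notin> N'" by (subst AE_restrict_space_iff) auto
  then have "AE x in unit_meas. indicat_real A x *\<^sub>R w x = indicat_real S x *\<^sub>R w x"
    using AE_space
  proof eventually_elim
    case (elim x)
    then show ?case using SN(2) B(2) SN(1) by (auto simp: indicator_def)
  qed
  then have "(LINT x|unit_meas. indicat_real A x *\<^sub>R w x) = (LINT x|unit_meas. indicat_real S x *\<^sub>R w x)"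
    using w A SN(4)
    by (intro integral_cong_AE borel_measurable_scaleR borel_measurable_indicator_unit
        borel_measurable_indicator[of A] borel_measurable_integrable) auto
  also have "\<dots> = 0"
    using integral_indicator_zero_if_prim_zero[OF w z] SN(4) by simp
  finally show "set_lebesgue_integral unit_meas A w = set_lebesgue_integral unit_meas A (\<lambda>x. 0)"
    by (simp add: set_lebesgue_integral_def)
qed

text \<open>Fubini's theorem on the triangle \<open>x \<le> y\<close>. A general bilinear product covers both test functions that scale vector-valued functions and
  the inner product in the Euler-Lagrange equation.\<close>

lemma integration_by_parts_prim:
  fixes f :: "real \<Rightarrow> 'a::{banach, second_countable_topology}" and g :: "real \<Rightarrow> 'b::{banach, second_countable_topology}"
    and prod :: "'a \<Rightarrow> 'b \<Rightarrow> 'c::{banach, second_countable_topology}"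
  assumes "bounded_bilinear prod" and f: "integrable unit_meas f" and g: "integrable unit_meas g"
  shows "(LINT x|unit_meas. prod (f x) (prim g x)) + (LINT x|unit_meas. prod (prim f x) (g x))
    = prod (prim f 1) (prim g 1)"
proof -
  interpret bounded_bilinear prod by fact
  interpret U: finite_measure unit_meas by (rule finite_measure_unit)
  interpret P: pair_sigma_finite unit_meas unit_meas ..
  have mf [measurable]: "f \<in> borel_measurable unit_meas" and mg [measurable]: "g \<in> borel_measurable unit_meas"
    using f g by auto
  have cont: "continuous_on UNIV (\<lambda>p. prod (fst p) (snd p))"
    by (intro continuous_on continuous_intros)
  have mp [measurable]: "(\<lambda>p. prod (f (fst p)) (g (snd p))) \<in> borel_measurable (unit_meas \<Otimes>\<^sub>M unit_meas)"
    using borel_measurable_continuous_Pair[OF _ _ cont, of "\<lambda>p. f (fst p)" _ "\<lambda>p. g (snd p)"] by measurable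
  have m2: "(\<lambda>p. indicat_real {..snd p} (fst p)) \<in> borel_measurable (unit_meas \<Otimes>\<^sub>M unit_meas)"
  proof -
    have "(\<lambda>p. if fst p \<le> snd p then 1 else 0 :: real) \<in> borel_measurable (unit_meas \<Otimes>\<^sub>M unit_meas)"
      by measurable
    then show ?thesis by (simp add: indicator_def of_bool_def)
  qed
  define h where "h x y = indicat_real {..y} x *\<^sub>R prod (f x) (g y)" for x y
  obtain K where K: "\<And>a b. norm (prod a b) \<le> norm a * norm b * K" "K > 0" using pos_bounded by blast
  have igx: "integrable unit_meas (\<lambda>y. prod (f x) (g y))" for x
    by (rule integrable_bounded_linear[OF bounded_linear_right g])
  have ifx: "integrable unit_meas (\<lambda>x. prod (f x) (g y))" for y
    by (rule integrable_bounded_linear[OF bounded_linear_left f])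
  have hx: "integrable unit_meas (\<lambda>y. h x y)" for x
  proof -
    have "integrable unit_meas (\<lambda>y. indicat_real {x..} y *\<^sub>R prod (f x) (g y))"
      by (rule integrable_indicator_unit[OF igx]) simp
    then show ?thesis by (simp add: h_def indicator_def)
  qed
  have int: "integrable (unit_meas \<Otimes>\<^sub>M unit_meas) (case_prod h)"
  proof (rule P.Fubini_integrable)
    show m: "case_prod h \<in> borel_measurable (unit_meas \<Otimes>\<^sub>M unit_meas)"
      using borel_measurable_scaleR[OF m2 mp] by (simp add: h_def case_prod_unfold)
    show "integrable unit_meas (\<lambda>x. LINT y|unit_meas. norm (case (x, y) of (x, y) \<Rightarrow> h x y))"
    proof (rule Bochner_Integration.integrable_bound)
      show "integrable unit_meas (\<lambda>x. norm (f x) * ((LINT y|unit_meas. norm (g y)) * K))"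
        using f by simp
      show "(\<lambda>x. LINT y|unit_meas. norm (case (x, y) of (x, y) \<Rightarrow> h x y)) \<in> borel_measurable unit_meas"
        using m by measurable
      have "norm (LINT y|unit_meas. norm (h x y)) \<le> norm (f x) * ((LINT y|unit_meas. norm (g y)) * K)" for x
      proof -
        have "(LINT y|unit_meas. norm (h x y)) \<le> (LINT y|unit_meas. norm (f x) * norm (g y) * K)"
          using g K by (intro integral_mono integrable_norm hx) (auto simp: h_def indicator_def)
        then show ?thesis by (simp add: mult.assoc)
      qed
      then show "AE x in unit_meas. norm (LINT y|unit_meas. norm (case (x, y) of (x, y) \<Rightarrow> h x y))
          \<le> norm (norm (f x) * ((LINT y|unit_meas. norm (g y)) * K))"
        using K(2) by (intro AE_I2) (auto simp: abs_mult intro: order_trans)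
    qed
    show "AE x in unit_meas. integrable unit_meas (\<lambda>y. case (x, y) of (x, y) \<Rightarrow> h x y)"
      using hx by simp
  qed
  have "(LINT x|unit_meas. prod (prim f x) (g x)) = (LINT y|unit_meas. LINT x|unit_meas. h x y)"
  proof (rule Bochner_Integration.integral_cong)
    fix y
    have "prod (prim f y) (g y) = (LINT x|unit_meas. prod (indicat_real {..y} x *\<^sub>R f x) (g y))"
      unfolding prim_def
      by (rule integral_bounded_linear[OF bounded_linear_left, symmetric])
        (rule integrable_indicator_unit[OF f], simp)
    then show "prod (prim f y) (g y) = (LINT x|unit_meas. h x y)"
      by (simp add: h_def scaleR_left)
  qed simp
  also have "\<dots> = (LINT x|unit_meas. LINT y|unit_meas. h x y)"
    by (rule P.Fubini_integral[OF int])
  also have "\<dots> = (LINT x|unit_meas. prod (f x) (prim g 1) - prod (f x) (prim g x))"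
  proof (rule Bochner_Integration.integral_cong)
    fix x
    have "(LINT y|unit_meas. h x y) = (LINT y|unit_meas. prod (f x) (g y) - prod (f x) (indicat_real {..x} y *\<^sub>R g y))"
    proof (rule integral_cong_AE)
      show "AE y in unit_meas. h x y = prod (f x) (g y) - prod (f x) (indicat_real {..x} y *\<^sub>R g y)"
        using AE_unit_neq[of x] by eventually_elim (auto simp: h_def indicator_def zero_right)
    qed (use hx igx integrable_bounded_linear[OF bounded_linear_right integrable_indicator_unit[OF g]] in auto)
    also have "\<dots> = prod (f x) (prim g 1) - prod (f x) (prim g x)"
      using integrable_bounded_linear[OF bounded_linear_right integrable_indicator_unit[OF g, of "{..x}"]] igx
      by (simp add: Bochner_Integration.integral_diff prim_ge_1)
         (simp add: prim_def integral_bounded_linear[OF bounded_linear_right] g integrable_indicator_unit)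
    finally show "(LINT y|unit_meas. h x y) = prod (f x) (prim g 1) - prod (f x) (prim g x)" .
  qed simp
  also have "\<dots> = (LINT x|unit_meas. prod (f x) (prim g 1)) - (LINT x|unit_meas. prod (f x) (prim g x))"
  proof (rule Bochner_Integration.integral_diff)
    show "integrable unit_meas (\<lambda>x. prod (f x) (prim g 1))"
      by (rule integrable_bounded_linear[OF bounded_linear_left f])
    show "integrable unit_meas (\<lambda>x. prod (f x) (prim g x))"
    proof (rule Bochner_Integration.integrable_bound)
      show "integrable unit_meas (\<lambda>x. norm (f x) * ((LINT y|unit_meas. norm (g y)) * K))"
        using f by simp
      have "prim g \<in> borel_measurable unit_meas"
        using measurable_compose[OF id_measurable_unit borel_measurable_continuous_onI[OF continuous_prim[OF g]]] by simp
      then show "(\<lambda>x. prod (f x) (prim g x)) \<in> borel_measurable unit_meas"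
        using borel_measurable_continuous_Pair[OF mf _ cont] by simp
      have "norm (prod (f x) (prim g x)) \<le> norm (f x) * ((LINT y|unit_meas. norm (g y)) * K)" for x
        using K norm_prim_le[OF g] by (intro order_trans[OF K(1)]) (auto simp: mult.assoc intro!: mult_left_mono mult_right_mono)
      then show "AE x in unit_meas. norm (prod (f x) (prim g x))
          \<le> norm (norm (f x) * ((LINT y|unit_meas. norm (g y)) * K))"
        using K(2) by (intro AE_I2) (auto simp: abs_mult intro: order_trans)
    qed
  qed
  finally show ?thesis
    using integral_bounded_linear[OF bounded_linear_left f] prim_ge_1[of 1 f] by simp
qed

lemma lebesgue_unit_set [simp]: "{0<..<1::real} \<in> sets lebesgue"
  by simp

lemma integral_unit_eq:
  fixes f :: "real \<Rightarrow> 'a::euclidean_space"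
  assumes "integrable unit_meas f"
  shows "(LINT x|unit_meas. f x) = integral {0..1} f"
  using lebesgue_integral_eq_integral[OF assms] by (simp add: integral_open_interval_real)

lemma prim_eq_integral:
  fixes f :: "real \<Rightarrow> 'a::euclidean_space"
  assumes "integrable unit_meas f" "x \<in> {0..1}"
  shows "prim f x = integral {0..x} f"
proof -
  have "prim f x = integral {0<..<1} (\<lambda>y. indicat_real {..x} y *\<^sub>R f y)"
    unfolding prim_def by (intro lebesgue_integral_eq_integral integrable_indicator_unit assms) auto
  also have "\<dots> = integral {0<..<1} (\<lambda>y. if y \<in> {..x} then f y else 0)"
    by (rule Henstock_Kurzweil_Integration.integral_cong) (auto simp: indicator_def)
  also have "\<dots> = integral ({0<..<1} \<inter> {..x}) f"
    by (simp only: integral_restrict_Int Int_commute)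
  also have "\<dots> = integral {0..x} f"
  proof (rule integral_spike_set)
    show "negligible {y \<in> {0<..<1} \<inter> {..x} - {0..x}. f y \<noteq> 0}"
      by (rule negligible_subset[of "{}"]) auto
    show "negligible {y \<in> {0..x} - {0<..<1} \<inter> {..x}. f y \<noteq> 0}"
      by (rule negligible_subset[of "{0, 1}"]) (use assms in auto)
  qed
  finally show ?thesis .
qed

lemma integrable_unit_continuous:
  fixes f :: "real \<Rightarrow> 'a::euclidean_space"
  assumes "continuous_on {0..1} f"
  shows "integrable unit_meas f"
proof -
  have "compact (f ` {0..1})"
    using assms compact_continuous_image by blast
  then obtain B where "\<forall>x\<in>f ` {0..1}. norm x \<le> B"
    using compact_imp_bounded bounded_iff by blast
  moreover have "f \<in> borel_measurable unit_meas"
    by (rule continuous_imp_measurable_on_sets_lebesgue)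
      (auto intro: continuous_on_subset[OF assms])
  ultimately show ?thesis
    by (intro integrable_unit_bounded[of _ B]) auto
qed

lemma prim_has_vector_derivative:
  fixes f :: "real \<Rightarrow> 'a::euclidean_space"
  assumes "continuous_on {0..1} f" "x \<in> {0..1}"
  shows "(prim f has_vector_derivative f x) (at x within {0..1})"
proof -
  have "((\<lambda>x. integral {0..x} f) has_vector_derivative f x) (at x within {0..1})"
    by (rule integral_has_vector_derivative) (use assms in auto)
  then show ?thesis
    by (rule has_vector_derivative_transform[OF assms(2), rotated])
      (use prim_eq_integral[OF integrable_unit_continuous[OF assms(1)]] in auto)
qed

lemma test_function_antiderivative:
  assumes "smooth f" "0 < a" "b < 1" "\<And>x. x \<notin> {a..b} \<Longrightarrow> f x = 0" "(LINT x|unit_meas. f x) = 0"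
  shows "test_function (prim f)" "deriv (prim f) = f"
proof -
  have cf: "continuous_on {0..1} f"
    using continuous_on_smooth[OF assms(1)] continuous_on_subset by blast
  have z: "prim f x = 0" if "x \<notin> {a..b}" for x
  proof (cases "x < a")
    case True
    then show ?thesis
      unfolding prim_def by (intro integral_eq_zero_AE AE_I2) (use assms(4) in \<open>auto simp: indicator_def\<close>)
  next
    case False
    then have "prim f x = (LINT x|unit_meas. f x)"
      unfolding prim_def using that
      by (intro Bochner_Integration.integral_cong) (use assms(4) in \<open>auto simp: indicator_def\<close>)
    then show ?thesis using assms(5) by simp
  qed
  have d: "(prim f has_real_derivative f x) (at x)" for x
  proof (cases "x \<in> {a..b}")
    case True
    then have "x \<in> {0<..<1}" using assms by auto
    then have "(prim f has_vector_derivative f x) (at x within {0..1})" "at x within {0..1} = at x"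
      using prim_has_vector_derivative[OF cf, of x] at_within_Icc_at[of 0 x 1] by auto
    then show ?thesis by (simp add: has_real_derivative_iff_has_vector_derivative)
  next
    case False
    have "((\<lambda>x. 0) has_real_derivative f x) (at x)" using False assms(4) by auto
    moreover have "open (- {a..b})" by auto
    ultimately show ?thesis
      by (rule has_field_derivative_transform_within_open) (use False z in auto)
  qed
  show "deriv (prim f) = f" using d by (auto intro: DERIV_imp_deriv)
  show "test_function (prim f)"
    by (rule test_function_support[OF smooth_antiderivative[OF assms(1) d] assms(2,3) z])
qed

section \<open>Weak derivatives and primitives\<close>

lemma bump_integral_tendsto:
  fixes w :: "real \<Rightarrow> 'a::{banach, second_countable_topology}"
  assumes w: "integrable unit_meas w" and "a \<le> b"
  shows "(\<lambda>n. LINT x|unit_meas. bump n a b x *\<^sub>R w x) \<longlonglongrightarrow> prim w b - prim w a"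
proof -
  have mb: "bump n a b \<in> borel_measurable unit_meas" for n
    using measurable_compose[OF id_measurable_unit borel_measurable_continuous_onI[OF continuous_on_smooth[OF smooth_bump]]] by simp
  have "(\<lambda>n. LINT x|unit_meas. bump n a b x *\<^sub>R w x) \<longlonglongrightarrow> (LINT x|unit_meas. indicat_real {a<..<b} x *\<^sub>R w x)"
  proof (rule integral_dominated_convergence[where w = "\<lambda>x. norm (w x)"])
    show "(\<lambda>x. indicat_real {a<..<b} x *\<^sub>R w x) \<in> borel_measurable unit_meas"
      by (intro borel_measurable_integrable integrable_indicator_unit w) simp
    show "(\<lambda>x. bump n a b x *\<^sub>R w x) \<in> borel_measurable unit_meas" for n
      using mb w by auto
    show "AE x in unit_meas. (\<lambda>n. bump n a b x *\<^sub>R w x) \<longlonglongrightarrow> indicat_real {a<..<b} x *\<^sub>R w x"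
      by (intro AE_I2 tendsto_scaleR bump_tendsto_indicator tendsto_const)
    show "AE x in unit_meas. norm (bump n a b x *\<^sub>R w x) \<le> norm (w x)" for n
      using bump_range[of n a b] by (intro AE_I2) (simp add: mult_left_le_one_le)
  qed (use w in auto)
  also have "(LINT x|unit_meas. indicat_real {a<..<b} x *\<^sub>R w x) = (LINT x|unit_meas. indicat_real {a<..b} x *\<^sub>R w x)"
  proof (rule integral_cong_AE)
    show "AE x in unit_meas. indicat_real {a<..<b} x *\<^sub>R w x = indicat_real {a<..b} x *\<^sub>R w x"
      using AE_unit_neq[of b] by eventually_elim (auto simp: indicator_def)
  qed (auto intro!: borel_measurable_integrable integrable_indicator_unit w)
  finally show ?thesis by (simp add: prim_minus_prim assms)
qed

lemma AE_zero_if_prim_constant: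
  fixes w :: "real \<Rightarrow> 'a::{banach, second_countable_topology}"
  assumes w: "integrable unit_meas w" and c: "\<And>a b. 0 < a \<Longrightarrow> a < b \<Longrightarrow> b < 1 \<Longrightarrow> prim w a = prim w b"
  shows "AE x in unit_meas. w x = 0"
proof (rule AE_zero_if_prim_zero[OF w])
  have cont: "continuous_on (closure {0<..<1}) (prim w)"
    using continuous_prim[OF w] continuous_on_subset by blast
  define k where "k = prim w (1/2)"
  have k: "prim w x = k" if "x \<in> {0<..<1}" for x
  proof -
    consider "x < 1/2" | "x = 1/2" | "1/2 < x" by linarith
    then show ?thesis
    proof cases
      case 2
      then show ?thesis by (simp only: k_def)
    qed (use c[of x "1/2"] c[of "1/2" x] that in \<open>simp_all add: k_def\<close>)
  qed
  have const: "prim w x = k" if "x \<in> {0..1}" for x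
    by (rule continuous_constant_on_closure[OF cont k]) (use that in simp_all)
  have "k = 0" using const[of 0] prim_nonpos[of 0 w] by simp
  then show "prim w x = 0" for x
    using const[of x] const[of 1] prim_nonpos[of x w] prim_ge_1[of x w] prim_ge_1[of 1 w] by force
qed

lemma fundamental_lemma_calculus_of_variations:
  fixes w :: "real \<Rightarrow> 'a::{banach, second_countable_topology}"
  assumes w: "integrable unit_meas w"
    and z: "\<And>\<phi>. test_function \<phi> \<Longrightarrow> (LINT x|unit_meas. \<phi> x *\<^sub>R w x) = 0"
  shows "AE x in unit_meas. w x = 0"
proof (rule AE_zero_if_prim_constant[OF w])
  fix a b :: real assume ab: "0 < a" "a < b" "b < 1"
  have "test_function (bump n a b)" for n
    by (rule test_function_support[OF smooth_bump, of a b]) (use ab bump_eq_0 in auto)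
  then show "prim w a = prim w b"
    using bump_integral_tendsto[OF w, of a b] z ab by (simp add: LIMSEQ_const_iff)
qed

lemma integrable_bump: "integrable unit_meas (bump n a b)"
  by (rule integrable_unit_continuous)
    (use continuous_on_smooth[OF smooth_bump] continuous_on_subset in blast)

lemma integral_bump_tendsto:
  assumes "0 < a" "a < b" "b < 1"
  shows "(\<lambda>n. LINT x|unit_meas. bump n a b x) \<longlonglongrightarrow> b - a"
proof -
  have "prim (\<lambda>x. 1 :: real) x = x" if "x \<in> {0..1}" for x
    using that by (subst prim_eq_integral) auto
  then show ?thesis
    using bump_integral_tendsto[of "\<lambda>x. 1 :: real" a b] assms by simp
qed

text \<open>A combination of two bumps with integral zero is the derivative of a test function. In the limit this compares the increments of the
  primitive of \<open>w\<close> over two intervals: they are proportional to the lengths, so the primitive is affine.\<close>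

lemma du_Bois_Reymond:
  fixes w :: "real \<Rightarrow> 'a::{banach, second_countable_topology}"
  assumes w: "integrable unit_meas w"
    and z: "\<And>\<phi>. test_function \<phi> \<Longrightarrow> (LINT x|unit_meas. deriv \<phi> x *\<^sub>R w x) = 0"
  shows "\<exists>k. AE x in unit_meas. w x = k"
proof -
  \<comment> \<open>A fixed reference interval, with which all others are compared.\<close>
  define a0 b0 :: real where "a0 = 1/4" and "b0 = 3/4"
  define k where "k = 2 *\<^sub>R (prim w b0 - prim w a0)"
  have eq: "prim w b - prim w a = (b - a) *\<^sub>R k" if ab: "0 < a" "a < b" "b < 1" for a b
  proof -
    define I J where "I n = (LINT x|unit_meas. bump n a b x)" and "J n = (LINT x|unit_meas. bump n a0 b0 x)" for n
    have "J n *\<^sub>R (LINT x|unit_meas. bump n a b x *\<^sub>R w x) = I n *\<^sub>R (LINT x|unit_meas. bump n a0 b0 x *\<^sub>R w x)" for n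
    proof -
      define f where "f x = J n * bump n a b x + (- I n) * bump n a0 b0 x" for x
      have sm: "smooth f" unfolding f_def by (rule smooth_bump_lincomb)
      have "(LINT x|unit_meas. f x) = 0"
        by (simp add: f_def integrable_bump I_def J_def Bochner_Integration.integral_diff)
      moreover have "\<And>x. x \<notin> {min a a0..max b b0} \<Longrightarrow> f x = 0"
        using ab unfolding f_def by (subst (1 2) bump_eq_0) (auto simp: a0_def b0_def)
      moreover have "0 < min a a0" "max b b0 < 1" using ab by (auto simp: a0_def b0_def)
      ultimately have "(LINT x|unit_meas. f x *\<^sub>R w x) = 0"
        using test_function_antiderivative[OF sm, of "min a a0" "max b b0"] z[of "prim f"] by presburger
      moreover have i: "integrable unit_meas (\<lambda>x. bump n a b x *\<^sub>R w x)" for a b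
      proof (rule Bochner_Integration.integrable_bound[OF w])
        show "(\<lambda>x. bump n a b x *\<^sub>R w x) \<in> borel_measurable unit_meas"
          using integrable_bump w by (intro borel_measurable_scaleR borel_measurable_integrable)
        show "AE x in unit_meas. norm (bump n a b x *\<^sub>R w x) \<le> norm (w x)"
          using bump_range[of n a b] by (intro AE_I2) (simp add: mult_left_le_one_le)
      qed
      ultimately show ?thesis
        by (simp add: f_def scaleR_diff_left Bochner_Integration.integral_diff flip: scaleR_scaleR)
    qed
    moreover have "(\<lambda>n. J n *\<^sub>R (LINT x|unit_meas. bump n a b x *\<^sub>R w x)) \<longlonglongrightarrow> (b0 - a0) *\<^sub>R (prim w b - prim w a)"
      "(\<lambda>n. I n *\<^sub>R (LINT x|unit_meas. bump n a0 b0 x *\<^sub>R w x)) \<longlonglongrightarrow> (b - a) *\<^sub>R (prim w b0 - prim w a0)"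
      unfolding I_def J_def
      by (intro tendsto_scaleR bump_integral_tendsto w integral_bump_tendsto;
          use ab in \<open>simp add: a0_def b0_def\<close>)+
    ultimately have "(b0 - a0) *\<^sub>R (prim w b - prim w a) = (b - a) *\<^sub>R (prim w b0 - prim w a0)"
      by (simp only: LIMSEQ_unique)
    then have "2 *\<^sub>R (b0 - a0) *\<^sub>R (prim w b - prim w a) = (b - a) *\<^sub>R k"
      by (simp add: k_def)
    then show ?thesis by (simp add: a0_def b0_def)
  qed
  have "AE x in unit_meas. w x - k = 0"
  proof (rule AE_zero_if_prim_constant)
    fix a b :: real assume ab: "0 < a" "a < b" "b < 1"
    have "prim (\<lambda>x. k) x = x *\<^sub>R k" if "x \<in> {0..1}" for x
    proof -
      have "prim (\<lambda>x. 1 :: real) x = x" using that by (subst prim_eq_integral) auto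
      then show ?thesis
        using prim_bounded_linear[OF bounded_linear_scaleR_left[of k], of "\<lambda>x. 1 :: real" x] by simp
    qed
    then show "prim (\<lambda>x. w x - k) a = prim (\<lambda>x. w x - k) b"
      using eq[OF ab] ab by (simp add: prim_diff w algebra_simps)
  qed (use w in auto)
  then show ?thesis by (auto intro!: exI[of _ k])
qed

section \<open>Sobolev functions as primitives\<close>

text \<open>An element of \<open>H1\<close> is handled through its continuous representative \<open>u\<close>, paired with one of its weak derivatives \<open>v\<close>. In this form functions can be
  glued and limits can be taken without reference to test functions.\<close>

definition sobolev_pair :: "(real \<Rightarrow> complex) \<Rightarrow> (real \<Rightarrow> complex) \<Rightarrow> bool" where
  "sobolev_pair u v \<longleftrightarrow> in_Lp 2 v \<and> (\<forall>x\<in>{0..1}. u x = u 0 + prim v x)"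

definition sq_norm :: "(real \<Rightarrow> complex) \<Rightarrow> real" where
  "sq_norm f = (LINT x|unit_meas. (cmod (f x))\<^sup>2)"

definition pot :: "real \<Rightarrow> (real \<Rightarrow> complex) \<Rightarrow> real" where
  "pot p u = (LINT x|unit_meas. cmod (u x) powr p)"

definition pair_energy :: "real \<Rightarrow> (real \<Rightarrow> complex) \<Rightarrow> (real \<Rightarrow> complex) \<Rightarrow> real" where
  "pair_energy p u v = 1 / 2 * sq_norm v - 1 / p * pot p u"

definition minimiser :: "real \<Rightarrow> real \<Rightarrow> (real \<Rightarrow> complex) \<Rightarrow> (real \<Rightarrow> complex) \<Rightarrow> bool" where
  "minimiser p \<mu> u v \<longleftrightarrow> sobolev_pair u v \<and> sq_norm u = \<mu> \<and>
     (\<forall>w z. sobolev_pair w z \<and> sq_norm w = \<mu> \<longrightarrow> pair_energy p u v \<le> pair_energy p w z)"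

lemma powr_2_cmod [simp]: "cmod z powr 2 = (cmod z)\<^sup>2"
  by (simp add: powr_numeral)

lemma in_L2_iff:
  "in_Lp 2 v \<longleftrightarrow> v \<in> borel_measurable unit_meas \<and> integrable unit_meas (\<lambda>x. (cmod (v x))\<^sup>2)"
  by (simp add: in_Lp_def)

lemma in_L2_measurable: "in_Lp 2 v \<Longrightarrow> v \<in> borel_measurable unit_meas"
  by (simp add: in_L2_iff)

lemma in_L2_sq_integrable: "in_Lp 2 v \<Longrightarrow> integrable unit_meas (\<lambda>x. (cmod (v x))\<^sup>2)"
  by (simp add: in_L2_iff)

lemma in_L2_integrable:
  assumes "in_Lp 2 v"
  shows "integrable unit_meas v"
proof (rule Bochner_Integration.integrable_bound)
  show "integrable unit_meas (\<lambda>x. 1 + (cmod (v x))\<^sup>2)"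
    using in_L2_sq_integrable[OF assms] by simp
  have "cmod z \<le> 1 + (cmod z)\<^sup>2" for z
  proof -
    have "0 \<le> (cmod z - 1)\<^sup>2 + (cmod z)^2 + 1" by simp
    then show ?thesis by (simp add: power2_eq_square algebra_simps)
  qed
  then show "AE x in unit_meas. norm (v x) \<le> norm (1 + (cmod (v x))\<^sup>2)"
    by (intro AE_I2) simp
qed (use in_L2_measurable[OF assms] in auto)

lemma in_L2_bounded:
  assumes "v \<in> borel_measurable unit_meas" "\<And>x. x \<in> {0<..<1} \<Longrightarrow> cmod (v x) \<le> B"
  shows "in_Lp 2 v"
  unfolding in_L2_iff
proof
  show "integrable unit_meas (\<lambda>x. (cmod (v x))\<^sup>2)"
    by (rule integrable_unit_bounded[of _ "B^2"]) (use assms in \<open>auto intro!: power_mono\<close>)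
qed (use assms in auto)

lemma in_L2_add:
  assumes "in_Lp 2 v" "in_Lp 2 w"
  shows "in_Lp 2 (\<lambda>x. v x + w x)"
  unfolding in_L2_iff
proof
  have [measurable]: "v \<in> borel_measurable unit_meas" "w \<in> borel_measurable unit_meas"
    using assms in_L2_measurable by auto
  show "(\<lambda>x. v x + w x) \<in> borel_measurable unit_meas" by measurable
  show "integrable unit_meas (\<lambda>x. (cmod (v x + w x))\<^sup>2)"
  proof (rule Bochner_Integration.integrable_bound)
    show "integrable unit_meas (\<lambda>x. 2 * (cmod (v x))\<^sup>2 + 2 * (cmod (w x))\<^sup>2)"
      using assms in_L2_sq_integrable by auto
    have "(cmod (a + b))\<^sup>2 \<le> 2 * (cmod a)\<^sup>2 + 2 * (cmod b)\<^sup>2" for a b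
    proof -
      have "(cmod (a + b))\<^sup>2 \<le> (cmod a + cmod b)\<^sup>2" by (intro power_mono norm_triangle_ineq) auto
      also have "\<dots> \<le> 2 * (cmod a)\<^sup>2 + 2 * (cmod b)\<^sup>2"
        using zero_le_power2[of "cmod a - cmod b"] by (simp add: power2_eq_square algebra_simps)
      finally show ?thesis .
    qed
    then show "AE x in unit_meas. norm ((cmod (v x + w x))\<^sup>2) \<le> norm (2 * (cmod (v x))\<^sup>2 + 2 * (cmod (w x))\<^sup>2)"
      by (intro AE_I2) simp
  qed measurable
qed

lemma in_L2_mult:
  assumes "in_Lp 2 v" shows "in_Lp 2 (\<lambda>x. c * v x)"
  using assms by (auto simp: in_L2_iff norm_mult power_mult_distrib)

lemma in_L2_scaleR:
  assumes "in_Lp 2 v" shows "in_Lp 2 (\<lambda>x. r *\<^sub>R v x)"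
  using in_L2_mult[OF assms, of "of_real r"] by (simp add: scaleR_conv_of_real)

lemma in_L2_diff:
  assumes "in_Lp 2 v" "in_Lp 2 w"
  shows "in_Lp 2 (\<lambda>x. v x - w x)"
  using in_L2_add[OF assms(1) in_L2_scaleR[OF assms(2), of "-1"]] by simp

lemma in_L2_inner_integrable:
  assumes "in_Lp 2 v" "in_Lp 2 w"
  shows "integrable unit_meas (\<lambda>x. v x \<bullet> w x)"
proof (rule Bochner_Integration.integrable_bound)
  show "integrable unit_meas (\<lambda>x. (cmod (v x))\<^sup>2 + (cmod (w x))\<^sup>2)"
    using assms in_L2_sq_integrable by auto
  have "\<bar>a \<bullet> b\<bar> \<le> (cmod a)\<^sup>2 + (cmod b)\<^sup>2" for a b
  proof -
    have "\<bar>a \<bullet> b\<bar> \<le> cmod a * cmod b" by (rule Cauchy_Schwarz_ineq2)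
    also have "\<dots> \<le> (cmod a)\<^sup>2 + (cmod b)\<^sup>2"
    proof -
      have "0 \<le> (cmod a - cmod b)\<^sup>2 + (cmod a)^2 + (cmod b)^2" by simp
      then show ?thesis by (simp add: power2_eq_square algebra_simps)
    qed
    finally show ?thesis .
  qed
  then show "AE x in unit_meas. norm (v x \<bullet> w x) \<le> norm ((cmod (v x))\<^sup>2 + (cmod (w x))\<^sup>2)"
    by (intro AE_I2) simp
qed (use assms in_L2_measurable in auto)

lemma sq_norm_nonneg: "0 \<le> sq_norm v"
  unfolding sq_norm_def by (rule Bochner_Integration.integral_nonneg) simp

lemma pot_nonneg: "0 \<le> pot p v"
  unfolding pot_def by (rule Bochner_Integration.integral_nonneg) simp

lemma sq_norm_add_scaled:
  assumes "in_Lp 2 v" "in_Lp 2 w"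
  shows "sq_norm (\<lambda>x. v x + t *\<^sub>R w x) = sq_norm v + 2 * t * (LINT x|unit_meas. v x \<bullet> w x) + t\<^sup>2 * sq_norm w"
proof -
  have "sq_norm (\<lambda>x. v x + t *\<^sub>R w x)
      = (LINT x|unit_meas. (cmod (v x))\<^sup>2 + 2 * t * (v x \<bullet> w x) + t\<^sup>2 * (cmod (w x))\<^sup>2)"
    unfolding sq_norm_def
    by (rule Bochner_Integration.integral_cong)
      (auto simp: power2_norm_eq_inner inner_add_left inner_add_right inner_commute[of "w _" "v _"]
         power2_eq_square[of t] distrib_left)
  then show ?thesis
    using in_L2_inner_integrable[OF assms] assms[THEN in_L2_sq_integrable]
    by (simp add: sq_norm_def)
qed

lemma sq_norm_scaleR: "sq_norm (\<lambda>x. r *\<^sub>R v x) = r\<^sup>2 * sq_norm v"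
  by (simp add: sq_norm_def power_mult_distrib)

lemma sq_norm_cong_AE:
  assumes "AE x in unit_meas. cmod (v x) = cmod (w x)"
    "v \<in> borel_measurable unit_meas" "w \<in> borel_measurable unit_meas"
  shows "sq_norm v = sq_norm w"
  unfolding sq_norm_def by (rule integral_cong_AE) (use assms in auto)

lemma pot_scaleR: "pot p (\<lambda>x. r *\<^sub>R v x) = \<bar>r\<bar> powr p * pot p v"
  by (simp add: pot_def powr_mult)

lemma L1_le_L2:
  assumes "in_Lp 2 v"
  shows "(LINT x|unit_meas. cmod (v x))\<^sup>2 \<le> sq_norm v"
proof -
  define m where "m = (LINT x|unit_meas. cmod (v x))"
  have i: "integrable unit_meas (\<lambda>x. cmod (v x))" using in_L2_integrable[OF assms] by simp
  have "0 \<le> (LINT x|unit_meas. (cmod (v x) - m)\<^sup>2)"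
    by (rule Bochner_Integration.integral_nonneg) simp
  also have "\<dots> = (LINT x|unit_meas. (cmod (v x))\<^sup>2 - 2 * m * cmod (v x) + m\<^sup>2)"
    by (rule Bochner_Integration.integral_cong) (auto simp: power2_eq_square algebra_simps)
  also have "\<dots> = sq_norm v - 2 * m * m + m\<^sup>2"
    using i in_L2_sq_integrable[OF assms] by (simp add: sq_norm_def measure_unit flip: m_def)
  finally show ?thesis by (simp add: m_def power2_eq_square)
qed

lemma sobolev_pair_eq:
  "sobolev_pair u v \<Longrightarrow> x \<in> {0..1} \<Longrightarrow> u x = u 0 + prim v x"
  unfolding sobolev_pair_def by blast

lemma sobolev_pair_continuous:
  assumes "sobolev_pair u v" shows "continuous_on {0..1} u"
proof (rule continuous_on_eq)
  show "continuous_on {0..1} (\<lambda>x. u 0 + prim v x)"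
    using assms continuous_prim[OF in_L2_integrable[of v]] continuous_on_subset
    by (intro continuous_intros) (auto simp: sobolev_pair_def)
qed (rule sobolev_pair_eq[OF assms, symmetric])

lemma continuous_bounded:
  fixes u :: "real \<Rightarrow> 'a::real_normed_vector"
  assumes "continuous_on {0..1} u"
  obtains B where "\<And>x. x \<in> {0..1} \<Longrightarrow> norm (u x) \<le> B"
proof -
  have "compact (u ` {0..1})" using assms compact_continuous_image by blast
  then obtain B where "\<forall>x\<in>u ` {0..1}. norm x \<le> B"
    using compact_imp_bounded bounded_iff by blast
  then show ?thesis using that by blast
qed

lemma continuous_measurable_unit:
  fixes u :: "real \<Rightarrow> 'a::euclidean_space"
  assumes "continuous_on {0..1} u" shows "u \<in> borel_measurable unit_meas"
  using integrable_unit_continuous[OF assms] by auto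

lemma continuous_in_L2:
  assumes "continuous_on {0..1} u" shows "in_Lp 2 u"
proof -
  obtain B where "\<And>x. x \<in> {0..1} \<Longrightarrow> norm (u x) \<le> B" by (rule continuous_bounded[OF assms]) blast
  then show ?thesis
    by (intro in_L2_bounded[of _ B] continuous_measurable_unit assms) auto
qed

lemma sobolev_pair_in_L2:
  assumes "sobolev_pair u v" shows "in_Lp 2 u" "in_Lp 2 v"
  using continuous_in_L2[OF sobolev_pair_continuous[OF assms]] assms by (auto simp: sobolev_pair_def)

lemma sobolev_pair_add:
  assumes "sobolev_pair u v" "sobolev_pair w z"
  shows "sobolev_pair (\<lambda>x. u x + w x) (\<lambda>x. v x + z x)"
  unfolding sobolev_pair_def
proof (intro conjI ballI)
  have L: "in_Lp 2 v" "in_Lp 2 z" using assms by (simp_all add: sobolev_pair_def)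
  then show "in_Lp 2 (\<lambda>x. v x + z x)" by (rule in_L2_add)
  fix x :: real assume x: "x \<in> {0..1}"
  show "u x + w x = u 0 + w 0 + prim (\<lambda>x. v x + z x) x"
    using sobolev_pair_eq[OF assms(1) x] sobolev_pair_eq[OF assms(2) x]
      prim_add[OF L[THEN in_L2_integrable], of x] by simp
qed

lemma sobolev_pair_mult:
  assumes "sobolev_pair u v"
  shows "sobolev_pair (\<lambda>x. c * u x) (\<lambda>x. c * v x)"
  unfolding sobolev_pair_def
proof (intro conjI ballI)
  have L: "in_Lp 2 v" using assms by (simp add: sobolev_pair_def)
  then show "in_Lp 2 (\<lambda>x. c * v x)" by (rule in_L2_mult)
  fix x :: real assume x: "x \<in> {0..1}"
  show "c * u x = c * u 0 + prim (\<lambda>x. c * v x) x"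
    using sobolev_pair_eq[OF assms x] prim_bounded_linear[OF bounded_linear_mult_right in_L2_integrable[OF L], of c x]
    by (simp add: distrib_left)
qed

lemma sobolev_pair_scaleR:
  assumes "sobolev_pair u v"
  shows "sobolev_pair (\<lambda>x. r *\<^sub>R u x) (\<lambda>x. r *\<^sub>R v x)"
  using sobolev_pair_mult[OF assms, of "of_real r"] by (simp add: scaleR_conv_of_real)

lemma sobolev_pair_const: "sobolev_pair (\<lambda>x. c) (\<lambda>x. 0)"
  by (auto simp: sobolev_pair_def in_L2_bounded[of _ 0] prim_def)

lemma sobolev_pair_prim:
  assumes "in_Lp 2 v" shows "sobolev_pair (prim v) v"
  using assms prim_nonpos[of 0 v] by (simp add: sobolev_pair_def)

lemma sobolev_pair_has_weak_deriv:
  assumes "sobolev_pair u v" shows "has_weak_deriv u v"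
  unfolding has_weak_deriv_def
proof (intro allI impI)
  fix \<phi> assume t: "test_function \<phi>"
  have sm: "smooth \<phi>" using t by (simp add: test_function_def smooth_def)
  have d: "(\<phi> has_real_derivative deriv \<phi> x) (at x)" for x
    using sm unfolding smooth_def by (metis DERIV_deriv_iff_real_differentiable funpow_0)
  have "(deriv ^^ 1) \<phi> differentiable (at x)" for x using sm unfolding smooth_def by blast
  then have cd: "continuous_on S (deriv \<phi>)" for S
    by (simp add: continuous_at_imp_continuous_on differentiable_imp_continuous_within)
  have z: "\<phi> x = 0" if "x \<notin> {0<..<1}" for x
    using t that closure_subset[of "{x. \<phi> x \<noteq> 0}"] by (auto simp: test_function_def)
  have id: "integrable unit_meas (deriv \<phi>)" by (rule integrable_unit_continuous[OF cd])
  have p: "prim (deriv \<phi>) x = \<phi> x" if "x \<in> {0..1}" for x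
  proof -
    have "(deriv \<phi> has_integral \<phi> x - \<phi> 0) {0..x}"
      by (rule fundamental_theorem_of_calculus)
        (use that d in \<open>auto simp: has_real_derivative_iff_has_vector_derivative[symmetric] intro: has_field_derivative_at_within\<close>)
    then show ?thesis using z[of 0] that by (simp add: prim_eq_integral id integral_unique)
  qed
  have v: "in_Lp 2 v" using assms by (simp add: sobolev_pair_def)
  have iv: "integrable unit_meas v" by (rule in_L2_integrable[OF v])
  have "(LINT x|unit_meas. deriv \<phi> x *\<^sub>R u x) = (LINT x|unit_meas. deriv \<phi> x *\<^sub>R u 0 + deriv \<phi> x *\<^sub>R prim v x)"
    by (rule Bochner_Integration.integral_cong)
      (simp_all flip: scaleR_add_right add: sobolev_pair_eq[OF assms, symmetric])
  also have "\<dots> = (LINT x|unit_meas. deriv \<phi> x *\<^sub>R u 0) + (LINT x|unit_meas. deriv \<phi> x *\<^sub>R prim v x)"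
  proof (rule Bochner_Integration.integral_add)
    have "continuous_on {0..1} (\<lambda>x. deriv \<phi> x *\<^sub>R prim v x)"
      using continuous_prim[OF iv] continuous_on_subset by (intro continuous_intros cd) blast
    then show "integrable unit_meas (\<lambda>x. deriv \<phi> x *\<^sub>R prim v x)" by (rule integrable_unit_continuous)
  qed (use id in auto)
  also have "(LINT x|unit_meas. deriv \<phi> x *\<^sub>R u 0) = 0"
    using id prim_ge_1[of 1 "deriv \<phi>"] p[of 1] z[of 1] by simp
  also have "(LINT x|unit_meas. deriv \<phi> x *\<^sub>R prim v x) = - (LINT x|unit_meas. \<phi> x *\<^sub>R v x)"
  proof -
    have "(LINT x|unit_meas. prim (deriv \<phi>) x *\<^sub>R v x) = (LINT x|unit_meas. \<phi> x *\<^sub>R v x)"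
      by (rule Bochner_Integration.integral_cong) (auto simp: p)
    then show ?thesis
      using integration_by_parts_prim[OF bounded_bilinear_scaleR id iv] p[of 1] z[of 1]
      by (simp add: eq_neg_iff_add_eq_0)
  qed
  finally show "(LINT x|unit_meas. deriv \<phi> x *\<^sub>R u x) = - (LINT x|unit_meas. \<phi> x *\<^sub>R v x)" by simp
qed

lemma integrable_test_function_scaleR:
  fixes v :: "real \<Rightarrow> complex"
  assumes "continuous_on UNIV \<phi>" "integrable unit_meas v"
  shows "integrable unit_meas (\<lambda>x. \<phi> x *\<^sub>R v x)"
proof -
  obtain B where B: "\<And>x. x \<in> {0..1} \<Longrightarrow> norm (\<phi> x) \<le> B"
    using continuous_bounded[of \<phi>] assms(1) continuous_on_subset by blast
  show ?thesis
  proof (rule Bochner_Integration.integrable_bound)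
    show "integrable unit_meas (\<lambda>x. B * norm (v x))" using assms by simp
    have "\<phi> \<in> borel_measurable unit_meas"
      using continuous_measurable_unit continuous_on_subset[OF assms(1)] by blast
    then show "(\<lambda>x. \<phi> x *\<^sub>R v x) \<in> borel_measurable unit_meas"
      using assms(2) by auto
    show "AE x in unit_meas. norm (\<phi> x *\<^sub>R v x) \<le> norm (B * norm (v x))"
    proof (rule AE_I2)
      fix x :: real assume "x \<in> space unit_meas"
      then have "norm (\<phi> x) \<le> B" using B by simp
      then show "norm (\<phi> x *\<^sub>R v x) \<le> norm (B * norm (v x))"
        by (auto simp: abs_mult intro!: mult_right_mono)
    qed
  qed
qed

lemma test_function_continuous:
  assumes "test_function \<phi>"
  shows "continuous_on UNIV \<phi>" "continuous_on UNIV (deriv \<phi>)"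
proof -
  have s: "smooth \<phi>" using assms by (simp add: test_function_def smooth_def)
  show "continuous_on UNIV \<phi>" by (rule continuous_on_smooth[OF s])
  have "(deriv ^^ 1) \<phi> differentiable (at x)" for x using s unfolding smooth_def by blast
  then show "continuous_on UNIV (deriv \<phi>)"
    by (simp add: continuous_at_imp_continuous_on differentiable_imp_continuous_within)
qed

lemma weak_deriv_unique:
  assumes "has_weak_deriv u v" "has_weak_deriv u w" "in_Lp 2 v" "in_Lp 2 w"
  shows "AE x in unit_meas. v x = w x"
proof -
  have iv: "integrable unit_meas v" "integrable unit_meas w" using assms in_L2_integrable by auto
  have "AE x in unit_meas. v x - w x = 0"
  proof (rule fundamental_lemma_calculus_of_variations)
    show "integrable unit_meas (\<lambda>x. v x - w x)" using iv by simp
    fix \<phi> assume t: "test_function \<phi>"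
    have "(LINT x|unit_meas. \<phi> x *\<^sub>R v x) = (LINT x|unit_meas. \<phi> x *\<^sub>R w x)"
    proof -
      have "(LINT x|unit_meas. deriv \<phi> x *\<^sub>R u x) = - (LINT x|unit_meas. \<phi> x *\<^sub>R v x)"
        "(LINT x|unit_meas. deriv \<phi> x *\<^sub>R u x) = - (LINT x|unit_meas. \<phi> x *\<^sub>R w x)"
        using assms(1,2) t unfolding has_weak_deriv_def by blast+
      then show ?thesis by simp
    qed
    then show "(LINT x|unit_meas. \<phi> x *\<^sub>R (v x - w x)) = 0"
      using integrable_test_function_scaleR[OF test_function_continuous(1)[OF t]] iv
      by (simp add: scaleR_diff_right)
  qed
  then show ?thesis by simp
qed

text \<open>The difference of \<open>w\<close> and the primitive of \<open>v\<close> has weak derivative zero, so it is constant by du Bois-Reymond.\<close>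

lemma H1_primitive:
  assumes "in_Lp 2 w" "in_Lp 2 v" "has_weak_deriv w v"
  shows "\<exists>u. sobolev_pair u v \<and> (AE x in unit_meas. w x = u x)"
proof -
  have iw: "integrable unit_meas w" using assms in_L2_integrable by auto
  have ip: "integrable unit_meas (prim v)"
    using continuous_prim[OF in_L2_integrable[OF assms(2)]] continuous_on_subset
    by (blast intro: integrable_unit_continuous)
  have "\<exists>k. AE x in unit_meas. w x - prim v x = k"
  proof (rule du_Bois_Reymond)
    show "integrable unit_meas (\<lambda>x. w x - prim v x)" using iw ip by simp
    fix \<phi> assume t: "test_function \<phi>"
    have "(LINT x|unit_meas. deriv \<phi> x *\<^sub>R w x) = (LINT x|unit_meas. deriv \<phi> x *\<^sub>R prim v x)"
      using assms(3) sobolev_pair_has_weak_deriv[OF sobolev_pair_prim[OF assms(2)]] t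
      by (simp add: has_weak_deriv_def)
    then show "(LINT x|unit_meas. deriv \<phi> x *\<^sub>R (w x - prim v x)) = 0"
      using integrable_test_function_scaleR[OF test_function_continuous(2)[OF t]] iw ip
      by (simp add: scaleR_diff_right)
  qed
  then obtain k where k: "AE x in unit_meas. w x - prim v x = k" by blast
  have "sobolev_pair (\<lambda>x. k + prim v x) (\<lambda>x. 0 + v x)"
    by (intro sobolev_pair_add sobolev_pair_const sobolev_pair_prim assms)
  moreover have "AE x in unit_meas. w x = k + prim v x"
    using k by eventually_elim (auto simp: algebra_simps)
  ultimately show ?thesis by (intro exI[of _ "\<lambda>x. k + prim v x"]) auto
qed

lemma Lp_norm_2_eq: "(Lp_norm 2 f)\<^sup>2 = sq_norm f"
  using sq_norm_nonneg[of f] unfolding Lp_norm_def sq_norm_def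
  by (simp add: powr_half_sqrt)

lemma Lp_norm_powr: "p \<noteq> 0 \<Longrightarrow> Lp_norm p f powr p = pot p f"
  using pot_nonneg[of p f] unfolding Lp_norm_def pot_def by (simp add: powr_powr)

lemma energy_eq_pair_energy:
  assumes "sobolev_pair u v" "w \<in> borel_measurable unit_meas" "AE x in unit_meas. w x = u x" "p \<noteq> 0"
  shows "w \<in> H1" "sq_norm w = sq_norm u" "energy p w = pair_energy p u v"
proof -
  have mu: "u \<in> borel_measurable unit_meas"
    using sobolev_pair_continuous[OF assms(1)] continuous_measurable_unit by blast
  have mw: "w \<in> borel_measurable unit_meas" by fact
  have v: "in_Lp 2 v" using assms(1) by (simp add: sobolev_pair_def)
  have wd: "has_weak_deriv w v"
    unfolding has_weak_deriv_def
  proof (intro allI impI)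
    fix \<phi> assume t: "test_function \<phi>"
    have "(LINT x|unit_meas. deriv \<phi> x *\<^sub>R w x) = (LINT x|unit_meas. deriv \<phi> x *\<^sub>R u x)"
    proof (rule integral_cong_AE)
      have "deriv \<phi> \<in> borel_measurable unit_meas"
        using continuous_measurable_unit continuous_on_subset[OF test_function_continuous(2)[OF t]] by blast
      then show "(\<lambda>x. deriv \<phi> x *\<^sub>R w x) \<in> borel_measurable unit_meas"
        "(\<lambda>x. deriv \<phi> x *\<^sub>R u x) \<in> borel_measurable unit_meas" using mu mw by auto
      show "AE x in unit_meas. deriv \<phi> x *\<^sub>R w x = deriv \<phi> x *\<^sub>R u x"
        using assms(3) by eventually_elim simp
    qed
    then show "(LINT x|unit_meas. deriv \<phi> x *\<^sub>R w x) = - (LINT x|unit_meas. \<phi> x *\<^sub>R v x)"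
      using sobolev_pair_has_weak_deriv[OF assms(1)] t by (simp add: has_weak_deriv_def)
  qed
  have ae: "AE x in unit_meas. cmod (w x) = cmod (u x)" using assms(3) by eventually_elim simp
  have uL: "in_Lp 2 u" using sobolev_pair_in_L2 assms(1) by blast
  have w2: "in_Lp 2 w"
    unfolding in_L2_iff
  proof
    have "AE x in unit_meas. (cmod (w x))\<^sup>2 = (cmod (u x))\<^sup>2" using ae by eventually_elim simp
    then show "integrable unit_meas (\<lambda>x. (cmod (w x))\<^sup>2)"
      using in_L2_sq_integrable[OF uL] mw mu
      by (subst integrable_cong_AE[where g = "\<lambda>x. (cmod (u x))\<^sup>2"]) auto
  qed (rule mw)
  show "w \<in> H1" using w2 v wd by (auto simp: H1_def)
  show s: "sq_norm w = sq_norm u" by (rule sq_norm_cong_AE[OF ae mw mu])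
  have wk: "in_Lp 2 (weak_deriv w) \<and> has_weak_deriv w (weak_deriv w)"
    unfolding weak_deriv_def by (rule someI[of _ v]) (use v wd in blast)
  have "AE x in unit_meas. weak_deriv w x = v x"
    using weak_deriv_unique wk v wd by blast
  then have "AE x in unit_meas. cmod (weak_deriv w x) = cmod (v x)" by eventually_elim simp
  then have "sq_norm (weak_deriv w) = sq_norm v"
    by (rule sq_norm_cong_AE) (use wk v in_L2_measurable in auto)
  moreover have "pot p w = pot p u"
    unfolding pot_def
    by (rule integral_cong_AE) (use mw mu ae in \<open>auto elim: eventually_mono\<close>)
  ultimately show "energy p w = pair_energy p u v"
    by (simp add: energy_def pair_energy_def Lp_norm_2_eq Lp_norm_powr assms)
qed

lemma H1_pair:
  assumes "w \<in> H1" "p \<noteq> 0"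
  obtains u v where "sobolev_pair u v" "AE x in unit_meas. w x = u x" "sq_norm w = sq_norm u" "energy p w = pair_energy p u v"
proof -
  obtain v where v: "in_Lp 2 w" "in_Lp 2 v" "has_weak_deriv w v" using assms by (auto simp: H1_def)
  from H1_primitive[OF this] obtain u where u: "sobolev_pair u v" "AE x in unit_meas. w x = u x" by blast
  note e = energy_eq_pair_energy[OF u(1) in_L2_measurable[OF v(1)] u(2) assms(2)]
  show ?thesis by (rule that[OF u e(2,3)])
qed

lemma ground_state_if_minimiser:
  assumes "minimiser p \<mu> u v" "p \<noteq> 0"
  shows "energy_ground_state p \<mu> u"
proof -
  have sp: "sobolev_pair u v" and mass: "sq_norm u = \<mu>"
    and min: "\<And>w z. sobolev_pair w z \<Longrightarrow> sq_norm w = \<mu> \<Longrightarrow> pair_energy p u v \<le> pair_energy p w z"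
    using assms(1) by (auto simp: minimiser_def)
  have u: "u \<in> H1" "energy p u = pair_energy p u v"
    using energy_eq_pair_energy[OF sp _ _ assms(2), of u] in_L2_measurable sobolev_pair_in_L2(1)[OF sp] by auto
  have mem: "u \<in> H1_mass \<mu>" using u(1) mass by (simp add: H1_mass_def Lp_norm_2_eq)
  moreover have "ereal (energy p u) = (INF v\<in>H1_mass \<mu>. ereal (energy p v))"
  proof (rule antisym)
    show "ereal (energy p u) \<le> (INF v\<in>H1_mass \<mu>. ereal (energy p v))"
    proof (rule INF_greatest)
      fix w assume "w \<in> H1_mass \<mu>"
      then have w: "w \<in> H1" "sq_norm w = \<mu>" by (auto simp: H1_mass_def Lp_norm_2_eq)
      obtain u' v' where "sobolev_pair u' v'" "sq_norm w = sq_norm u'" "energy p w = pair_energy p u' v'"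
        by (rule H1_pair[OF w(1) assms(2)])
      then show "ereal (energy p u) \<le> ereal (energy p w)" using min w(2) u(2) by simp
    qed
    show "(INF v\<in>H1_mass \<mu>. ereal (energy p v)) \<le> ereal (energy p u)"
      by (rule INF_lower[OF mem])
  qed
  ultimately show ?thesis by (simp add: energy_ground_state_def)
qed

lemma minimiser_if_ground_state:
  assumes "energy_ground_state p \<mu> w" "p \<noteq> 0"
  obtains u v where "minimiser p \<mu> u v" "AE x in unit_meas. w x = u x"
proof -
  have w: "w \<in> H1" "sq_norm w = \<mu>" and inf: "ereal (energy p w) = (INF v\<in>H1_mass \<mu>. ereal (energy p v))"
    using assms(1) by (auto simp: energy_ground_state_def H1_mass_def Lp_norm_2_eq)
  obtain u v where uv: "sobolev_pair u v" "AE x in unit_meas. w x = u x" "sq_norm w = sq_norm u" "energy p w = pair_energy p u v"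
    by (rule H1_pair[OF w(1) assms(2)])
  have "pair_energy p u v \<le> pair_energy p w' z'" if "sobolev_pair w' z'" "sq_norm w' = \<mu>" for w' z'
  proof -
    have "w' \<in> H1" "energy p w' = pair_energy p w' z'"
      using energy_eq_pair_energy[OF that(1) _ _ assms(2), of w'] in_L2_measurable sobolev_pair_in_L2(1)[OF that(1)] by auto
    moreover from this that have "w' \<in> H1_mass \<mu>" by (simp add: H1_mass_def Lp_norm_2_eq)
    then have "(INF v\<in>H1_mass \<mu>. ereal (energy p v)) \<le> ereal (energy p w')" by (rule INF_lower)
    ultimately show ?thesis using inf uv(4) by (metis ereal_less_eq(3))
  qed
  then have "minimiser p \<mu> u v" using uv w by (simp add: minimiser_def)
  then show ?thesis by (rule that[OF _ uv(2)])
qed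

section \<open>Completeness of the space of square integrable functions\<close>

lemma Cauchy_Schwarz_L2:
  assumes "in_Lp 2 v" "in_Lp 2 w"
  shows "(LINT x|unit_meas. v x \<bullet> w x)\<^sup>2 \<le> sq_norm v * sq_norm w"
proof -
  define I where "I = (LINT x|unit_meas. v x \<bullet> w x)"
  have q: "0 \<le> sq_norm v + 2 * t * I + t\<^sup>2 * sq_norm w" for t
    using sq_norm_nonneg[of "\<lambda>x. v x + t *\<^sub>R w x"] sq_norm_add_scaled[OF assms, of t] by (simp add: I_def)
  show ?thesis
  proof (cases "sq_norm w = 0")
    case True
    have "I = 0"
    proof (rule ccontr)
      assume "I \<noteq> 0"
      then show False using q[of "- (sq_norm v + 1) / (2 * I)"] True by (simp add: field_simps)
    qed
    then show ?thesis using True by (simp add: I_def)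
  next
    case False
    then have "sq_norm w > 0" using sq_norm_nonneg[of w] by linarith
    then show ?thesis using q[of "- I / sq_norm w"]
      by (simp add: I_def[symmetric] power2_eq_square field_simps)
  qed
qed

lemma sq_norm_of_real: "sq_norm (\<lambda>x. complex_of_real (f x)) = (LINT x|unit_meas. (f x)\<^sup>2)"
  by (simp add: sq_norm_def)

lemma sobolev_pair_holder:
  assumes "sobolev_pair u v" "x \<in> {0..1}" "y \<in> {0..1}"
  shows "cmod (u x - u y) \<le> sqrt (sq_norm v * \<bar>x - y\<bar>)"
proof -
  have v: "in_Lp 2 v" using assms(1) by (simp add: sobolev_pair_def)
  have iv: "integrable unit_meas v" by (rule in_L2_integrable[OF v])
  have le: "cmod (u y - u x) \<le> sqrt (sq_norm v * (y - x))" if "x \<le> y" "x \<in> {0..1}" "y \<in> {0..1}" for x y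
  proof -
    let ?E = "indicat_real {x<..y}"
    have iE: "integrable unit_meas ?E"
      using integrable_indicator_unit[of "\<lambda>x. 1 :: real" "{x<..y}"] by simp
    have "prim (\<lambda>x. 1 :: real) z = z" if "z \<in> {0..1}" for z
      using that by (subst prim_eq_integral) auto
    then have mE: "(LINT z|unit_meas. ?E z) = y - x"
      using prim_minus_prim[of "\<lambda>x. 1 :: real" x y] that by simp
    have L: "in_Lp 2 (\<lambda>z. complex_of_real (?E z))" "in_Lp 2 (\<lambda>z. complex_of_real (cmod (v z)))"
      using iE in_L2_measurable[OF v] in_L2_sq_integrable[OF v]
      by (auto simp: in_L2_iff indicator_def power2_eq_square intro!: integrable_unit_bounded[of _ 1])
    have "u y - u x = (LINT z|unit_meas. ?E z *\<^sub>R v z)"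
      using sobolev_pair_eq[OF assms(1) that(2)] sobolev_pair_eq[OF assms(1) that(3)]
        prim_minus_prim[OF iv that(1)] by simp
    then have "cmod (u y - u x) \<le> (LINT z|unit_meas. norm (?E z *\<^sub>R v z))"
      using integral_norm_bound by metis
    also have "\<dots> = (LINT z|unit_meas. complex_of_real (?E z) \<bullet> complex_of_real (cmod (v z)))"
      by (rule Bochner_Integration.integral_cong) (auto simp: inner_complex_def)
    finally have 1: "cmod (u y - u x) \<le> (LINT z|unit_meas. complex_of_real (?E z) \<bullet> complex_of_real (cmod (v z)))" .
    have "(cmod (u y - u x))\<^sup>2 \<le> (LINT z|unit_meas. complex_of_real (?E z) \<bullet> complex_of_real (cmod (v z)))\<^sup>2"
      by (rule power_mono[OF 1]) simp
    also have "\<dots> \<le> (LINT z|unit_meas. (?E z)\<^sup>2) * sq_norm v"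
      using Cauchy_Schwarz_L2[OF L] unfolding sq_norm_of_real by (simp add: sq_norm_def)
    also have "(LINT z|unit_meas. (?E z)\<^sup>2) = y - x"
      using mE by (simp add: power2_eq_square flip: indicator_inter_arith)
    finally show ?thesis by (simp add: real_le_rsqrt mult.commute)
  qed
  show ?thesis
    using le[of x y] le[of y x] assms by (cases "x \<le> y") (auto simp: norm_minus_commute abs_minus_commute)
qed

lemma convergent_if_summable_increments:
  fixes W :: "nat \<Rightarrow> 'a::banach"
  assumes "summable (\<lambda>k. norm (W (Suc k) - W k))"
  shows "convergent W"
proof -
  have "summable (\<lambda>k. W (Suc k) - W k)" using summable_norm_cancel[OF assms] .
  then have "convergent (\<lambda>n. \<Sum>k<n. W (Suc k) - W k)" by (simp add: summable_iff_convergent)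
  then have "convergent (\<lambda>n. W n - W 0)" by (simp add: sum_lessThan_telescope)
  then have "convergent (\<lambda>n. (W n - W 0) + W 0)" by (intro convergent_add convergent_const)
  then show ?thesis by simp
qed

text \<open>The Riesz-Fischer theorem: a subsequence with summable increments converges almost everywhere, and Fatou's lemma turns the Cauchy estimate into an
  estimate for the distance of the whole sequence to the limit.\<close>

lemma L2_complete:
  fixes V :: "nat \<Rightarrow> real \<Rightarrow> complex"
  assumes L: "\<And>n. in_Lp 2 (V n)"
    and C: "\<And>e. e > 0 \<Longrightarrow> \<exists>N. \<forall>n\<ge>N. \<forall>m\<ge>N. sq_norm (\<lambda>x. V n x - V m x) \<le> e"
  shows "\<exists>v. in_Lp 2 v \<and> (\<lambda>n. sq_norm (\<lambda>x. V n x - v x)) \<longlonglongrightarrow> 0"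
proof -
  have meas [measurable]: "V n \<in> borel_measurable unit_meas" for n using L in_L2_measurable by blast
  have "\<forall>k. \<exists>N. \<forall>n\<ge>N. \<forall>m\<ge>N. sq_norm (\<lambda>x. V n x - V m x) \<le> (1/4) ^ k"
    by (intro allI C) simp
  from choice[OF this] obtain N where
    N: "\<And>k n m. n \<ge> N k \<Longrightarrow> m \<ge> N k \<Longrightarrow> sq_norm (\<lambda>x. V n x - V m x) \<le> (1/4) ^ k"
    by blast
  define M where "M k = k + (\<Sum>i\<le>k. N i)" for k
  have M: "N k \<le> M k" "M k \<le> M (Suc k)" "k \<le> M k" for k
    using member_le_sum[of k "{..k}" N] by (simp_all add: M_def)
  define W where "W k = V (M k)" for k
  have LW: "in_Lp 2 (W k)" for k using L by (simp add: W_def)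
  have [measurable]: "W k \<in> borel_measurable unit_meas" for k by (simp add: W_def)
  have inc: "(LINT x|unit_meas. cmod (W (Suc k) x - W k x)) \<le> (1/2) ^ k" for k
  proof -
    have "(LINT x|unit_meas. cmod (W (Suc k) x - W k x))\<^sup>2 \<le> sq_norm (\<lambda>x. W (Suc k) x - W k x)"
      by (rule L1_le_L2[OF in_L2_diff[OF LW LW]])
    also have "\<dots> \<le> (1/4) ^ k" unfolding W_def by (rule N) (use M[of k] in linarith)+
    also have "\<dots> = ((1/2) ^ k)\<^sup>2" by (simp add: power_mult_distrib power2_eq_square flip: power_mult_distrib)
    finally show ?thesis by (rule power2_le_imp_le) simp
  qed
  have "(\<integral>\<^sup>+x. (\<Sum>k. ennreal (cmod (W (Suc k) x - W k x))) \<partial>unit_meas)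
      = (\<Sum>k. \<integral>\<^sup>+x. ennreal (cmod (W (Suc k) x - W k x)) \<partial>unit_meas)"
    by (rule nn_integral_suminf) measurable
  also have "\<dots> \<le> (\<Sum>k. ennreal ((1/2) ^ k))"
  proof (rule suminf_le)
    fix k
    have "integrable unit_meas (\<lambda>x. cmod (W (Suc k) x - W k x))"
      using in_L2_integrable[OF in_L2_diff[OF LW LW]] by (rule integrable_norm)
    then have "(\<integral>\<^sup>+x. ennreal (cmod (W (Suc k) x - W k x)) \<partial>unit_meas) = ennreal (LINT x|unit_meas. cmod (W (Suc k) x - W k x))"
      by (rule nn_integral_eq_integral) simp
    then show "(\<integral>\<^sup>+x. ennreal (cmod (W (Suc k) x - W k x)) \<partial>unit_meas) \<le> ennreal ((1/2) ^ k)"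
      using inc by (simp add: ennreal_leI)
  qed auto
  also have "\<dots> = ennreal (\<Sum>k. (1/2) ^ k)"
    by (rule suminf_ennreal2) (auto intro: summable_geometric)
  also have "\<dots> < \<infinity>" by simp
  finally have fin: "(\<integral>\<^sup>+x. (\<Sum>k. ennreal (cmod (W (Suc k) x - W k x))) \<partial>unit_meas) < \<infinity>" .
  have "AE x in unit_meas. (\<Sum>k. ennreal (cmod (W (Suc k) x - W k x))) \<noteq> \<infinity>"
    by (rule nn_integral_PInf_AE) (use fin in \<open>auto simp: less_top\<close>)
  then have conv: "AE x in unit_meas. convergent (\<lambda>k. W k x)"
  proof eventually_elim
    case (elim x)
    then have "summable (\<lambda>k. cmod (W (Suc k) x - W k x))"
      by (intro summable_suminf_not_top) (auto simp: infinity_ennreal_def)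
    then show ?case by (rule convergent_if_summable_increments[of "\<lambda>k. W k x"])
  qed
  define v where "v x = lim (\<lambda>k. W k x)" for x
  have [measurable]: "v \<in> borel_measurable unit_meas" unfolding v_def by measurable
  have lim: "AE x in unit_meas. (\<lambda>k. W k x) \<longlonglongrightarrow> v x"
    using conv by eventually_elim (simp add: v_def convergent_LIMSEQ_iff)
  have key: "integrable unit_meas (\<lambda>x. (cmod (V n x - v x))\<^sup>2) \<and> sq_norm (\<lambda>x. V n x - v x) \<le> e"
    if n: "n \<ge> N0" "\<forall>n\<ge>N0. \<forall>m\<ge>N0. sq_norm (\<lambda>x. V n x - V m x) \<le> e" for n N0 e
  proof -
    have e0: "e \<ge> 0"
      using n(2)[rule_format, OF n(1) n(1)] sq_norm_nonneg[of "\<lambda>x. V n x - V n x"] by linarith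
    have fat: "(\<integral>\<^sup>+x. liminf (\<lambda>k. ennreal ((cmod (V n x - W k x))\<^sup>2)) \<partial>unit_meas)
        \<le> liminf (\<lambda>k. \<integral>\<^sup>+x. ennreal ((cmod (V n x - W k x))\<^sup>2) \<partial>unit_meas)"
      by (rule nn_integral_liminf) measurable
    have "(\<integral>\<^sup>+x. ennreal ((cmod (V n x - v x))\<^sup>2) \<partial>unit_meas)
        = (\<integral>\<^sup>+x. liminf (\<lambda>k. ennreal ((cmod (V n x - W k x))\<^sup>2)) \<partial>unit_meas)"
    proof (rule nn_integral_cong_AE)
      show "AE x in unit_meas. ennreal ((cmod (V n x - v x))\<^sup>2) = liminf (\<lambda>k. ennreal ((cmod (V n x - W k x))\<^sup>2))"
        using lim
      proof eventually_elim
        case (elim x)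
        have "(\<lambda>k. ennreal ((cmod (V n x - W k x))\<^sup>2)) \<longlonglongrightarrow> ennreal ((cmod (V n x - v x))\<^sup>2)"
          by (intro tendsto_ennrealI tendsto_intros elim)
        then show ?case by (rule lim_imp_Liminf[OF trivial_limit_sequentially, symmetric])
      qed
    qed
    also have "\<dots> \<le> liminf (\<lambda>k. \<integral>\<^sup>+x. ennreal ((cmod (V n x - W k x))\<^sup>2) \<partial>unit_meas)" by (rule fat)
    also have "\<dots> \<le> liminf (\<lambda>k. ennreal e)"
    proof (rule Liminf_mono)
      show "\<forall>\<^sub>F k in sequentially. (\<integral>\<^sup>+x. ennreal ((cmod (V n x - W k x))\<^sup>2) \<partial>unit_meas) \<le> ennreal e"
        using eventually_ge_at_top[of N0]
      proof eventually_elim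
        case (elim k)
        have "(\<integral>\<^sup>+x. ennreal ((cmod (V n x - W k x))\<^sup>2) \<partial>unit_meas) = ennreal (sq_norm (\<lambda>x. V n x - W k x))"
          unfolding sq_norm_def
          by (rule nn_integral_eq_integral[OF in_L2_sq_integrable[OF in_L2_diff[OF L LW]]]) simp
        also have "\<dots> \<le> ennreal e"
          using n(2)[rule_format, OF n(1), of "M k"] elim M(3)[of k] unfolding W_def by (intro ennreal_leI) simp
        finally show ?case .
      qed
    qed
    also have "\<dots> = ennreal e" by (simp add: Liminf_const)
    finally have le: "(\<integral>\<^sup>+x. ennreal ((cmod (V n x - v x))\<^sup>2) \<partial>unit_meas) \<le> ennreal e" .
    have i: "integrable unit_meas (\<lambda>x. (cmod (V n x - v x))\<^sup>2)"
      by (rule integrableI_bounded) (use le in \<open>auto simp: le_less_trans ennreal_less_top\<close>)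
    have "ennreal (sq_norm (\<lambda>x. V n x - v x)) \<le> ennreal e"
      using le nn_integral_eq_integral[OF i] by (simp add: sq_norm_def)
    then show ?thesis using i e0 by (simp add: ennreal_le_iff)
  qed
  obtain N1 where N1: "\<forall>n\<ge>N1. \<forall>m\<ge>N1. sq_norm (\<lambda>x. V n x - V m x) \<le> 1" using C[of 1] by auto
  have "in_Lp 2 (\<lambda>x. V N1 x - v x)"
    using key[OF order_refl N1] unfolding in_L2_iff by simp
  then have "in_Lp 2 (\<lambda>x. V N1 x - (V N1 x - v x))" by (rule in_L2_diff[OF L])
  then have "in_Lp 2 v" by simp
  moreover have "(\<lambda>n. sq_norm (\<lambda>x. V n x - v x)) \<longlonglongrightarrow> 0"
  proof (rule LIMSEQ_I)
    fix r :: real assume r: "r > 0"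
    obtain N0 where N0: "\<forall>n\<ge>N0. \<forall>m\<ge>N0. sq_norm (\<lambda>x. V n x - V m x) \<le> r / 2" using C[of "r/2"] r by auto
    have "norm (sq_norm (\<lambda>x. V n x - v x) - 0) < r" if "n \<ge> N0" for n
      using key[OF that N0] r sq_norm_nonneg[of "\<lambda>x. V n x - v x"] by simp
    then show "\<exists>no. \<forall>n\<ge>no. norm (sq_norm (\<lambda>x. V n x - v x) - 0) < r" by blast
  qed
  ultimately show ?thesis by blast
qed

lemma sq_norm_tendsto:
  assumes "\<And>n. in_Lp 2 (V n)" "in_Lp 2 v" "(\<lambda>n. sq_norm (\<lambda>x. V n x - v x)) \<longlonglongrightarrow> 0"
  shows "(\<lambda>n. sq_norm (V n)) \<longlonglongrightarrow> sq_norm v"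
proof -
  define D where "D n = (\<lambda>x. V n x - v x)" for n
  have LD: "in_Lp 2 (D n)" for n unfolding D_def by (rule in_L2_diff) (use assms in auto)
  define I where "I n = (LINT x|unit_meas. v x \<bullet> D n x)" for n
  have eq: "sq_norm (V n) = sq_norm v + 2 * I n + sq_norm (D n)" for n
    using sq_norm_add_scaled[OF assms(2) LD, of 1 n] by (simp add: D_def I_def)
  have D0: "(\<lambda>n. sq_norm (D n)) \<longlonglongrightarrow> 0" using assms(3) by (simp add: D_def)
  have "I \<longlonglongrightarrow> 0"
  proof (rule Lim_null_comparison)
    have "norm (I n) \<le> sqrt (sq_norm v * sq_norm (D n))" for n
      using real_sqrt_le_mono[OF Cauchy_Schwarz_L2[OF assms(2) LD, of n]] by (simp add: I_def)
    then show "\<forall>\<^sub>F n in sequentially. norm (I n) \<le> sqrt (sq_norm v * sq_norm (D n))" by simp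
    have "(\<lambda>n. sqrt (sq_norm v * sq_norm (D n))) \<longlonglongrightarrow> sqrt (sq_norm v * 0)"
      by (intro tendsto_intros D0)
    then show "(\<lambda>n. sqrt (sq_norm v * sq_norm (D n))) \<longlonglongrightarrow> 0" by simp
  qed
  then have "(\<lambda>n. sq_norm v + 2 * I n + sq_norm (D n)) \<longlonglongrightarrow> sq_norm v + 2 * 0 + 0"
    by (intro tendsto_intros D0)
  then show ?thesis by (simp add: eq)
qed

section \<open>Existence of minimisers\<close>

lemma sobolev_pair_sup_bound:
  assumes "sobolev_pair u v" "x \<in> {0..1}"
  shows "(cmod (u x))\<^sup>2 \<le> 2 * sq_norm u + 2 * sq_norm v"
proof -
  have iu: "integrable unit_meas (\<lambda>y. (cmod (u y))\<^sup>2)"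
    using in_L2_sq_integrable sobolev_pair_in_L2(1)[OF assms(1)] by blast
  have "(cmod (u x))\<^sup>2 = (LINT y|unit_meas. (cmod (u x))\<^sup>2)" by (simp add: measure_unit)
  also have "\<dots> \<le> (LINT y|unit_meas. 2 * (cmod (u y))\<^sup>2 + 2 * sq_norm v)"
  proof (rule integral_mono)
    fix y assume "y \<in> space unit_meas"
    then have y: "y \<in> {0..1}" by simp
    have d: "cmod (u x - u y) \<le> sqrt (sq_norm v)"
    proof -
      have "sq_norm v * \<bar>x - y\<bar> \<le> sq_norm v * 1"
        using assms(2) y sq_norm_nonneg by (intro mult_left_mono) auto
      then show ?thesis
        using sobolev_pair_holder[OF assms y] real_sqrt_le_mono order_trans by fastforce
    qed
    have "cmod (u x) \<le> cmod (u y) + sqrt (sq_norm v)"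
      using d norm_triangle_sub[of "u x" "u y"] by linarith
    then have "(cmod (u x))\<^sup>2 \<le> (cmod (u y) + sqrt (sq_norm v))\<^sup>2" by (intro power_mono) auto
    also have "\<dots> \<le> 2 * (cmod (u y))\<^sup>2 + 2 * (sqrt (sq_norm v))\<^sup>2"
      using zero_le_power2[of "cmod (u y) - sqrt (sq_norm v)"] by (simp add: power2_eq_square algebra_simps)
    finally show "(cmod (u x))\<^sup>2 \<le> 2 * (cmod (u y))\<^sup>2 + 2 * sq_norm v"
      using sq_norm_nonneg by simp
  qed (use iu in auto)
  also have "\<dots> = 2 * sq_norm u + 2 * sq_norm v"
    using iu by (simp add: sq_norm_def measure_unit)
  finally show ?thesis .
qed

lemma continuous_powr_cmod:
  assumes "continuous_on S u" "p > 0"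
  shows "continuous_on S (\<lambda>x. cmod (u x) powr p)"
  using assms by (intro continuous_on_powr' continuous_intros) auto

lemma integrable_powr_cmod:
  assumes "continuous_on {0..1} u" "p > 0"
  shows "integrable unit_meas (\<lambda>x. cmod (u x) powr p)"
  by (rule integrable_unit_continuous[OF continuous_powr_cmod[OF assms]])

text \<open>Since \<open>p \<le> 3\<close>, the integrand is at most \<open>\<bar>u\<bar>\<^sup>2 (1 + sup \<bar>u\<bar>)\<close>; the bound is of order one half in the kinetic energy, which makes
  the energy coercive.\<close>

lemma pot_bound:
  assumes "sobolev_pair u v" "2 < p" "p \<le> 3"
  shows "pot p u \<le> sq_norm u * (1 + sqrt (2 * sq_norm u + 2 * sq_norm v))"
proof -
  define B where "B = sqrt (2 * sq_norm u + 2 * sq_norm v)"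
  have iu: "integrable unit_meas (\<lambda>y. (cmod (u y))\<^sup>2)"
    using in_L2_sq_integrable sobolev_pair_in_L2(1)[OF assms(1)] by blast
  have "pot p u \<le> (LINT x|unit_meas. (cmod (u x))\<^sup>2 * (1 + B))"
    unfolding pot_def
  proof (rule integral_mono)
    show "integrable unit_meas (\<lambda>x. cmod (u x) powr p)"
      using assms by (intro integrable_powr_cmod sobolev_pair_continuous) auto
    fix x assume "x \<in> space unit_meas"
    then have x: "x \<in> {0..1}" by simp
    have "cmod (u x) powr (p - 2) \<le> 1 + cmod (u x)"
    proof (cases "cmod (u x) \<le> 1")
      case True
      then have "cmod (u x) powr (p - 2) \<le> 1" using assms by (intro powr_le1) auto
      then show ?thesis by (simp add: add_increasing2)
    next
      case False
      then have "cmod (u x) powr (p - 2) \<le> cmod (u x) powr 1" using assms by (intro powr_mono) auto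
      then show ?thesis by simp
    qed
    also have "cmod (u x) \<le> B"
      unfolding B_def by (rule real_le_rsqrt[OF sobolev_pair_sup_bound[OF assms(1) x]])
    finally have "cmod (u x) powr (p - 2) \<le> 1 + B" by simp
    then have "(cmod (u x))\<^sup>2 * cmod (u x) powr (p - 2) \<le> (cmod (u x))\<^sup>2 * (1 + B)"
      by (intro mult_left_mono) auto
    moreover have "(cmod (u x))\<^sup>2 * cmod (u x) powr (p - 2) = cmod (u x) powr p"
      using powr_add[of "cmod (u x)" 2 "p - 2"] by simp
    ultimately show "cmod (u x) powr p \<le> (cmod (u x))\<^sup>2 * (1 + B)" by simp
  qed (use iu in auto)
  then show ?thesis using iu by (simp add: sq_norm_def B_def)
qed

lemma energy_coercive:
  assumes "sobolev_pair u v" "2 < p" "p \<le> 3"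
  shows "sq_norm v \<le> 4 * pair_energy p u v + 3 * sq_norm u + 2 * (sq_norm u)\<^sup>2"
proof -
  define m k where "m = sq_norm u" and "k = sq_norm v"
  define s where "s = sqrt (2 * m + 2 * k)"
  have nn: "m \<ge> 0" "k \<ge> 0" by (auto simp: m_def k_def sq_norm_nonneg)
  then have s2: "s\<^sup>2 = 2 * m + 2 * k" by (simp add: s_def)
  have "1 / p * pot p u \<le> 1 / 2 * pot p u" using assms pot_nonneg by (intro mult_right_mono) (auto simp: field_simps)
  also have "\<dots> \<le> 1 / 2 * (m * (1 + s))"
    using pot_bound[OF assms] by (simp add: m_def k_def s_def)
  finally have 1: "1 / p * pot p u \<le> 1 / 2 * (m * (1 + s))" .
  have "0 \<le> (s - 2 * m)\<^sup>2" by simp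
  then have "4 * (m * s) \<le> 4 * m\<^sup>2 + s\<^sup>2" by (simp add: power2_eq_square algebra_simps)
  then show ?thesis using 1 s2 unfolding pair_energy_def m_def[symmetric] k_def[symmetric]
    by (simp add: algebra_simps)
qed

lemma pot_tendsto_uniform:
  fixes w :: "'i \<Rightarrow> real \<Rightarrow> complex"
  assumes ul: "uniform_limit {0..1} w g F" and c: "\<And>i. continuous_on {0..1} (w i)"
    and g: "continuous_on {0..1} g" and p: "p > 0" and F: "F \<noteq> bot"
  shows "((\<lambda>i. pot p (w i)) \<longlongrightarrow> pot p g) F"
proof -
  obtain B where B: "\<And>x. x \<in> {0..1} \<Longrightarrow> norm (g x) \<le> B" by (rule continuous_bounded[OF g]) blast
  have "\<forall>\<^sub>F i in F. \<forall>x\<in>{0..1}. dist (w i x) (g x) < 1"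
    using uniform_limitD[OF ul, of 1] by simp
  then have ev: "\<forall>\<^sub>F i in F. \<forall>x\<in>{0..1}. w i x \<in> cball 0 (B + 1)"
  proof eventually_elim
    case (elim i)
    show ?case
    proof
      fix x :: real assume x: "x \<in> {0..1}"
      have "norm (w i x) \<le> norm (g x) + dist (w i x) (g x)"
        using norm_triangle_sub[of "w i x" "g x"] by (simp add: dist_norm)
      then show "w i x \<in> cball 0 (B + 1)" using elim x B[OF x] by fastforce
    qed
  qed
  have uc: "uniformly_continuous_on (cball 0 (B + 1)) (\<lambda>z. cmod z powr p)"
    by (rule compact_uniformly_continuous) (auto intro!: continuous_powr_cmod continuous_intros p)
  have ul2: "uniform_limit {0..1} (\<lambda>i x. cmod (w i x) powr p) (\<lambda>x. cmod (g x) powr p) F"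
    by (rule uniform_limit_compose_uniformly_continuous_on[OF ul uc ev]) simp
  obtain I J where IJ: "\<And>i. ((\<lambda>x. cmod (w i x) powr p) has_integral I i) {0..1}"
    "((\<lambda>x. cmod (g x) powr p) has_integral J) {0..1}" "(I \<longlongrightarrow> J) F"
    by (rule uniform_limit_integral[OF ul2 continuous_powr_cmod[OF c p] F]) blast
  have "pot p (w i) = I i" for i
    unfolding pot_def using IJ(1) by (simp add: integral_unit_eq integrable_powr_cmod c p integral_unique)
  moreover have "pot p g = J"
    unfolding pot_def using IJ(2) by (simp add: integral_unit_eq integrable_powr_cmod g p integral_unique)
  ultimately show ?thesis using IJ(3) by simp
qed

lemma sq_norm_eq_pot: "sq_norm u = pot 2 u"
  by (simp add: sq_norm_def pot_def)

text \<open>Rescaling to the prescribed mass turns a lower bound for the energy at that mass into a lower bound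
  for the kinetic energy of an arbitrary function, in terms of quantities that are continuous with
  respect to uniform convergence.\<close>

lemma kinetic_lower_bound:
  assumes e: "\<And>w z. sobolev_pair w z \<Longrightarrow> sq_norm w = \<mu> \<Longrightarrow> e \<le> pair_energy p w z"
    and wz: "sobolev_pair w z" and m: "sq_norm w > 0" and \<mu>: "\<mu> > 0"
  shows "e \<le> 1 / 2 * (\<mu> / sq_norm w * sq_norm z) - 1 / p * ((\<mu> / sq_norm w) powr (p / 2) * pot p w)"
proof -
  define r where "r = sqrt (\<mu> / sq_norm w)"
  have r: "r > 0" "r\<^sup>2 = \<mu> / sq_norm w" using m \<mu> by (auto simp: r_def)
  have "r powr p = (\<mu> / sq_norm w) powr (p / 2)"
    using m \<mu> by (simp add: r_def powr_powr flip: powr_half_sqrt)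
  then show ?thesis
    using e[OF sobolev_pair_scaleR[OF wz, of r]] m r
    by (simp add: sq_norm_scaleR pot_scaleR pair_energy_def)
qed

lemma uniform_limit_average:
  fixes g :: "'a \<Rightarrow> complex"
  assumes "uniform_limit S U g sequentially"
  shows "uniform_limit S (\<lambda>(n, m) x. (1/2) *\<^sub>R (U n x + U m x)) g (sequentially \<times>\<^sub>F sequentially)"
proof (rule uniform_limitI)
  fix e :: real assume e: "e > 0"
  obtain N where N: "\<And>n x. n \<ge> N \<Longrightarrow> x \<in> S \<Longrightarrow> dist (U n x) (g x) < e"
    using uniform_limitD[OF assms e] unfolding eventually_sequentially by blast
  show "\<forall>\<^sub>F i in sequentially \<times>\<^sub>F sequentially. \<forall>x\<in>S. dist ((case i of (n, m) \<Rightarrow> \<lambda>x. (1/2) *\<^sub>R (U n x + U m x)) x) (g x) < e"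
    unfolding eventually_prod_sequentially
  proof (intro exI[of _ N] allI impI ballI)
    fix m n x assume *: "N \<le> m" "N \<le> n" "x \<in> S"
    have "(1/2) *\<^sub>R (U n x + U m x) - g x = (1/2) *\<^sub>R ((U n x - g x) + (U m x - g x))"
      by (simp add: scaleR_conv_of_real field_simps)
    also have "norm \<dots> = 1/2 * norm ((U n x - g x) + (U m x - g x))"
      by (subst norm_scaleR) simp
    also have "\<dots> \<le> 1/2 * (norm (U n x - g x) + norm (U m x - g x))"
      by (rule mult_left_mono[OF norm_triangle_ineq]) simp
    also have "\<dots> < e" using N[of n x] N[of m x] * by (simp add: dist_norm)
    finally show "dist ((case (n, m) of (n, m) \<Rightarrow> \<lambda>x. (1/2) *\<^sub>R (U n x + U m x)) x) (g x) < e"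
      by (simp add: dist_norm)
  qed
qed

lemma parallelogram_sq_norm:
  assumes "in_Lp 2 v" "in_Lp 2 w"
  shows "sq_norm (\<lambda>x. v x - w x) = 2 * sq_norm v + 2 * sq_norm w - 4 * sq_norm (\<lambda>x. (1/2) *\<^sub>R (v x + w x))"
proof -
  have "sq_norm (\<lambda>x. (1/2) *\<^sub>R (v x + w x)) = 1/4 * sq_norm (\<lambda>x. v x + w x)"
    by (subst sq_norm_scaleR) (simp add: power2_eq_square)
  then show ?thesis
    using sq_norm_add_scaled[OF assms, of 1] sq_norm_add_scaled[OF assms, of "-1"] by simp
qed

text \<open>No weak compactness is used: the functions converge uniformly by Arzela-Ascoli, and the derivatives of that subsequence are Cauchy in the
  mean square.\<close>

lemma minimiser_exists:
  assumes p: "2 < p" "p \<le> 3" and \<mu>: "\<mu> > 0"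
  shows "\<exists>u v. minimiser p \<mu> u v"
proof -
  define S where "S = {pair_energy p u v |u v. sobolev_pair u v \<and> sq_norm u = \<mu>}"
  define e where "e = Inf S"
  have ne: "S \<noteq> {}"
  proof -
    have "sq_norm (\<lambda>x. complex_of_real (sqrt \<mu>)) = \<mu>" using \<mu> by (simp add: sq_norm_def measure_unit)
    then show ?thesis using sobolev_pair_const unfolding S_def by blast
  qed
  have bdd: "bdd_below S"
  proof (rule bdd_belowI[of _ "- (3 * \<mu> + 2 * \<mu>\<^sup>2) / 4"])
    fix s assume "s \<in> S"
    then obtain u v where "sobolev_pair u v" "sq_norm u = \<mu>" "s = pair_energy p u v" by (auto simp: S_def)
    then show "- (3 * \<mu> + 2 * \<mu>\<^sup>2) / 4 \<le> s"
      using energy_coercive[OF _ p, of u v] sq_norm_nonneg[of v] by (simp add: field_simps)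
  qed
  have e: "e \<le> pair_energy p w z" if "sobolev_pair w z" "sq_norm w = \<mu>" for w z
    unfolding e_def using that by (intro cInf_lower bdd) (auto simp: S_def)
  have "\<exists>u v. sobolev_pair u v \<and> sq_norm u = \<mu> \<and> pair_energy p u v < e + 1 / real (Suc n)" for n
  proof -
    have "Inf S < e + 1 / real (Suc n)" by (simp add: e_def)
    then show ?thesis using cInf_less_iff[OF ne bdd] unfolding S_def by blast
  qed
  then have "\<forall>n. \<exists>uv. sobolev_pair (fst uv) (snd uv) \<and> sq_norm (fst uv) = \<mu> \<and> pair_energy p (fst uv) (snd uv) < e + 1 / real (Suc n)"
    by simp
  from choice[OF this] obtain uv where
    uv: "\<And>n. sobolev_pair (fst (uv n)) (snd (uv n))" "\<And>n. sq_norm (fst (uv n)) = \<mu>"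
      "\<And>n. pair_energy p (fst (uv n)) (snd (uv n)) < e + 1 / real (Suc n)"
    by blast
  define u v where "u n = fst (uv n)" and "v n = snd (uv n)" for n
  have sp: "sobolev_pair (u n) (v n)" and mass: "sq_norm (u n) = \<mu>"
    and en: "pair_energy p (u n) (v n) < e + 1 / real (Suc n)" for n
    using uv by (auto simp: u_def v_def)
  define B where "B = 4 * (e + 1) + 3 * \<mu> + 2 * \<mu>\<^sup>2"
  have B: "sq_norm (v n) \<le> B" for n
  proof -
    define q where "q = 1 / real (Suc n)"
    have "q \<le> 1" by (simp add: q_def)
    moreover have "sq_norm (v n) \<le> 4 * pair_energy p (u n) (v n) + 3 * \<mu> + 2 * \<mu>\<^sup>2"
      using energy_coercive[OF sp p, of n] mass by simp
    moreover have "4 * pair_energy p (u n) (v n) \<le> 4 * (e + 1)"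
      using en[of n] calculation(1) unfolding q_def[symmetric] by simp
    ultimately show ?thesis unfolding B_def by simp
  qed
  have B0: "B \<ge> 0" using B[of 0] sq_norm_nonneg order_trans by blast
  obtain g k where gk: "continuous_on {0..1::real} g" "strict_mono (k :: nat \<Rightarrow> nat)"
    "\<And>e. 0 < e \<Longrightarrow> \<exists>N. \<forall>n x. n \<ge> N \<and> x \<in> {0..1} \<longrightarrow> norm (u (k n) x - g x) < e"
  proof (rule Arzela_Ascoli[of "{0..1}" u "sqrt (2 * \<mu> + 2 * B)"])
    show "norm (u n x) \<le> sqrt (2 * \<mu> + 2 * B)" if "x \<in> {0..1}" for n x
      by (rule real_le_rsqrt) (use sobolev_pair_sup_bound[OF sp that, of n] mass B[of n] in auto)
    fix x d :: real assume x: "x \<in> {0..1}" and d: "0 < d"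
    show "\<exists>r>0. \<forall>n y. y \<in> {0..1} \<and> norm (x - y) < r \<longrightarrow> norm (u n x - u n y) < d"
    proof (intro exI[of _ "d\<^sup>2 / (B + 1)"] conjI allI impI)
      show "0 < d\<^sup>2 / (B + 1)" using d B0 by simp
      fix n y assume y: "y \<in> {0..1} \<and> norm (x - y) < d\<^sup>2 / (B + 1)"
      have "sq_norm (v n) * \<bar>x - y\<bar> \<le> (B + 1) * \<bar>x - y\<bar>" using B[of n] by (intro mult_right_mono) auto
      also have "\<dots> < d\<^sup>2" using y B0 by (simp add: field_simps)
      finally have "sqrt (sq_norm (v n) * \<bar>x - y\<bar>) < d"
        using d real_sqrt_less_mono by fastforce
      then show "norm (u n x - u n y) < d"
        using sobolev_pair_holder[OF sp x, of y n] y by fastforce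
    qed
  qed auto
  define U V where "U n = u (k n)" and "V n = v (k n)" for n
  have spU: "sobolev_pair (U n) (V n)" and massU: "sq_norm (U n) = \<mu>" for n
    using sp mass by (auto simp: U_def V_def)
  have LV: "in_Lp 2 (V n)" for n using spU by (simp add: sobolev_pair_def)
  have cU: "continuous_on {0..1} (U n)" for n by (rule sobolev_pair_continuous[OF spU])
  have ul: "uniform_limit {0..1} U g sequentially"
    using gk(3) unfolding uniform_limit_sequentially_iff U_def dist_norm by blast
  have massg: "sq_norm g = \<mu>"
  proof -
    have "(\<lambda>n. pot 2 (U n)) \<longlonglongrightarrow> pot 2 g" by (rule pot_tendsto_uniform[OF ul cU gk(1)]) auto
    then show ?thesis using massU by (simp add: LIMSEQ_const_iff flip: sq_norm_eq_pot)
  qed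
  have potU: "(\<lambda>n. pot p (U n)) \<longlonglongrightarrow> pot p g" by (rule pot_tendsto_uniform[OF ul cU gk(1)]) (use p in auto)
  have enU: "(\<lambda>n. pair_energy p (U n) (V n)) \<longlonglongrightarrow> e"
  proof (rule tendsto_sandwich[OF always_eventually always_eventually])
    show "\<forall>n. e \<le> pair_energy p (U n) (V n)" using e[OF spU massU] by blast
    show "\<forall>n. pair_energy p (U n) (V n) \<le> e + 1 / real (Suc n)"
    proof
      fix n
      have "1 / real (Suc (k n)) \<le> 1 / real (Suc n)"
        using seq_suble[OF gk(2), of n] by (intro divide_left_mono) auto
      then show "pair_energy p (U n) (V n) \<le> e + 1 / real (Suc n)"
        using en[of "k n"] by (simp add: U_def V_def)
    qed
    have "(\<lambda>n. e + 1 / real (Suc n)) \<longlonglongrightarrow> e + 0"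
      by (intro tendsto_intros LIMSEQ_Suc[OF lim_1_over_n])
    then show "(\<lambda>n. e + 1 / real (Suc n)) \<longlonglongrightarrow> e" by simp
  qed simp
  define L where "L = 2 * (e + 1 / p * pot p g)"
  have kinU: "(\<lambda>n. sq_norm (V n)) \<longlonglongrightarrow> L"
  proof -
    have "(\<lambda>n. 2 * (pair_energy p (U n) (V n) + 1 / p * pot p (U n))) \<longlonglongrightarrow> L"
      unfolding L_def by (intro tendsto_intros enU potU)
    then show ?thesis by (simp add: pair_energy_def)
  qed
  \<comment> \<open>The midpoints of two late members of the sequence are almost admissible, so their kinetic energy
    cannot be much below the limit; by the parallelogram identity the derivatives are Cauchy.\<close>
  let ?F = "sequentially \<times>\<^sub>F sequentially :: (nat \<times> nat) filter"
  define W Z where "W = (\<lambda>(n, m) x. (1/2) *\<^sub>R (U n x + U m x))" and "Z = (\<lambda>(n, m) x. (1/2) *\<^sub>R (V n x + V m x))"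
  have spW: "sobolev_pair (W i) (Z i)" for i
    unfolding W_def Z_def by (cases i) (simp add: sobolev_pair_scaleR sobolev_pair_add spU)
  have ulW: "uniform_limit {0..1} W g ?F"
    unfolding W_def by (rule uniform_limit_average[OF ul])
  have Fb: "?F \<noteq> bot" by (simp add: prod_filter_eq_bot)
  have massW: "((\<lambda>i. sq_norm (W i)) \<longlongrightarrow> \<mu>) ?F"
    using pot_tendsto_uniform[OF ulW sobolev_pair_continuous[OF spW] gk(1) _ Fb, of 2] massg
    by (simp add: sq_norm_eq_pot)
  have potW: "((\<lambda>i. pot p (W i)) \<longlongrightarrow> pot p g) ?F"
    by (rule pot_tendsto_uniform[OF ulW sobolev_pair_continuous[OF spW] gk(1) _ Fb]) (use p in auto)
  define R where "R i = 2 * (sq_norm (W i) / \<mu>) * (e + 1 / p * ((\<mu> / sq_norm (W i)) powr (p / 2) * pot p (W i)))" for i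
  have Rlim: "(R \<longlongrightarrow> L) ?F"
  proof -
    have "(R \<longlongrightarrow> 2 * (\<mu> / \<mu>) * (e + 1 / p * ((\<mu> / \<mu>) powr (p / 2) * pot p g))) ?F"
      unfolding R_def by (intro tendsto_intros massW potW) (use \<mu> in auto)
    then show ?thesis using \<mu> by (simp add: L_def)
  qed
  have Rle: "\<forall>\<^sub>F i in ?F. R i \<le> sq_norm (Z i)"
  proof -
    have "\<forall>\<^sub>F i in ?F. 0 < sq_norm (W i)" using order_tendstoD(1)[OF massW \<mu>] .
    then show ?thesis
    proof eventually_elim
      case (elim i)
      have "e + 1 / p * ((\<mu> / sq_norm (W i)) powr (p / 2) * pot p (W i)) \<le> 1 / 2 * (\<mu> / sq_norm (W i) * sq_norm (Z i))"
        using kinetic_lower_bound[OF e spW elim \<mu>] by simp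
      then have "R i \<le> 2 * (sq_norm (W i) / \<mu>) * (1 / 2 * (\<mu> / sq_norm (W i) * sq_norm (Z i)))"
        unfolding R_def using elim \<mu> by (intro mult_left_mono) auto
      then show ?case using elim \<mu> by simp
    qed
  qed
  have kin1: "((\<lambda>i. sq_norm (V (fst i))) \<longlongrightarrow> L) ?F" "((\<lambda>i. sq_norm (V (snd i))) \<longlongrightarrow> L) ?F"
    by (rule filterlim_compose[OF kinU filterlim_fst], rule filterlim_compose[OF kinU filterlim_snd])
  have Dlim: "((\<lambda>i. 2 * sq_norm (V (fst i)) + 2 * sq_norm (V (snd i)) - 4 * R i) \<longlongrightarrow> 2 * L + 2 * L - 4 * L) ?F"
    by (intro tendsto_intros kin1 Rlim)
  have cauchy: "\<exists>N. \<forall>n\<ge>N. \<forall>m\<ge>N. sq_norm (\<lambda>x. V n x - V m x) \<le> r" if "r > 0" for r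
  proof -
    have "\<forall>\<^sub>F i in ?F. 2 * sq_norm (V (fst i)) + 2 * sq_norm (V (snd i)) - 4 * R i < r"
      by (rule order_tendstoD(2)[OF Dlim]) (use that in simp)
    then have "\<forall>\<^sub>F i in ?F. sq_norm (\<lambda>x. V (fst i) x - V (snd i) x) \<le> r"
      using Rle
    proof eventually_elim
      case (elim i)
      have "sq_norm (\<lambda>x. V (fst i) x - V (snd i) x)
          = 2 * sq_norm (V (fst i)) + 2 * sq_norm (V (snd i)) - 4 * sq_norm (Z i)"
        unfolding Z_def using parallelogram_sq_norm[OF LV LV, of "fst i" "snd i"] by (cases i) simp
      then show ?case using elim by simp
    qed
    then show ?thesis unfolding eventually_prod_sequentially by (auto intro: exI)
  qed
  obtain G where G: "in_Lp 2 G" "(\<lambda>n. sq_norm (\<lambda>x. V n x - G x)) \<longlonglongrightarrow> 0"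
    using L2_complete[OF LV cauchy] by blast
  have kinG: "sq_norm G = L"
    using LIMSEQ_unique[OF sq_norm_tendsto[OF LV G] kinU] .
  have gU: "(\<lambda>n. U n x) \<longlonglongrightarrow> g x" if "x \<in> {0..1}" for x
    by (rule tendsto_uniform_limitI[OF ul that])
  have primV: "(\<lambda>n. prim (V n) x) \<longlonglongrightarrow> prim G x" for x
  proof (rule Lim_null[THEN iffD2], rule Lim_null_comparison)
    have "norm (prim (V n) x - prim G x) \<le> sqrt (sq_norm (\<lambda>x. V n x - G x))" for n
    proof -
      have LD: "in_Lp 2 (\<lambda>x. V n x - G x)" by (rule in_L2_diff[OF LV G(1)])
      have "prim (V n) x - prim G x = prim (\<lambda>x. V n x - G x) x"
        by (rule prim_diff[symmetric]) (auto intro: in_L2_integrable LV G)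
      then have "norm (prim (V n) x - prim G x) \<le> (LINT y|unit_meas. cmod (V n y - G y))"
        using norm_prim_le[OF in_L2_integrable[OF LD]] by simp
      also have "\<dots> \<le> sqrt (sq_norm (\<lambda>x. V n x - G x))"
        by (rule real_le_rsqrt[OF L1_le_L2[OF LD]])
      finally show ?thesis .
    qed
    then show "\<forall>\<^sub>F n in sequentially. norm (prim (V n) x - prim G x) \<le> sqrt (sq_norm (\<lambda>x. V n x - G x))" by simp
    show "(\<lambda>n. sqrt (sq_norm (\<lambda>x. V n x - G x))) \<longlonglongrightarrow> 0"
      using tendsto_real_sqrt[OF G(2)] by simp
  qed
  have "g x = g 0 + prim G x" if x: "x \<in> {0..1}" for x
  proof -
    have "(\<lambda>n. U n 0 + prim (V n) x) \<longlonglongrightarrow> g 0 + prim G x"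
      by (intro tendsto_intros gU primV) simp
    moreover have "U n 0 + prim (V n) x = U n x" for n
      by (rule sobolev_pair_eq[OF spU x, symmetric])
    ultimately show ?thesis using gU[OF x] LIMSEQ_unique by auto
  qed
  then have "sobolev_pair g G" using G(1) unfolding sobolev_pair_def by blast
  moreover have "pair_energy p g G = e" by (simp add: pair_energy_def kinG L_def add_divide_distrib)
  ultimately have "minimiser p \<mu> g G" using e massg by (simp add: minimiser_def)
  then show ?thesis by blast
qed

section \<open>The Euler-Lagrange equation\<close>

lemma powr_tangent_line:
  fixes s r p :: real
  assumes "s \<ge> 0" "r \<ge> 0" "p > 1"
  shows "r powr p + p * r powr (p - 1) * (s - r) \<le> s powr p"
proof (cases "r = 0 \<or> s = 0 \<or> s = r")
  case True
  have "r powr p = r * r powr (p - 1)" if "r > 0"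
    using that by (simp add: powr_mult_base)
  moreover have "1 * (r * r powr (p - 1)) \<le> p * (r * r powr (p - 1))"
    using assms by (intro mult_right_mono) auto
  ultimately show ?thesis using True assms by (cases "r = 0") (auto simp: algebra_simps)
next
  case False
  then have pos: "r > 0" "s > 0" "s \<noteq> r" using assms by auto
  show ?thesis
  proof (cases "r < s")
    case True
    have "\<exists>z>r. z < s \<and> s powr p - r powr p = (s - r) * (p * z powr (p - 1))"
      by (rule MVT2[OF True]) (use pos in \<open>auto intro!: derivative_eq_intros\<close>)
    then obtain z where z: "z > r" "s powr p - r powr p = (s - r) * (p * z powr (p - 1))" by blast
    have "(s - r) * (p * r powr (p - 1)) \<le> (s - r) * (p * z powr (p - 1))"
      using z(1) True assms pos by (intro mult_left_mono powr_mono2) auto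
    then show ?thesis using z(2) by (simp add: algebra_simps)
  next
    case False
    then have lt: "s < r" using pos by simp
    have "\<exists>z>s. z < r \<and> r powr p - s powr p = (r - s) * (p * z powr (p - 1))"
      by (rule MVT2[OF lt]) (use pos in \<open>auto intro!: derivative_eq_intros\<close>)
    then obtain z where z: "z > s" "z < r" "r powr p - s powr p = (r - s) * (p * z powr (p - 1))" by blast
    have "(r - s) * (p * z powr (p - 1)) \<le> (r - s) * (p * r powr (p - 1))"
      using z lt assms pos by (intro mult_left_mono powr_mono2) auto
    then show ?thesis using z(3) by (simp add: algebra_simps)
  qed
qed

text \<open>Convexity of the power in the form needed for the Euler-Lagrange equation, where it takes the place of differentiation under the integral sign.\<close>

lemma cmod_powr_tangent:
  assumes "p > 2"
  shows "cmod z powr p + p * (cmod z powr (p - 2) *\<^sub>R z \<bullet> (w - z)) \<le> cmod w powr p"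
proof (cases "z = 0")
  case False
  then have n: "cmod z > 0" by simp
  have split: "cmod z powr (p - 1) = cmod z powr (p - 2) * cmod z"
    using powr_mult_base[of "cmod z" "p - 2"] by (simp add: algebra_simps)
  have "z \<bullet> (w - z) \<le> cmod z * (cmod w - cmod z)"
    using norm_cauchy_schwarz[of z w] by (simp add: inner_diff_right power2_norm_eq_inner[symmetric] power2_eq_square algebra_simps)
  then have "cmod z powr (p - 2) * (z \<bullet> (w - z)) \<le> cmod z powr (p - 2) * (cmod z * (cmod w - cmod z))"
    by (intro mult_left_mono) auto
  then have "p * (cmod z powr (p - 2) * (z \<bullet> (w - z))) \<le> p * (cmod z powr (p - 1) * (cmod w - cmod z))"
    using assms by (intro mult_left_mono) (simp_all add: split mult.assoc)
  moreover have "cmod z powr p + p * cmod z powr (p - 1) * (cmod w - cmod z) \<le> cmod w powr p"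
    by (rule powr_tangent_line) (use assms in auto)
  ultimately show ?thesis by (simp only: inner_scaleR_left mult.assoc)
qed auto

definition power_nl :: "real \<Rightarrow> complex \<Rightarrow> complex" where
  "power_nl p z = cmod z powr (p - 2) *\<^sub>R z"

lemma continuous_power_nl:
  assumes "continuous_on S u" "p > 2"
  shows "continuous_on S (\<lambda>x. power_nl p (u x))"
  unfolding power_nl_def using assms by (intro continuous_intros continuous_powr_cmod) auto

text \<open>Along \<open>u + t \<phi>\<close>, rescaled to mass \<open>\<mu>\<close>, the energy is at most the explicit function \<open>h\<close> that arises when the \<open>p\<close>-th power is replaced by its tangent
  at \<open>u\<close>. As \<open>h\<close> agrees with the energy at \<open>t = 0\<close>, it has a minimum there, and its derivative is the equation.\<close>

lemma Euler_Lagrange_weak: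
  assumes min: "minimiser p \<mu> u v" and p: "2 < p" and \<mu>: "\<mu> > 0" and \<phi>: "sobolev_pair \<phi> \<psi>"
  defines "lam \<equiv> (pot p u - sq_norm v) / \<mu>"
  shows "(LINT x|unit_meas. v x \<bullet> \<psi> x)
    = (LINT x|unit_meas. power_nl p (u x) \<bullet> \<phi> x) - lam * (LINT x|unit_meas. u x \<bullet> \<phi> x)"
proof -
  have sp: "sobolev_pair u v" and mass: "sq_norm u = \<mu>"
    and e: "\<And>w z. sobolev_pair w z \<Longrightarrow> sq_norm w = \<mu> \<Longrightarrow> pair_energy p u v \<le> pair_energy p w z"
    using min by (auto simp: minimiser_def)
  note L = sobolev_pair_in_L2[OF sp] sobolev_pair_in_L2[OF \<phi>]
  note c = sobolev_pair_continuous[OF sp] sobolev_pair_continuous[OF \<phi>]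
  define K1 m1 B where "K1 = (LINT x|unit_meas. v x \<bullet> \<psi> x)" and "m1 = (LINT x|unit_meas. u x \<bullet> \<phi> x)"
    and "B = (LINT x|unit_meas. power_nl p (u x) \<bullet> \<phi> x)"
  define m where "m t = \<mu> + 2 * t * m1 + t\<^sup>2 * sq_norm \<phi>" for t
  define K where "K t = sq_norm v + 2 * t * K1 + t\<^sup>2 * sq_norm \<psi>" for t
  define h where "h t = 1 / 2 * (\<mu> / m t * K t) - 1 / p * ((\<mu> / m t) powr (p / 2) * (pot p u + p * (t * B)))" for t
  have pos: "\<exists>d>0. \<forall>t. \<bar>0 - t\<bar> < d \<longrightarrow> m t > 0"
  proof -
    have "isCont m 0" unfolding m_def by (intro continuous_intros)
    then have "\<forall>\<^sub>F t in at 0. m t > 0"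
      unfolding isCont_def by (rule order_tendstoD(1)) (use \<mu> in \<open>simp add: m_def\<close>)
    then obtain d where "d > 0" "\<And>t. t \<noteq> 0 \<Longrightarrow> \<bar>t\<bar> < d \<Longrightarrow> m t > 0"
      unfolding eventually_at by (auto simp: dist_real_def)
    moreover have "m 0 > 0" using \<mu> by (simp add: m_def)
    ultimately have "m t > 0" if "\<bar>0 - t\<bar> < d" for t using that by (cases "t = 0") auto
    then show ?thesis using \<open>d > 0\<close> by blast
  qed
  then obtain d where d: "d > 0" "\<And>t. \<bar>0 - t\<bar> < d \<Longrightarrow> m t > 0" by blast
  have h0: "h 0 = pair_energy p u v"
    using \<mu> by (simp add: h_def m_def K_def pair_energy_def)
  have le: "h 0 \<le> h t" if "m t > 0" for t
  proof -
    let ?w = "\<lambda>x. u x + t *\<^sub>R \<phi> x" and ?z = "\<lambda>x. v x + t *\<^sub>R \<psi> x"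
    have sw: "sobolev_pair ?w ?z" by (intro sobolev_pair_add sobolev_pair_scaleR sp \<phi>)
    have mt: "sq_norm ?w = m t" "sq_norm ?z = K t"
      using sq_norm_add_scaled[OF L(1,3), of t] sq_norm_add_scaled[OF L(2,4), of t] mass
      by (simp_all add: m_def K_def m1_def K1_def)
    have pt: "pot p u + p * (t * B) \<le> pot p ?w"
    proof -
      have i1: "integrable unit_meas (\<lambda>x. cmod (u x) powr p)" "integrable unit_meas (\<lambda>x. cmod (?w x) powr p)"
        using p c by (auto intro!: integrable_powr_cmod continuous_intros)
      have i2: "integrable unit_meas (\<lambda>x. power_nl p (u x) \<bullet> \<phi> x)"
        by (rule integrable_unit_continuous) (intro continuous_intros continuous_power_nl c p)
      have "pot p u + p * (t * B) = (LINT x|unit_meas. cmod (u x) powr p + p * (t * (power_nl p (u x) \<bullet> \<phi> x)))"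
        using i1 i2 by (simp add: pot_def B_def)
      also have "\<dots> \<le> (LINT x|unit_meas. cmod (?w x) powr p)"
      proof (rule integral_mono)
        show "cmod (u x) powr p + p * (t * (power_nl p (u x) \<bullet> \<phi> x)) \<le> cmod (?w x) powr p" for x
          using cmod_powr_tangent[OF p, of "u x" "?w x"] by (simp add: power_nl_def)
      qed (use i1 i2 in auto)
      finally show ?thesis by (simp add: pot_def)
    qed
    have "h 0 \<le> 1 / 2 * (\<mu> / m t * K t) - 1 / p * ((\<mu> / m t) powr (p / 2) * pot p ?w)"
      using kinetic_lower_bound[OF e sw _ \<mu>] that unfolding mt h0 by simp
    also have "\<dots> \<le> h t"
      unfolding h_def using pt p by (intro diff_left_mono mult_left_mono) auto
    finally show ?thesis .
  qed
  have dm: "(m has_real_derivative 2 * m1) (at 0)"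
    unfolding m_def by (auto intro!: derivative_eq_intros)
  have dK: "(K has_real_derivative 2 * K1) (at 0)"
    unfolding K_def by (auto intro!: derivative_eq_intros)
  have m0: "m 0 = \<mu>" "K 0 = sq_norm v" by (simp_all add: m_def K_def)
  have dq: "((\<lambda>t. \<mu> / m t) has_real_derivative - 2 * m1 / \<mu>) (at 0)"
    by (rule DERIV_cong[OF DERIV_divide[OF DERIV_const dm]]) (use \<mu> m0 in \<open>auto simp: power2_eq_square field_simps\<close>)
  have dp: "((\<lambda>t. (\<mu> / m t) powr (p / 2)) has_real_derivative - p * m1 / \<mu>) (at 0)"
    by (rule DERIV_cong[OF DERIV_fun_powr[OF dq]]) (use \<mu> m0 in \<open>auto simp: field_simps\<close>)
  have dl: "((\<lambda>t. pot p u + p * (t * B)) has_real_derivative p * B) (at 0)"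
    by (auto intro!: derivative_eq_intros)
  have "(h has_real_derivative (1 / 2 * (- 2 * m1 / \<mu> * K 0 + 2 * K1 * (\<mu> / m 0)))
      - 1 / p * (- p * m1 / \<mu> * (pot p u + p * (0 * B)) + p * B * (\<mu> / m 0) powr (p / 2))) (at 0)"
    unfolding h_def by (intro DERIV_diff DERIV_cmult DERIV_mult dq dK dp dl)
  then have eq1: "1 / 2 * (- 2 * m1 / \<mu> * K 0 + 2 * K1 * (\<mu> / m 0))
      - 1 / p * (- p * m1 / \<mu> * (pot p u + p * (0 * B)) + p * B * (\<mu> / m 0) powr (p / 2)) = 0"
    by (rule DERIV_local_min[OF _ d(1)]) (use le d(2) in blast)
  have eq2: "1 / p * (- p * m1 / \<mu> * (pot p u + p * (0 * B)) + p * B * (\<mu> / m 0) powr (p / 2)) = B - m1 * pot p u / \<mu>"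
    using \<mu> p m0 by (simp add: field_simps)
  have eq3: "1 / 2 * (- 2 * m1 / \<mu> * K 0 + 2 * K1 * (\<mu> / m 0)) = K1 - m1 * sq_norm v / \<mu>"
    using \<mu> m0 by (simp add: field_simps)
  show ?thesis
    using eq1[unfolded eq2 eq3] unfolding lam_def K1_def[symmetric] m1_def[symmetric] B_def[symmetric]
    by (simp add: algebra_simps diff_divide_distrib)
qed

definition neumann_sol :: "real \<Rightarrow> real \<Rightarrow> (real \<Rightarrow> complex) \<Rightarrow> (real \<Rightarrow> complex) \<Rightarrow> bool" where
  "neumann_sol lam p u w \<longleftrightarrow> continuous_on {0..1} u \<and> continuous_on {0..1} w \<and> w 0 = 0 \<and> w 1 = 0 \<and>
     (\<forall>x\<in>{0<..<1}. (u has_vector_derivative w x) (at x) \<and>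
        (w has_vector_derivative (lam *\<^sub>R u x - power_nl p (u x))) (at x))"

lemma sq_norm_eq_0_AE:
  assumes "in_Lp 2 v" "sq_norm v = 0" shows "AE x in unit_meas. v x = 0"
  using assms(2) integral_nonneg_eq_0_iff_AE[OF in_L2_sq_integrable[OF assms(1)]]
  by (simp add: sq_norm_def)

lemma prim_cong_AE:
  assumes "AE x in unit_meas. v x = w x" "v \<in> borel_measurable unit_meas" "w \<in> borel_measurable unit_meas"
  shows "prim v x = prim w x"
  unfolding prim_def
  by (rule integral_cong_AE) (use assms in \<open>auto intro!: borel_measurable_scaleR elim: eventually_mono\<close>)

text \<open>Let \<open>G\<close> be the primitive of the right-hand side of the equation. Constant test functions give \<open>G 1 = 0\<close>, and the test function with
  derivative \<open>v - G\<close> gives \<open>v = G\<close> almost everywhere; so the derivative may be taken continuous, with the Neumann conditions.\<close>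

lemma minimiser_regular:
  assumes min: "minimiser p \<mu> u v" and p: "2 < p" and \<mu>: "\<mu> > 0"
  shows "\<exists>lam w. neumann_sol lam p u w \<and> minimiser p \<mu> u w"
proof -
  have sp: "sobolev_pair u v" using min by (simp add: minimiser_def)
  note L = sobolev_pair_in_L2[OF sp]
  have cu: "continuous_on {0..1} u" by (rule sobolev_pair_continuous[OF sp])
  define lam where "lam = (pot p u - sq_norm v) / \<mu>"
  define g where "g x = lam *\<^sub>R u x - power_nl p (u x)" for x
  have cg: "continuous_on {0..1} g" unfolding g_def by (intro continuous_intros continuous_power_nl cu p)
  have ig: "integrable unit_meas g" by (rule integrable_unit_continuous[OF cg])
  define G where "G = prim g"
  have cG: "continuous_on {0..1} G" unfolding G_def using continuous_prim[OF ig] continuous_on_subset by blast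
  have EL: "(LINT x|unit_meas. v x \<bullet> \<psi> x) = - (LINT x|unit_meas. g x \<bullet> \<phi> x)" if "sobolev_pair \<phi> \<psi>" for \<phi> \<psi>
  proof -
    have c: "continuous_on {0..1} \<phi>" by (rule sobolev_pair_continuous[OF that])
    have "integrable unit_meas (\<lambda>x. power_nl p (u x) \<bullet> \<phi> x)" "integrable unit_meas (\<lambda>x. u x \<bullet> \<phi> x)"
      by (rule integrable_unit_continuous, intro continuous_intros continuous_power_nl cu c p)+
    then have "(LINT x|unit_meas. g x \<bullet> \<phi> x) = lam * (LINT x|unit_meas. u x \<bullet> \<phi> x) - (LINT x|unit_meas. power_nl p (u x) \<bullet> \<phi> x)"
      by (simp add: g_def inner_diff_left)
    then show ?thesis using Euler_Lagrange_weak[OF min p \<mu> that] by (simp add: lam_def)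
  qed
  have G1: "G 1 = 0"
  proof -
    have "0 = (LINT x|unit_meas. g x \<bullet> G 1)" using EL[OF sobolev_pair_const, of "G 1"] by simp
    also have "\<dots> = G 1 \<bullet> G 1"
      using integral_bounded_linear[OF bounded_linear_inner_left ig] by (simp add: G_def prim_ge_1)
    finally show ?thesis by simp
  qed
  have LG: "in_Lp 2 G" by (rule continuous_in_L2[OF cG])
  define \<psi> where "\<psi> x = v x - G x" for x
  have L\<psi>: "in_Lp 2 \<psi>" unfolding \<psi>_def by (rule in_L2_diff[OF L(2) LG])
  have "(LINT x|unit_meas. g x \<bullet> prim \<psi> x) + (LINT x|unit_meas. G x \<bullet> \<psi> x) = 0"
    using integration_by_parts_prim[OF bounded_bilinear_inner ig in_L2_integrable[OF L\<psi>]] G1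
    by (simp add: G_def)
  then have "(LINT x|unit_meas. v x \<bullet> \<psi> x) = (LINT x|unit_meas. G x \<bullet> \<psi> x)"
    using EL[OF sobolev_pair_prim[OF L\<psi>]] by simp
  then have "(LINT x|unit_meas. v x \<bullet> \<psi> x - G x \<bullet> \<psi> x) = 0"
    using in_L2_inner_integrable[OF L(2) L\<psi>] in_L2_inner_integrable[OF LG L\<psi>] by simp
  then have "sq_norm \<psi> = 0"
    by (simp add: sq_norm_def power2_norm_eq_inner flip: inner_diff_left \<psi>_def)
  then have "AE x in unit_meas. \<psi> x = 0" by (rule sq_norm_eq_0_AE[OF L\<psi>])
  then have ae: "AE x in unit_meas. v x = G x" by eventually_elim (simp add: \<psi>_def)
  note mm = in_L2_measurable[OF L(2)] in_L2_measurable[OF LG]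
  have pv: "prim v x = prim G x" for x by (rule prim_cong_AE[OF ae mm])
  have spG: "sobolev_pair u G"
    unfolding sobolev_pair_def
  proof (intro conjI ballI LG)
    fix x :: real assume "x \<in> {0..1}"
    then show "u x = u 0 + prim G x" unfolding pv[symmetric] by (rule sobolev_pair_eq[OF sp])
  qed
  have "sq_norm v = sq_norm G"
    by (rule sq_norm_cong_AE[OF _ mm]) (use ae in \<open>auto elim: eventually_mono\<close>)
  then have "minimiser p \<mu> u G" using min spG by (simp add: minimiser_def pair_energy_def)
  moreover have "neumann_sol lam p u G"
    unfolding neumann_sol_def
  proof (intro conjI ballI cu cG G1)
    show "G 0 = 0" by (simp add: G_def prim_nonpos)
    fix x :: real assume x: "x \<in> {0<..<1}"
    then have at: "at x within {0..1} = at x" "x \<in> {0..1}" by (auto simp: at_within_Icc_at)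
    show "(G has_vector_derivative lam *\<^sub>R u x - power_nl p (u x)) (at x)"
      using prim_has_vector_derivative[OF cg at(2)] at(1) by (simp add: G_def g_def)
    have "((\<lambda>x. u 0 + prim G x) has_vector_derivative 0 + G x) (at x)"
      using prim_has_vector_derivative[OF cG at(2)] at(1) by (intro has_vector_derivative_add) auto
    then show "(u has_vector_derivative G x) (at x)"
      by (rule has_vector_derivative_transform_within_open[of _ _ _ "{0<..<1}", THEN has_vector_derivative_eq_rhs])
        (use x sobolev_pair_eq[OF spG, symmetric] in auto)
  qed
  ultimately show ?thesis by blast
qed

section \<open>Positivity and monotonicity of minimisers\<close>

text \<open>Gronwall's argument for the sum of squares of the solution and its derivative.\<close>

lemma linear_ode_zero:
  fixes y z c :: "real \<Rightarrow> real"
  assumes cont: "continuous_on {a..b} y" "continuous_on {a..b} z"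
    and y: "\<And>x. x \<in> {a<..<b} \<Longrightarrow> (y has_real_derivative z x) (at x)"
    and z: "\<And>x. x \<in> {a<..<b} \<Longrightarrow> (z has_real_derivative c x * y x) (at x)"
    and C: "\<And>x. x \<in> {a<..<b} \<Longrightarrow> \<bar>c x\<bar> \<le> C"
    and s: "s \<in> {a..b}" "y s = 0" "z s = 0" and x: "x \<in> {a..b}"
  shows "y x = 0 \<and> z x = 0"
proof -
  define E where "E t = (y t)\<^sup>2 + (z t)\<^sup>2" for t
  define K where "K = 1 + C"
  have contE: "continuous_on {a..b} E" unfolding E_def by (intro continuous_intros cont)
  have dE: "(E has_real_derivative 2 * (1 + c t) * (y t * z t)) (at t)" if "t \<in> {a<..<b}" for t
    unfolding E_def power2_eq_square
    by (rule DERIV_cong[OF DERIV_add[OF DERIV_mult[OF y[OF that] y[OF that]] DERIV_mult[OF z[OF that] z[OF that]]]])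
      (simp add: algebra_simps)
  have bound: "\<bar>2 * (1 + c t) * (y t * z t)\<bar> \<le> K * E t" if "t \<in> {a<..<b}" for t
  proof -
    have "2 * \<bar>y t * z t\<bar> \<le> E t"
      using zero_le_power2[of "\<bar>y t\<bar> - \<bar>z t\<bar>"] by (simp add: E_def power2_eq_square abs_mult algebra_simps)
    moreover have "\<bar>1 + c t\<bar> \<le> K" using C[OF that] by (simp add: K_def)
    ultimately have "\<bar>1 + c t\<bar> * (2 * \<bar>y t * z t\<bar>) \<le> K * E t" by (intro mult_mono) auto
    moreover have "\<bar>2 * (1 + c t) * (y t * z t)\<bar> = \<bar>1 + c t\<bar> * (2 * \<bar>y t * z t\<bar>)"
      by (simp only: abs_mult)
    ultimately show ?thesis by simp
  qed
  have "E x \<le> 0"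
  proof (cases "s \<le> x")
    case True
    have "E x * exp (- K * x) \<le> E s * exp (- K * s)"
    proof (rule DERIV_nonpos_imp_decreasing_open[OF True])
      show "continuous_on {s..x} (\<lambda>t. E t * exp (- K * t))"
        by (rule continuous_on_mult[OF continuous_on_subset[OF contE]])
          (use s x in \<open>auto intro!: continuous_intros\<close>)
      fix t assume t: "s < t" "t < x"
      then have t': "t \<in> {a<..<b}" using s x by auto
      have dx: "((\<lambda>t. exp (- K * t)) has_real_derivative exp (- K * t) * (- K)) (at t)"
        by (rule DERIV_cong[OF DERIV_fun_exp[OF DERIV_cmult_Id]]) simp
      have "((\<lambda>t. E t * exp (- K * t)) has_real_derivative
          2 * (1 + c t) * (y t * z t) * exp (- K * t) + E t * (exp (- K * t) * (- K))) (at t)"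
        by (rule DERIV_cong[OF DERIV_mult[OF dE[OF t'] dx]]) (simp add: algebra_simps)
      moreover have "2 * (1 + c t) * (y t * z t) * exp (- K * t) + E t * (exp (- K * t) * (- K))
          = (2 * (1 + c t) * (y t * z t) - K * E t) * exp (- K * t)"
        by (simp add: algebra_simps)
      moreover have "\<dots> \<le> 0" using bound[OF t'] by (intro mult_nonpos_nonneg) auto
      ultimately show "\<exists>l. ((\<lambda>t. E t * exp (- K * t)) has_real_derivative l) (at t) \<and> l \<le> 0"
        by (intro exI[of _ "2 * (1 + c t) * (y t * z t) * exp (- K * t) + E t * (exp (- K * t) * (- K))"]) simp
    qed
    then have "E x * exp (- K * x) \<le> 0" using s by (simp add: E_def)
    then show ?thesis by (simp add: mult_le_0_iff)
  next
    case False
    then have le: "x \<le> s" by simp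
    have "E x * exp (K * x) \<le> E s * exp (K * s)"
    proof (rule DERIV_nonneg_imp_increasing_open[OF le])
      show "continuous_on {x..s} (\<lambda>t. E t * exp (K * t))"
        by (rule continuous_on_mult[OF continuous_on_subset[OF contE]])
          (use s x in \<open>auto intro!: continuous_intros\<close>)
      fix t assume t: "x < t" "t < s"
      then have t': "t \<in> {a<..<b}" using s x by auto
      have dx: "((\<lambda>t. exp (K * t)) has_real_derivative exp (K * t) * (K)) (at t)"
        by (rule DERIV_cong[OF DERIV_fun_exp[OF DERIV_cmult_Id]]) simp
      have "((\<lambda>t. E t * exp (K * t)) has_real_derivative
          2 * (1 + c t) * (y t * z t) * exp (K * t) + E t * (exp (K * t) * (K))) (at t)"
        by (rule DERIV_cong[OF DERIV_mult[OF dE[OF t'] dx]]) (simp add: algebra_simps)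
      moreover have "2 * (1 + c t) * (y t * z t) * exp (K * t) + E t * (exp (K * t) * (K))
          = (2 * (1 + c t) * (y t * z t) + K * E t) * exp (K * t)"
        by (simp add: algebra_simps)
      moreover have "\<dots> \<ge> 0" using bound[OF t'] by (intro mult_nonneg_nonneg) auto
      ultimately show "\<exists>l. ((\<lambda>t. E t * exp (K * t)) has_real_derivative l) (at t) \<and> 0 \<le> l"
        by (intro exI[of _ "2 * (1 + c t) * (y t * z t) * exp (K * t) + E t * (exp (K * t) * (K))"]) simp
    qed
    then have "E x * exp (K * x) \<le> 0" using s by (simp add: E_def)
    then show ?thesis by (simp add: mult_le_0_iff)
  qed
  then have "y x ^ 2 + z x ^ 2 \<le> 0" by (simp add: E_def)
  then show ?thesis by (simp add: sum_power2_le_zero_iff)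
qed

lemma sobolev_pair_glue:
  assumes "sobolev_pair u v" "sobolev_pair u' v'" "x0 \<in> {0..1}" "u x0 = u' x0"
  shows "sobolev_pair (\<lambda>x. if x \<le> x0 then u x else u' x) (\<lambda>x. if x \<le> x0 then v x else v' x)"
proof -
  let ?v = "\<lambda>x. if x \<le> x0 then v x else v' x"
  have L: "in_Lp 2 v" "in_Lp 2 v'" using assms(1,2) unfolding sobolev_pair_def by blast+
  have m: "?v \<in> borel_measurable unit_meas"
  proof -
    have "(\<lambda>y. indicat_real {..x0} y *\<^sub>R v y + indicat_real {x0<..} y *\<^sub>R v' y) \<in> borel_measurable unit_meas"
      by (intro borel_measurable_add borel_measurable_integrable integrable_indicator_unit in_L2_integrable L) auto
    then show ?thesis
      by (rule measurable_cong[THEN iffD1, rotated]) (auto simp: indicator_def)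
  qed
  have Lv: "in_Lp 2 ?v"
    unfolding in_L2_iff
  proof (intro conjI m)
    show "integrable unit_meas (\<lambda>x. (cmod (?v x))\<^sup>2)"
    proof (rule Bochner_Integration.integrable_bound)
      show "integrable unit_meas (\<lambda>x. (cmod (v x))\<^sup>2 + (cmod (v' x))\<^sup>2)"
        using L by (intro Bochner_Integration.integrable_add in_L2_sq_integrable)
    qed (use m in auto)
  qed
  have p1: "prim ?v x = prim v x" if "x \<le> x0" for x
    unfolding prim_def by (rule Bochner_Integration.integral_cong) (use that in \<open>auto simp: indicator_def\<close>)
  have p2: "prim ?v x - prim ?v x0 = prim v' x - prim v' x0" if "x0 \<le> x" for x
    unfolding prim_minus_prim[OF in_L2_integrable[OF Lv] that] prim_minus_prim[OF in_L2_integrable[OF L(2)] that]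
    by (rule Bochner_Integration.integral_cong) (auto simp: indicator_def)
  show ?thesis
    unfolding sobolev_pair_def
  proof (intro conjI ballI Lv)
    fix x :: real assume x: "x \<in> {0..1}"
    show "(if x \<le> x0 then u x else u' x) = (if 0 \<le> x0 then u 0 else u' 0) + prim ?v x"
    proof (cases "x \<le> x0")
      case True
      then show ?thesis using p1[OF True] sobolev_pair_eq[OF assms(1) x] assms(3) by simp
    next
      case False
      then have le: "x0 \<le> x" by simp
      have e1: "prim ?v x = prim v x0 + prim v' x - prim v' x0"
        using p2[OF le] p1[of x0] by (simp add: algebra_simps)
      have e2: "u' 0 + prim v' x0 = u 0 + prim v x0"
        using sobolev_pair_eq[OF assms(2,3)] sobolev_pair_eq[OF assms(1,3)] assms(4) by metis
      have "u' x = u' 0 + prim v' x" by (rule sobolev_pair_eq[OF assms(2) x])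
      moreover have "u' 0 = u 0 + prim v x0 - prim v' x0" using e2 by (simp add: eq_diff_eq)
      ultimately show ?thesis using False e1 assms(3) by simp
    qed
  qed
qed

lemma sobolev_pair_if_derivative:
  fixes u v :: "real \<Rightarrow> complex"
  assumes "continuous_on {0..1} u" "finite S"
    and d: "\<And>x. x \<in> {0<..<1} - S \<Longrightarrow> (u has_vector_derivative v x) (at x)"
    and B: "\<And>x. x \<in> {0<..<1} \<Longrightarrow> cmod (v x) \<le> B"
  shows "sobolev_pair u v"
proof -
  have hi: "(v has_integral u x - u 0) {0..x}" if "x \<in> {0..1}" for x
    by (rule fundamental_theorem_of_calculus_interior_strong[OF assms(2)])
      (use that d continuous_on_subset[OF assms(1)] in auto)
  have "v integrable_on {0<..<1}"
    using hi[of 1] by (simp add: has_integral_integrable integrable_on_open_interval_real)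
  then have m: "v \<in> borel_measurable unit_meas" by (rule integrable_imp_measurable)
  have L: "in_Lp 2 v" by (rule in_L2_bounded[OF m B])
  show ?thesis
    unfolding sobolev_pair_def
  proof (intro conjI ballI L)
    fix x :: real assume "x \<in> {0..1}"
    then show "u x = u 0 + prim v x"
      using hi[of x] prim_eq_integral[OF in_L2_integrable[OF L], of x] by (simp add: integral_unique)
  qed
qed

lemma minimiser_cong:
  assumes "minimiser p \<mu> u v" "sobolev_pair u' v'" "sq_norm u' = sq_norm u" "sq_norm v' \<le> sq_norm v" "pot p u' = pot p u"
  shows "minimiser p \<mu> u' v'" "sq_norm v' = sq_norm v"
proof -
  have "pair_energy p u' v' \<le> pair_energy p u v" using assms by (simp add: pair_energy_def)
  moreover have "pair_energy p u v \<le> pair_energy p u' v'" using assms by (simp add: minimiser_def)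
  ultimately show "sq_norm v' = sq_norm v" using assms by (simp add: pair_energy_def)
  show "minimiser p \<mu> u' v'"
    using assms \<open>pair_energy p u' v' \<le> pair_energy p u v\<close> order_trans by (fastforce simp: minimiser_def)
qed

text \<open>The real and the imaginary part solve \<open>y = (lam - \<bar>u\<bar>^(p - 2)) y\<close>, a linear equation with bounded coefficient.\<close>

lemma neumann_sol_zero:
  assumes sol: "neumann_sol lam p u w" and p: "2 < p" and x0: "x0 \<in> {0..1}" "u x0 = 0" "w x0 = 0"
  shows "\<forall>x\<in>{0..1}. u x = 0"
proof -
  have c: "continuous_on {0..1} u" "continuous_on {0..1} w"
    and d: "\<And>x. x \<in> {0<..<1} \<Longrightarrow> (u has_vector_derivative w x) (at x)"
      "\<And>x. x \<in> {0<..<1} \<Longrightarrow> (w has_vector_derivative (lam *\<^sub>R u x - power_nl p (u x))) (at x)"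
    using sol by (auto simp: neumann_sol_def)
  define cf where "cf x = lam - cmod (u x) powr (p - 2)" for x
  have "continuous_on {0..1} cf" unfolding cf_def by (intro continuous_intros continuous_powr_cmod c) (use p in simp)
  then obtain C where C: "\<And>x. x \<in> {0..1} \<Longrightarrow> norm (cf x) \<le> C" by (rule continuous_bounded) blast
  have comp: "L (u x) = 0" if L: "bounded_linear L" and x: "x \<in> {0..1}" for L :: "complex \<Rightarrow> real" and x
  proof -
    interpret L: bounded_linear L by fact
    have "L (u x) = 0 \<and> L (w x) = 0"
    proof (rule linear_ode_zero[where x = x and y = "\<lambda>x. L (u x)" and z = "\<lambda>x. L (w x)" and c = cf and C = C and a = 0 and b = 1 and s = x0])
      show "continuous_on {0..1} (\<lambda>x. L (u x))" "continuous_on {0..1} (\<lambda>x. L (w x))"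
        using c by (auto intro: L.continuous_on)
      show "((\<lambda>x. L (u x)) has_real_derivative L (w x)) (at x)" if "x \<in> {0<..<1}" for x
        using L.has_vector_derivative[OF d(1)[OF that]] by (simp add: has_real_derivative_iff_has_vector_derivative)
      show "((\<lambda>x. L (w x)) has_real_derivative cf x * L (u x)) (at x)" if "x \<in> {0<..<1}" for x
        using L.has_vector_derivative[OF d(2)[OF that]]
        by (simp add: has_real_derivative_iff_has_vector_derivative power_nl_def L.diff L.scaleR cf_def algebra_simps)
      show "\<bar>cf x\<bar> \<le> C" if "x \<in> {0<..<1}" for x using C[of x] that by simp
    qed (use x x0 L.zero in simp_all)
    then show ?thesis by simp
  qed
  show ?thesis
    using comp[OF bounded_linear_Re] comp[OF bounded_linear_Im] by (simp add: complex_eq_iff)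
qed

text \<open>If a minimiser vanished at an interior point, then changing its sign to the right of that point
  would give another minimiser; but minimisers are continuously differentiable, so the
  derivative would vanish as well, and hence the whole function. At the end points the derivative vanishes anyway.\<close>

lemma minimiser_nonzero:
  assumes min: "minimiser p \<mu> u w" and sol: "neumann_sol lam p u w" and p: "2 < p" and \<mu>: "\<mu> > 0" and x0: "x0 \<in> {0..1}"
  shows "u x0 \<noteq> 0"
proof
  assume u0: "u x0 = 0"
  have sp: "sobolev_pair u w" and mass: "sq_norm u = \<mu>" using min by (auto simp: minimiser_def)
  have "w x0 = 0"
  proof (cases "x0 = 0 \<or> x0 = 1")
    case True
    then show ?thesis using sol by (auto simp: neumann_sol_def)
  next
    case False
    then have x0': "x0 \<in> {0<..<1}" using x0 by auto
    let ?u = "\<lambda>x. if x \<le> x0 then u x else - 1 * u x" and ?w = "\<lambda>x. if x \<le> x0 then w x else - 1 * w x"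
    have sp': "sobolev_pair ?u ?w"
      by (rule sobolev_pair_glue[OF sp sobolev_pair_mult[OF sp] x0]) (simp add: u0)
    have "sq_norm ?u = sq_norm u" "sq_norm ?w = sq_norm w" "pot p ?u = pot p u"
      unfolding sq_norm_def pot_def by (rule Bochner_Integration.integral_cong; simp)+
    then have "minimiser p \<mu> ?u ?w" using minimiser_cong[OF min sp'] by simp
    from minimiser_regular[OF this p \<mu>] obtain lam' w' where w': "neumann_sol lam' p ?u w'" by blast
    have d': "(?u has_vector_derivative w' x0) (at x0)" using w' x0' by (auto simp: neumann_sol_def)
    have d: "(u has_vector_derivative w x0) (at x0)" using sol x0' by (auto simp: neumann_sol_def)
    have "(?u has_vector_derivative w x0) (at x0 within {0..x0})"
      by (rule has_vector_derivative_transform[OF _ _ has_vector_derivative_at_within[OF d]]) (use x0' in auto)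
    then have "w' x0 = w x0"
      using vector_derivative_unique_within[OF _ has_vector_derivative_at_within[OF d']] x0'
      by (metis greaterThanLessThan_iff islimpt_Icc[of 0 x0] trivial_limit_within atLeastAtMost_iff less_imp_le order_refl)
    moreover have "(?u has_vector_derivative - w x0) (at x0 within {x0..1})"
      by (rule has_vector_derivative_transform[OF _ _ has_vector_derivative_minus[OF has_vector_derivative_at_within[OF d]]])
        (use x0' u0 in auto)
    then have "w' x0 = - w x0"
      using vector_derivative_unique_within[OF _ has_vector_derivative_at_within[OF d']] x0'
      by (metis greaterThanLessThan_iff islimpt_Icc[of x0 1] trivial_limit_within atLeastAtMost_iff less_imp_le order_refl)
    ultimately show ?thesis by simp
  qed
  from neumann_sol_zero[OF sol p x0 u0 this] have "sq_norm u = 0"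
    unfolding sq_norm_def by (intro integral_eq_zero_AE AE_I2) auto
  then show False using mass \<mu> by simp
qed

definition positive_sol :: "real \<Rightarrow> real \<Rightarrow> (real \<Rightarrow> real) \<Rightarrow> (real \<Rightarrow> real) \<Rightarrow> bool" where
  "positive_sol lam p R R' \<longleftrightarrow> continuous_on {0..1} R \<and> continuous_on {0..1} R' \<and> R' 0 = 0 \<and> R' 1 = 0 \<and>
     (\<forall>x\<in>{0..1}. R x > 0) \<and>
     (\<forall>x\<in>{0<..<1}. (R has_real_derivative R' x) (at x) \<and>
        (R' has_real_derivative (lam * R x - R x powr (p - 1))) (at x))"

definition real_minimiser :: "real \<Rightarrow> real \<Rightarrow> (real \<Rightarrow> real) \<Rightarrow> (real \<Rightarrow> real) \<Rightarrow> bool" where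
  "real_minimiser p \<mu> R R' \<longleftrightarrow> minimiser p \<mu> (\<lambda>x. complex_of_real (R x)) (\<lambda>x. complex_of_real (R' x))"

text \<open>After the rotation that makes \<open>u 0\<close> positive, the imaginary part solves a linear equation with vanishing data at \<open>0\<close>. The real part has no zero, hence no change of
  sign.\<close>

lemma minimiser_phase:
  assumes min0: "minimiser p \<mu> u v" and p: "2 < p" and \<mu>: "\<mu> > 0"
  obtains lam c R R' where "positive_sol lam p R R'" "real_minimiser p \<mu> R R'" "cmod c = 1"
    "\<And>x. x \<in> {0..1} \<Longrightarrow> u x = c * complex_of_real (R x)"
proof -
  obtain lam w where sol: "neumann_sol lam p u w" and min: "minimiser p \<mu> u w"
    using minimiser_regular[OF min0 p \<mu>] by blast
  have sp: "sobolev_pair u w" using min by (auto simp: minimiser_def)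
  have cont: "continuous_on {0..1} u" "continuous_on {0..1} w"
    and d: "\<And>x. x \<in> {0<..<1} \<Longrightarrow> (u has_vector_derivative w x) (at x)"
      "\<And>x. x \<in> {0<..<1} \<Longrightarrow> (w has_vector_derivative (lam *\<^sub>R u x - power_nl p (u x))) (at x)"
    and bc: "w 0 = 0" "w 1 = 0"
    using sol by (auto simp: neumann_sol_def)
  have nz: "u x \<noteq> 0" if "x \<in> {0..1}" for x by (rule minimiser_nonzero[OF min sol p \<mu> that])
  define c where "c = sgn (u 0)"
  have c: "cmod c = 1" using nz[of 0] by (simp add: c_def norm_sgn)
  have cc: "c * cnj c = 1" using complex_norm_square[of c] c by simp
  define y z where "y x = Im (cnj c * u x)" and "z x = Im (cnj c * w x)" for x
  define R R' where "R x = Re (cnj c * u x)" and "R' x = Re (cnj c * w x)" for x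
  have c0: "cnj c * u 0 = of_real (cmod (u 0))"
    using nz[of 0] by (simp add: c_def sgn_eq field_simps complex_norm_square power2_eq_square flip: complex_norm_square)
  define cf where "cf x = lam - cmod (u x) powr (p - 2)" for x
  have "continuous_on {0..1} cf" unfolding cf_def by (intro continuous_intros continuous_powr_cmod cont) (use p in simp)
  then obtain C where C: "\<And>x. x \<in> {0..1} \<Longrightarrow> norm (cf x) \<le> C" by (rule continuous_bounded) blast
  have dL: "((\<lambda>x. L (cnj c * u x)) has_real_derivative L (cnj c * w x)) (at x)"
      "((\<lambda>x. L (cnj c * w x)) has_real_derivative cf x * L (cnj c * u x)) (at x)"
    if L: "bounded_linear L" and x: "x \<in> {0<..<1}" for L x
  proof -
    have L': "bounded_linear (\<lambda>z. L (cnj c * z))"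
      by (rule bounded_linear_compose[OF L bounded_linear_mult_right])
    interpret L': bounded_linear "\<lambda>z. L (cnj c * z)" by fact
    show "((\<lambda>x. L (cnj c * u x)) has_real_derivative L (cnj c * w x)) (at x)"
      using L'.has_vector_derivative[OF d(1)[OF x]] by (simp add: has_real_derivative_iff_has_vector_derivative)
    have "L (cnj c * (lam *\<^sub>R u x - power_nl p (u x))) = cf x * L (cnj c * u x)"
      unfolding power_nl_def L'.diff L'.scaleR by (simp add: cf_def algebra_simps)
    then show "((\<lambda>x. L (cnj c * w x)) has_real_derivative cf x * L (cnj c * u x)) (at x)"
      using L'.has_vector_derivative[OF d(2)[OF x]] by (simp add: has_real_derivative_iff_has_vector_derivative)
  qed
  have contRI: "continuous_on {0..1} y" "continuous_on {0..1} z" "continuous_on {0..1} R" "continuous_on {0..1} R'"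
    unfolding y_def z_def R_def R'_def by (intro continuous_intros cont)+
  have yz: "y x = 0 \<and> z x = 0" if x: "x \<in> {0..1}" for x
  proof (rule linear_ode_zero[OF contRI(1,2) _ _ _ _ _ _ x])
    show "(y has_real_derivative z x) (at x)" "(z has_real_derivative cf x * y x) (at x)" if "x \<in> {0<..<1}" for x
      using dL[OF bounded_linear_Im that] by (simp_all add: y_def[abs_def] z_def[abs_def])
    show "\<bar>cf x\<bar> \<le> C" if "x \<in> {0<..<1}" for x using C[of x] that by simp
    show "y 0 = 0" by (simp only: y_def c0) simp
    show "z 0 = 0" by (simp add: z_def bc)
  qed simp
  have uR: "cnj c * u x = of_real (R x)" "cnj c * w x = of_real (R' x)" if "x \<in> {0..1}" for x
    using yz[OF that] by (simp_all add: complex_eq_iff R_def R'_def y_def z_def del: complex_cnj_cnj mult_eq_0_iff)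
  have u_eq: "u x = c * of_real (R x)" if "x \<in> {0..1}" for x
    using arg_cong[OF uR(1)[OF that], of "\<lambda>z. c * z"] cc by (simp flip: mult.assoc)
  have Rnz: "R x \<noteq> 0" if "x \<in> {0..1}" for x using nz[OF that] u_eq[OF that] by auto
  have R0: "R 0 > 0" using nz[of 0] by (simp only: R_def c0) simp
  have Rpos: "R x > 0" if x: "x \<in> {0..1}" for x
  proof (rule ccontr)
    assume "\<not> R x > 0"
    then have "\<exists>t\<ge>0. t \<le> x \<and> R t = 0"
      using R0 x by (intro IVT2' continuous_on_subset[OF contRI(3)]) auto
    then show False using Rnz x by auto
  qed
  have nu: "cmod (u x) = R x" if "x \<in> {0..1}" for x
    using u_eq[OF that] Rpos[OF that] c by (simp add: norm_mult)
  have "positive_sol lam p R R'"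
    unfolding positive_sol_def
  proof (intro conjI ballI contRI Rpos)
    show "R' 0 = 0" "R' 1 = 0" using bc by (simp_all add: R'_def)
    fix x :: real assume x: "x \<in> {0<..<1}"
    show "(R has_real_derivative R' x) (at x)"
      using dL(1)[OF bounded_linear_Re x] by (simp add: R_def[abs_def] R'_def)
    have "cf x * R x = lam * R x - R x powr (p - 1)"
      using nu[of x] Rpos[of x] x powr_mult_base[of "R x" "p - 2"] by (simp add: cf_def algebra_simps)
    then show "(R' has_real_derivative lam * R x - R x powr (p - 1)) (at x)"
      using dL(2)[OF bounded_linear_Re x] by (simp add: R_def R'_def[abs_def])
  qed auto
  moreover have "real_minimiser p \<mu> R R'"
  proof -
    have "sobolev_pair (\<lambda>x. complex_of_real (R x)) (\<lambda>x. complex_of_real (R' x))"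
    proof -
      have s: "sobolev_pair (\<lambda>x. cnj c * u x) (\<lambda>x. cnj c * w x)" by (rule sobolev_pair_mult[OF sp])
      obtain B where B: "\<And>x. x \<in> {0..1} \<Longrightarrow> norm (R' x) \<le> B" by (rule continuous_bounded[OF contRI(4)]) blast
      show ?thesis
      proof (rule sobolev_pair_if_derivative[of _ "{}"])
        show "continuous_on {0..1} (\<lambda>x. complex_of_real (R x))" by (intro continuous_intros contRI)
        show "((\<lambda>x. complex_of_real (R x)) has_vector_derivative complex_of_real (R' x)) (at x)" if "x \<in> {0<..<1} - {}" for x
          using \<open>positive_sol lam p R R'\<close> that
          by (intro has_vector_derivative_of_real) (auto simp: positive_sol_def)
        show "cmod (complex_of_real (R' x)) \<le> B" if "x \<in> {0<..<1}" for x using B[of x] that by simp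
      qed simp
    qed
    moreover have "sq_norm (\<lambda>x. complex_of_real (R x)) = sq_norm u" "pot p (\<lambda>x. complex_of_real (R x)) = pot p u"
      unfolding sq_norm_def pot_def by (rule Bochner_Integration.integral_cong; use nu Rpos in \<open>simp add: less_imp_le\<close>)+
    moreover have "sq_norm (\<lambda>x. complex_of_real (R' x)) = sq_norm w"
    proof -
      have "cmod (w x) = \<bar>R' x\<bar>" if "x \<in> {0..1}" for x
        using arg_cong[OF uR(2)[OF that], of cmod] c by (simp add: norm_mult)
      then show ?thesis unfolding sq_norm_def by (intro Bochner_Integration.integral_cong) auto
    qed
    ultimately show ?thesis unfolding real_minimiser_def using minimiser_cong(1)[OF min] by simp
  qed
  ultimately show ?thesis using that c u_eq by blast
qed

lemma powr_Lipschitz: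
  fixes s t B p :: real
  assumes "0 < s" "s \<le> B" "0 < t" "t \<le> B" "p > 2"
  shows "\<bar>s powr (p - 1) - t powr (p - 1)\<bar> \<le> (p - 1) * B powr (p - 2) * \<bar>s - t\<bar>"
proof -
  have lt: "\<bar>s powr (p - 1) - t powr (p - 1)\<bar> \<le> (p - 1) * B powr (p - 2) * \<bar>s - t\<bar>"
    if "0 < s" "t \<le> B" "s < t" for s t :: real
  proof -
    have "\<exists>z>s. z < t \<and> t powr (p - 1) - s powr (p - 1) = (t - s) * ((p - 1) * z powr (p - 2))"
      by (rule MVT2[OF that(3)]) (use that in \<open>auto intro!: derivative_eq_intros\<close>)
    then obtain z where z: "z > s" "z < t" "t powr (p - 1) - s powr (p - 1) = (t - s) * ((p - 1) * z powr (p - 2))" by blast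
    have "(t - s) * ((p - 1) * z powr (p - 2)) \<le> (t - s) * ((p - 1) * B powr (p - 2))"
      using z that assms by (intro mult_left_mono powr_mono2) auto
    moreover have "0 \<le> (t - s) * ((p - 1) * z powr (p - 2))" using that assms by auto
    ultimately show ?thesis using z(3) that by (simp add: mult.commute)
  qed
  show ?thesis
    using lt[of s t] lt[of t s] assms by (cases s t rule: linorder_cases) (auto simp: abs_minus_commute)
qed

text \<open>The difference of two solutions solves a linear equation whose coefficient, a difference quotient of the nonlinearity, is bounded because the solutions
  are.\<close>

lemma positive_ode_unique:
  fixes R S R' S' :: "real \<Rightarrow> real"
  assumes cont: "continuous_on {a..b} R" "continuous_on {a..b} R'" "continuous_on {a..b} S" "continuous_on {a..b} S'"
    and pos: "\<And>x. x \<in> {a..b} \<Longrightarrow> R x > 0" "\<And>x. x \<in> {a..b} \<Longrightarrow> S x > 0"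
    and R: "\<And>x. x \<in> {a<..<b} \<Longrightarrow> (R has_real_derivative R' x) (at x)"
      "\<And>x. x \<in> {a<..<b} \<Longrightarrow> (R' has_real_derivative lam * R x - R x powr (p - 1)) (at x)"
    and S: "\<And>x. x \<in> {a<..<b} \<Longrightarrow> (S has_real_derivative S' x) (at x)"
      "\<And>x. x \<in> {a<..<b} \<Longrightarrow> (S' has_real_derivative lam * S x - S x powr (p - 1)) (at x)"
    and init: "s \<in> {a..b}" "R s = S s" "R' s = S' s" and p: "p > 2" and x: "x \<in> {a..b}"
  shows "R x = S x \<and> R' x = S' x"
proof -
  have "compact (R ` {a..b})" "compact (S ` {a..b})" using cont compact_continuous_image by blast+
  then have "bounded (R ` {a..b})" "bounded (S ` {a..b})" using compact_imp_bounded by blast+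
  then obtain B1 B2 where B12: "\<And>y. y \<in> R ` {a..b} \<Longrightarrow> norm y \<le> B1" "\<And>y. y \<in> S ` {a..b} \<Longrightarrow> norm y \<le> B2"
    unfolding bounded_iff by blast
  have B: "R t \<le> max B1 B2" "S t \<le> max B1 B2" if "t \<in> {a..b}" for t
    using B12(1)[OF imageI[OF that]] B12(2)[OF imageI[OF that]] by auto
  \<comment> \<open>Where the solutions agree any bounded value would do.\<close>
  define c where "c t = (if R t = S t then lam else lam - (R t powr (p - 1) - S t powr (p - 1)) / (R t - S t))" for t
  define C where "C = \<bar>lam\<bar> + (p - 1) * (max B1 B2) powr (p - 2)"
  have "R x - S x = 0 \<and> R' x - S' x = 0"
  proof (rule linear_ode_zero[where y = "\<lambda>x. R x - S x" and z = "\<lambda>x. R' x - S' x" and x = x and s = s and a = a and b = b and c = c and C = C])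
    show "continuous_on {a..b} (\<lambda>x. R x - S x)" "continuous_on {a..b} (\<lambda>x. R' x - S' x)"
      by (intro continuous_intros cont)+
    fix t assume t: "t \<in> {a<..<b}"
    show "((\<lambda>x. R x - S x) has_real_derivative R' t - S' t) (at t)"
      by (rule DERIV_diff[OF R(1)[OF t] S(1)[OF t]])
    have "lam * R t - R t powr (p - 1) - (lam * S t - S t powr (p - 1)) = c t * (R t - S t)"
      by (simp add: c_def field_simps)
    then show "((\<lambda>x. R' x - S' x) has_real_derivative c t * (R t - S t)) (at t)"
      using DERIV_diff[OF R(2)[OF t] S(2)[OF t]] by simp
    show "\<bar>c t\<bar> \<le> C"
    proof (cases "R t = S t")
      case True
      then show ?thesis using p by (simp add: c_def C_def)
    next
      case False
      have "\<bar>R t powr (p - 1) - S t powr (p - 1)\<bar> \<le> (p - 1) * (max B1 B2) powr (p - 2) * \<bar>R t - S t\<bar>"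
        by (rule powr_Lipschitz) (use t pos B p in auto)
      moreover define q where "q = (R t powr (p - 1) - S t powr (p - 1)) / (R t - S t)"
      ultimately have "\<bar>q\<bar> \<le> (p - 1) * (max B1 B2) powr (p - 2)"
        using False by (simp add: abs_divide divide_le_eq)
      moreover have "c t = lam - q" using False by (simp add: c_def q_def)
      ultimately show ?thesis using abs_triangle_ineq4[of lam q] by (simp add: C_def)
    qed
  qed (use init x in auto)
  then show ?thesis by simp
qed

lemma integral_affine:
  fixes f :: "real \<Rightarrow> real"
  assumes cf: "continuous_on {0..1} f" and k: "k > 0" and b: "b \<ge> 0" and r: "0 \<le> a - k * b" "a \<le> 1"
  shows "integral {0..b} (\<lambda>x. f (a - k * x)) = (integral {0..a} f - integral {0..a - k * b} f) / k"
proof -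
  define F where "F x = integral {0..x} f" for x
  have cF: "continuous_on {0..1} F"
    unfolding F_def using cf by (intro indefinite_integral_continuous_1 integrable_continuous_real)
  have dF: "(F has_real_derivative f x) (at x)" if "x \<in> {0<..<1}" for x
    using integral_has_real_derivative[OF cf, of x] that at_within_Icc_at[of 0 x 1] by (auto simp: F_def[abs_def])
  have rng: "a - k * x \<in> {0..1}" if "x \<in> {0..b}" for x
  proof -
    have "k * x \<le> k * b" "0 \<le> k * x" using that k by auto
    then show ?thesis using r by auto
  qed
  have rng': "a - k * x \<in> {0<..<1}" if "x \<in> {0<..<b}" for x
  proof -
    have "k * x < k * b" "0 < k * x" using that k by auto
    then show ?thesis using r by auto
  qed
  have "((\<lambda>x. f (a - k * x)) has_integral (- F (a - k * b) / k) - (- F (a - k * 0) / k)) {0..b}"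
  proof (rule fundamental_theorem_of_calculus_interior[OF b])
    show "continuous_on {0..b} (\<lambda>x. - F (a - k * x) / k)"
      using rng k by (intro continuous_intros continuous_on_compose2[OF cF]) auto
    fix x assume x: "x \<in> {0<..<b}"
    have "((\<lambda>x. a - k * x) has_real_derivative - k) (at x)" by (auto intro!: derivative_eq_intros)
    from DERIV_chain2[OF dF[OF rng'[OF x]] this]
    have "((\<lambda>x. - F (a - k * x) / k) has_real_derivative f (a - k * x)) (at x)"
      by (rule DERIV_cong[OF DERIV_cdivide[OF DERIV_minus]]) (use k in simp)
    then show "((\<lambda>x. - F (a - k * x) / k) has_vector_derivative f (a - k * x)) (at x)"
      by (simp add: has_real_derivative_iff_has_vector_derivative)
  qed
  then show ?thesis by (simp add: integral_unique F_def diff_divide_distrib)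
qed

lemma sq_norm_eq_integral:
  assumes "continuous_on {0..1} f"
  shows "sq_norm (\<lambda>x. complex_of_real (f x)) = integral {0..1} (\<lambda>x. (f x)\<^sup>2)"
  unfolding sq_norm_of_real by (intro integral_unit_eq integrable_unit_continuous continuous_intros assms)

lemma pot_eq_integral:
  assumes "continuous_on {0..1} f" "p > 0"
  shows "pot p (\<lambda>x. complex_of_real (f x)) = integral {0..1} (\<lambda>x. \<bar>f x\<bar> powr p)"
  unfolding pot_def norm_of_real
  using assms by (intro integral_unit_eq integrable_unit_continuous continuous_on_powr' continuous_intros) auto

lemma sobolev_pair_of_real:
  assumes "continuous_on {0..1} f" "continuous_on {0..1} f'" "\<And>x. x \<in> {0<..<1} \<Longrightarrow> (f has_real_derivative f' x) (at x)"
  shows "sobolev_pair (\<lambda>x. complex_of_real (f x)) (\<lambda>x. complex_of_real (f' x))"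
proof -
  obtain B where B: "\<And>x. x \<in> {0..1} \<Longrightarrow> norm (f' x) \<le> B" by (rule continuous_bounded[OF assms(2)]) blast
  show ?thesis
  proof (rule sobolev_pair_if_derivative[of _ "{}"])
    show "continuous_on {0..1} (\<lambda>x. complex_of_real (f x))" by (intro continuous_intros assms)
    show "((\<lambda>x. complex_of_real (f x)) has_vector_derivative complex_of_real (f' x)) (at x)" if "x \<in> {0<..<1} - {}" for x
      using assms(3) that by (intro has_vector_derivative_of_real) auto
    show "cmod (complex_of_real (f' x)) \<le> B" if "x \<in> {0<..<1}" for x using B[of x] that by simp
  qed simp
qed

lemma positive_solD:
  assumes "positive_sol lam p R R'"
  shows "continuous_on {0..1} R" "continuous_on {0..1} R'" "R' 0 = 0" "R' 1 = 0"
    "\<And>x. x \<in> {0..1} \<Longrightarrow> R x > 0" "\<And>x. x \<in> {0<..<1} \<Longrightarrow> (R has_real_derivative R' x) (at x)"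
    "\<And>x. x \<in> {0<..<1} \<Longrightarrow> (R' has_real_derivative (lam * R x - R x powr (p - 1))) (at x)"
  using assms by (auto simp: positive_sol_def)

lemma positive_sol_reflect:
  assumes "positive_sol lam p R R'"
  shows "positive_sol lam p (\<lambda>x. R (1 - x)) (\<lambda>x. - R' (1 - x))"
proof -
  note s = positive_solD[OF assms]
  show ?thesis
    unfolding positive_sol_def
  proof (intro conjI ballI)
    show "continuous_on {0..1} (\<lambda>x. R (1 - x))" "continuous_on {0..1} (\<lambda>x. - R' (1 - x))"
      by (intro continuous_intros continuous_on_compose2[OF s(1)] continuous_on_compose2[OF s(2)]; auto)+
    fix x :: real assume x: "x \<in> {0<..<1}"
    then have x': "1 - x \<in> {0<..<1}" by auto
    have d: "((\<lambda>x. 1 - x) has_real_derivative - 1) (at x)" by (auto intro!: derivative_eq_intros)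
    show "((\<lambda>x. R (1 - x)) has_real_derivative - R' (1 - x)) (at x)"
      using DERIV_chain2[OF s(6)[OF x'] d] by simp
    show "((\<lambda>x. - R' (1 - x)) has_real_derivative lam * R (1 - x) - R (1 - x) powr (p - 1)) (at x)"
      using DERIV_minus[OF DERIV_chain2[OF s(7)[OF x'] d]] by simp
  qed (use s in auto)
qed

lemma real_minimiser_reflect:
  assumes min: "real_minimiser p \<mu> R R'" and sol: "positive_sol lam p R R'" and p: "p > 2"
  shows "real_minimiser p \<mu> (\<lambda>x. R (1 - x)) (\<lambda>x. - R' (1 - x))"
proof -
  note s = positive_solD[OF sol] and s' = positive_solD[OF positive_sol_reflect[OF sol]]
  have i: "integral {0..1} (\<lambda>x. f (1 - x)) = integral {0..1} f" if "continuous_on {0..1} f" for f :: "real \<Rightarrow> real"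
    using integral_affine[OF that, of 1 1 1] by simp
  have "sq_norm (\<lambda>x. complex_of_real (R (1 - x))) = sq_norm (\<lambda>x. complex_of_real (R x))"
    "sq_norm (\<lambda>x. complex_of_real (- R' (1 - x))) = sq_norm (\<lambda>x. complex_of_real (R' x))"
    using i[of "\<lambda>x. (R x)\<^sup>2"] i[of "\<lambda>x. (R' x)\<^sup>2"] s(1,2) s'(1,2)
    by (simp_all only: sq_norm_eq_integral power2_minus continuous_on_power)
  moreover have "pot p (\<lambda>x. complex_of_real (R (1 - x))) = pot p (\<lambda>x. complex_of_real (R x))"
  proof -
    have "continuous_on {0..1} (\<lambda>x. \<bar>R x\<bar> powr p)" using s(1) p by (intro continuous_on_powr' continuous_intros) auto
    then show ?thesis using i[of "\<lambda>x. \<bar>R x\<bar> powr p"] s(1) s'(1) p by (simp add: pot_eq_integral)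
  qed
  ultimately show ?thesis
    using min sobolev_pair_of_real[OF s'(1,2,6)] minimiser_cong(1) unfolding real_minimiser_def by (metis order_refl)
qed

text \<open>A critical point in the left half is a centre of symmetry. Replacing the
  symmetric piece by a monotone one of the same length and the same distribution divides the kinetic energy there by four,
  so the piece, and then the whole solution, is constant.\<close>

lemma critical_point_imp_constant_left:
  assumes sol: "positive_sol lam p R R'" and min: "real_minimiser p \<mu> R R'" and p: "p > 2"
    and x0: "0 < x0" "x0 \<le> 1 / 2" "R' x0 = 0" and x: "x \<in> {0..1}"
  shows "R x = R x0"
proof -
  note s = positive_solD[OF sol]
  define b where "b = 2 * x0"
  have b: "0 < b" "b \<le> 1" using x0 by (auto simp: b_def)
  have refl: "b - t \<in> {0..1}" "b - t \<in> {0..b}" "t \<in> {0..1}" if "t \<in> {0..b}" for t using that b by auto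
  have refl': "b - t \<in> {0<..<1}" "t \<in> {0<..<1}" if "t \<in> {0<..<b}" for t using that b by auto
  have sym: "R t = R (b - t) \<and> R' t = - R' (b - t)" if t: "t \<in> {0..b}" for t
  proof (rule positive_ode_unique[where a = 0 and b = b and s = x0 and lam = lam and p = p and S = "\<lambda>t. R (b - t)" and S' = "\<lambda>t. - R' (b - t)"])
    show "continuous_on {0..b} R" "continuous_on {0..b} R'"
      using b by (auto intro: continuous_on_subset[OF s(1)] continuous_on_subset[OF s(2)])
    show "continuous_on {0..b} (\<lambda>t. R (b - t))" "continuous_on {0..b} (\<lambda>t. - R' (b - t))"
      by (intro continuous_intros continuous_on_compose2[OF s(1)] continuous_on_compose2[OF s(2)]; use b in auto)+
    show "R t > 0" "R (b - t) > 0" if "t \<in> {0..b}" for t using s(5) refl[OF that] by auto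
    fix t assume t: "t \<in> {0<..<b}"
    show "(R has_real_derivative R' t) (at t)" "(R' has_real_derivative lam * R t - R t powr (p - 1)) (at t)"
      using s(6,7) refl'[OF t] by auto
    have d: "((\<lambda>t. b - t) has_real_derivative - 1) (at t)" by (auto intro!: derivative_eq_intros)
    show "((\<lambda>t. R (b - t)) has_real_derivative - R' (b - t)) (at t)"
      using DERIV_chain2[OF s(6)[OF refl'(1)[OF t]] d] by simp
    show "((\<lambda>t. - R' (b - t)) has_real_derivative lam * R (b - t) - R (b - t) powr (p - 1)) (at t)"
      using DERIV_minus[OF DERIV_chain2[OF s(7)[OF refl'(1)[OF t]] d]] by simp
  qed (use x0 p t in \<open>auto simp: b_def\<close>)
  have half: "integral {0..b} (\<lambda>t. H (x0 - t / 2)) = integral {0..b} H"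
    if cH: "continuous_on {0..1} H" and sH: "\<And>t. t \<in> {0..b} \<Longrightarrow> H t = H (b - t)" for H :: "real \<Rightarrow> real"
  proof -
    have "integral {0..x0} H = integral {0..x0} (\<lambda>t. H (b - 1 * t))"
    proof (rule Henstock_Kurzweil_Integration.integral_cong)
      show "H t = H (b - 1 * t)" if "t \<in> {0..x0}" for t
        using sH[of t] that x0 by (simp add: b_def)
    qed
    also have "\<dots> = integral {0..b} H - integral {0..x0} H"
      using integral_affine[OF cH, of 1 x0 b] x0 by (simp add: b_def)
    finally have "integral {0..b} H = 2 * integral {0..x0} H" by simp
    moreover have "integral {0..b} (\<lambda>t. H (x0 - 1/2 * t)) = 2 * integral {0..x0} H"
      using integral_affine[OF cH, of "1/2" b x0] x0 by (simp add: b_def)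
    ultimately show ?thesis by simp
  qed
  have split: "integral {0..1} (\<lambda>t. if t \<le> b then k * H (x0 - t / 2) else H t) = k * integral {0..b} H + integral {b..1} H"
    if cH: "continuous_on {0..1} H" and sH: "\<And>t. t \<in> {0..b} \<Longrightarrow> H t = H (b - t)" for H :: "real \<Rightarrow> real" and k
  proof -
    have cc: "continuous_on {0..b} (\<lambda>t. k * H (x0 - t / 2))"
      by (intro continuous_intros continuous_on_compose2[OF cH]) (use x0 in \<open>auto simp: b_def\<close>)
    have "((\<lambda>t. k * H (x0 - t / 2)) has_integral k * integral {0..b} H) {0..b}"
      using integrable_integral[OF integrable_continuous_real[OF cc]] half[OF that] by simp
    then have 1: "((\<lambda>t. if t \<le> b then k * H (x0 - t / 2) else H t) has_integral k * integral {0..b} H) {0..b}"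
      by (rule has_integral_eq[rotated]) auto
    have "(H has_integral integral {b..1} H) {b..1}"
      using b by (intro integrable_integral integrable_continuous_real continuous_on_subset[OF cH]) auto
    then have 2: "((\<lambda>t. if t \<le> b then k * H (x0 - t / 2) else H t) has_integral integral {b..1} H) {b..1}"
      by (rule has_integral_spike_finite[of "{b}", rotated 2]) auto
    show ?thesis
      using has_integral_combine[OF _ _ 1 2] b by (simp add: integral_unique)
  qed
  have comb: "integral {0..1} H = integral {0..b} H + integral {b..1} H" if "continuous_on {0..1} H" for H :: "real \<Rightarrow> real"
    using Henstock_Kurzweil_Integration.integral_combine[of 0 b 1 H] b integrable_continuous_real[OF that] by simp
  \<comment> \<open>The piece on \<open>[0, x0]\<close>, traversed backwards at half speed, takes the place of the symmetric piece on \<open>[0, b]\<close>; it ends at \<open>R 0 = R b\<close>.\<close>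
  define w where "w t = (if t \<le> b then R (x0 - t / 2) else R t)" for t
  define w' where "w' t = (if t \<le> b then - (1/2) * R' (x0 - t / 2) else R' t)" for t
  have cw: "continuous_on {0..1} w"
  proof -
    have "continuous_on ({0..b} \<union> {b..1}) w"
      unfolding w_def
    proof (rule continuous_on_If)
      show "continuous_on {0..b} (\<lambda>t. R (x0 - t / 2))"
        by (intro continuous_intros continuous_on_compose2[OF s(1)]) (use x0 in \<open>auto simp: b_def\<close>)
      show "continuous_on {b..1} R" using b by (intro continuous_on_subset[OF s(1)]) auto
      show "R (x0 - t / 2) = R t" if "t \<in> {0..b}" "\<not> t \<le> b" for t using that by auto
      show "R (x0 - t / 2) = R t" if "t \<in> {b..1}" "t \<le> b" for t
        using that sym[of 0] b by (simp add: b_def)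
    qed auto
    moreover have "{0..b} \<union> {b..1} = {0..1}" using b by auto
    ultimately show ?thesis by simp
  qed
  obtain B where B: "\<And>x. x \<in> {0..1} \<Longrightarrow> norm (R' x) \<le> B" by (rule continuous_bounded[OF s(2)]) blast
  have sw: "sobolev_pair (\<lambda>t. complex_of_real (w t)) (\<lambda>t. complex_of_real (w' t))"
  proof (rule sobolev_pair_if_derivative[of _ "{b}"])
    show "continuous_on {0..1} (\<lambda>t. complex_of_real (w t))" by (intro continuous_intros cw)
    fix t :: real
    show "((\<lambda>t. complex_of_real (w t)) has_vector_derivative complex_of_real (w' t)) (at t)" if t: "t \<in> {0<..<1} - {b}"
    proof (rule has_vector_derivative_of_real)
      show "(w has_real_derivative w' t) (at t)"
      proof (cases "t < b")
        case True
        then have t': "x0 - t / 2 \<in> {0<..<1}" using t x0 by (auto simp: b_def)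
        have "((\<lambda>t. x0 - t / 2) has_real_derivative - (1/2)) (at t)" by (auto intro!: derivative_eq_intros)
        from DERIV_chain2[OF s(6)[OF t'] this] have "((\<lambda>t. R (x0 - t / 2)) has_real_derivative w' t) (at t)"
          using True by (simp add: w'_def)
        then show ?thesis
          by (rule has_field_derivative_transform_within_open[of _ _ _ "{..<b}"]) (use True in \<open>auto simp: w_def\<close>)
      next
        case False
        then have "b < t" using t by auto
        then have "(R has_real_derivative w' t) (at t)" using s(6) t by (simp add: w'_def)
        then show ?thesis
          by (rule has_field_derivative_transform_within_open[of _ _ _ "{b<..}"]) (use \<open>b < t\<close> in \<open>auto simp: w_def\<close>)
      qed
    qed
    show "cmod (complex_of_real (w' t)) \<le> B" if "t \<in> {0<..<1}"
      using B[of t] B[of "x0 - t / 2"] that x0 by (auto simp: w'_def b_def)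
  qed simp
  have c2: "continuous_on {0..1} (\<lambda>t. (R t)\<^sup>2)" "continuous_on {0..1} (\<lambda>t. (R' t)\<^sup>2)"
    by (intro continuous_intros s)+
  have cp: "continuous_on {0..1} (\<lambda>t. \<bar>R t\<bar> powr p)"
    using p by (intro continuous_on_powr' continuous_intros s) auto
  have symH: "(R t)\<^sup>2 = (R (b - t))\<^sup>2" "(R' t)\<^sup>2 = (R' (b - t))\<^sup>2" "\<bar>R t\<bar> powr p = \<bar>R (b - t)\<bar> powr p"
    if "t \<in> {0..b}" for t
    using sym[OF that] by (metis power2_minus)+
  have m: "sq_norm (\<lambda>t. complex_of_real (w t)) = sq_norm (\<lambda>t. complex_of_real (R t))"
  proof -
    have "(\<lambda>t. (w t)\<^sup>2) = (\<lambda>t. if t \<le> b then 1 * (R (x0 - t / 2))\<^sup>2 else (R t)\<^sup>2)" by (auto simp: w_def)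
    then show ?thesis
      using split[OF c2(1) symH(1), of 1] comb[OF c2(1)] by (simp add: sq_norm_eq_integral cw s)
  qed
  have pt: "pot p (\<lambda>t. complex_of_real (w t)) = pot p (\<lambda>t. complex_of_real (R t))"
  proof -
    have "(\<lambda>t. \<bar>w t\<bar> powr p) = (\<lambda>t. if t \<le> b then 1 * \<bar>R (x0 - t / 2)\<bar> powr p else \<bar>R t\<bar> powr p)" by (auto simp: w_def)
    then show ?thesis
      using split[OF cp symH(3), of 1] comb[OF cp] p by (simp add: pot_eq_integral cw s)
  qed
  have Lw': "in_Lp 2 (\<lambda>t. complex_of_real (w' t))" using sw unfolding sobolev_pair_def by blast
  have k: "sq_norm (\<lambda>t. complex_of_real (w' t)) = 1/4 * integral {0..b} (\<lambda>t. (R' t)\<^sup>2) + integral {b..1} (\<lambda>t. (R' t)\<^sup>2)"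
  proof -
    have eq: "(\<lambda>t. (w' t)\<^sup>2) = (\<lambda>t. if t \<le> b then 1/4 * (R' (x0 - t / 2))\<^sup>2 else (R' t)\<^sup>2)"
      by (auto simp: w'_def power2_eq_square)
    have "sq_norm (\<lambda>t. complex_of_real (w' t)) = integral {0..1} (\<lambda>t. (w' t)\<^sup>2)"
      unfolding sq_norm_of_real using in_L2_sq_integrable[OF Lw'] by (intro integral_unit_eq) simp
    also have "\<dots> = 1/4 * integral {0..b} (\<lambda>t. (R' t)\<^sup>2) + integral {b..1} (\<lambda>t. (R' t)\<^sup>2)"
      unfolding eq by (rule split[OF c2(2) symH(2)])
    finally show ?thesis .
  qed
  have kR: "sq_norm (\<lambda>t. complex_of_real (R' t)) = integral {0..b} (\<lambda>t. (R' t)\<^sup>2) + integral {b..1} (\<lambda>t. (R' t)\<^sup>2)"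
    using comb[OF c2(2)] by (simp add: sq_norm_eq_integral s)
  have i0: "0 \<le> integral {0..b} (\<lambda>t. (R' t)\<^sup>2)"
    using b by (intro Henstock_Kurzweil_Integration.integral_nonneg integrable_continuous_real continuous_on_subset[OF c2(2)]) auto
  have "sq_norm (\<lambda>t. complex_of_real (w' t)) = sq_norm (\<lambda>t. complex_of_real (R' t))"
    by (rule minimiser_cong(2)[OF min[unfolded real_minimiser_def] sw m _ pt]) (use k kR i0 in simp)
  then have "integral {0..b} (\<lambda>t. (R' t)\<^sup>2) = 0" using k kR by simp
  then have R'0: "R' t = 0" if "t \<in> {0..b}" for t
    using integral_eq_0_iff[of 0 b "\<lambda>t. (R' t)\<^sup>2"] continuous_on_subset[OF c2(2), of "{0..b}"] b that by auto
  have x0': "x0 \<in> {0<..<1}" "x0 \<in> {0<..<b}" using x0 by (auto simp: b_def)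
  have "(R' has_real_derivative 0) (at x0)"
    by (rule has_field_derivative_transform_within_open[OF DERIV_const[of 0], of "{0<..<b}"]) (use x0' R'0 in auto)
  then have eq0: "lam * R x0 - R x0 powr (p - 1) = 0"
    using DERIV_unique s(7)[OF x0'(1)] by blast
  have "R x = R x0 \<and> R' x = 0"
    by (rule positive_ode_unique[where a = 0 and b = 1 and s = x0 and lam = lam and p = p and S = "\<lambda>t. R x0" and S' = "\<lambda>t. 0"])
      (use s x0 x0' p x eq0 in auto)
  then show ?thesis by simp
qed

text \<open>A critical point in the right half is moved to the left half by reflection.\<close>

lemma minimiser_constant_or_monotone:
  assumes sol: "positive_sol lam p R R'" and min: "real_minimiser p \<mu> R R'" and p: "p > 2"
  shows "(\<forall>x\<in>{0..1}. R x = R 0) \<or> (\<forall>x\<in>{0<..<1}. R' x < 0) \<or> (\<forall>x\<in>{0<..<1}. R' x > 0)"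
proof (cases "\<exists>x0\<in>{0<..<1}. R' x0 = 0")
  case True
  then obtain x0 where x0: "x0 \<in> {0<..<1}" "R' x0 = 0" by blast
  have "R x = R x0" if x: "x \<in> {0..1}" for x
  proof (cases "x0 \<le> 1/2")
    case True
    show ?thesis by (rule critical_point_imp_constant_left[OF sol min p _ True x0(2) x]) (use x0 in auto)
  next
    case False
    have "R (1 - (1 - x)) = R (1 - (1 - x0))"
      by (rule critical_point_imp_constant_left[OF positive_sol_reflect[OF sol] real_minimiser_reflect[OF min sol p] p])
        (use x0 False x in auto)
    then show ?thesis by simp
  qed
  then have "\<forall>x\<in>{0..1}. R x = R 0" by (metis atLeastAtMost_iff order_refl zero_le_one)
  then show ?thesis by blast
next
  case False
  have c: "continuous_on {0<..<1} R'"
    using positive_solD(2)[OF sol] by (rule continuous_on_subset) auto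
  have "connected (R' ` {0<..<1})" by (rule connected_continuous_image[OF c]) auto
  moreover have "0 \<notin> R' ` {0<..<1}" using False by auto
  ultimately have "(\<forall>y\<in>R' ` {0<..<1}. y < 0) \<or> (\<forall>y\<in>R' ` {0<..<1}. y > 0)"
    unfolding connected_iff_interval by (metis linorder_cases order.order_iff_strict)
  then show ?thesis by blast
qed

section \<open>Constant minimisers\<close>

text \<open>The second derivative \<open>r (r - 1) (1 + q)^(r - 2)\<close> is at least \<open>r (r - 1) / (1 + \<eta>)\<close>, because \<open>r - 2\<close> lies between \<open>-1\<close> and \<open>0\<close>.\<close>

lemma powr_second_order_bound:
  fixes q r \<eta> :: real
  assumes "1 < r" "r < 2" "\<bar>q\<bar> \<le> \<eta>" "\<eta> < 1"
  shows "1 + r * q + r * (r - 1) / (2 * (1 + \<eta>)) * q\<^sup>2 \<le> (1 + q) powr r"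
proof -
  define k where "k = r * (r - 1) / (1 + \<eta>)"
  define h where "h x = (1 + x) powr r - (1 + r * x + k / 2 * x\<^sup>2)" for x
  define h' where "h' x = r * (1 + x) powr (r - 1) - r - k * x" for x
  have eta: "0 \<le> \<eta>" using assms by linarith
  have dh: "(h has_real_derivative h' x) (at x)" if "\<bar>x\<bar> \<le> \<eta>" for x
    unfolding h_def h'_def using that assms by (auto intro!: derivative_eq_intros simp: power2_eq_square)
  have dh': "(h' has_real_derivative r * ((r - 1) * (1 + x) powr (r - 2)) - k) (at x)" if "\<bar>x\<bar> \<le> \<eta>" for x
    unfolding h'_def using that assms by (auto intro!: derivative_eq_intros)
  have pos: "0 \<le> r * ((r - 1) * (1 + x) powr (r - 2)) - k" if "\<bar>x\<bar> \<le> \<eta>" for x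
  proof -
    have x: "0 < 1 + x" "1 + x \<le> 1 + \<eta>" using that assms by auto
    have "1 / (1 + \<eta>) = (1 + \<eta>) powr (-1)" using eta by (simp add: powr_minus_divide)
    also have "\<dots> \<le> (1 + \<eta>) powr (r - 2)" using assms eta by (intro powr_mono) auto
    also have "\<dots> \<le> (1 + x) powr (r - 2)" using assms x by (intro powr_mono2') auto
    finally have "r * ((r - 1) * (1 / (1 + \<eta>))) \<le> r * ((r - 1) * (1 + x) powr (r - 2))"
      using assms by (intro mult_left_mono) auto
    then show ?thesis by (simp add: k_def)
  qed
  have h'0: "h' 0 = 0" and h0: "h 0 = 0" by (simp_all add: h'_def h_def)
  have "h q \<ge> 0"
  proof (cases "q \<ge> 0")
    case True
    have h'pos: "h' x \<ge> 0" if "0 \<le> x" "x \<le> \<eta>" for x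
    proof -
      have "h' 0 \<le> h' x"
      proof (rule DERIV_nonneg_imp_nondecreasing[OF that(1)])
        fix t assume "0 \<le> t" "t \<le> x"
        then have "\<bar>t\<bar> \<le> \<eta>" using that by auto
        then show "\<exists>y. (h' has_real_derivative y) (at t) \<and> 0 \<le> y" using dh' pos by blast
      qed
      then show ?thesis by (simp add: h'0)
    qed
    have "h 0 \<le> h q"
    proof (rule DERIV_nonneg_imp_nondecreasing[OF True])
      fix t assume t: "0 \<le> t" "t \<le> q"
      then have "t \<le> \<eta>" "\<bar>t\<bar> \<le> \<eta>" using assms(3) by auto
      then show "\<exists>y. (h has_real_derivative y) (at t) \<and> 0 \<le> y" using dh h'pos t(1) by blast
    qed
    then show ?thesis by (simp add: h0)
  next
    case False
    then have q: "q \<le> 0" by simp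
    have h'neg: "h' x \<le> 0" if "x \<le> 0" "- \<eta> \<le> x" for x
    proof -
      have "h' x \<le> h' 0"
      proof (rule DERIV_nonneg_imp_nondecreasing[OF that(1)])
        fix t assume "x \<le> t" "t \<le> 0"
        then have "\<bar>t\<bar> \<le> \<eta>" using that by auto
        then show "\<exists>y. (h' has_real_derivative y) (at t) \<and> 0 \<le> y" using dh' pos by blast
      qed
      then show ?thesis by (simp add: h'0)
    qed
    have "h 0 \<le> h q"
    proof (rule DERIV_nonpos_imp_nonincreasing[OF q])
      fix t assume t: "q \<le> t" "t \<le> 0"
      then have "- \<eta> \<le> t" "\<bar>t\<bar> \<le> \<eta>" using assms(3) by auto
      then show "\<exists>y. (h has_real_derivative y) (at t) \<and> y \<le> 0" using dh h'neg t(2) by blast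
    qed
    then show ?thesis by (simp add: h0)
  qed
  moreover have "k / 2 = r * (r - 1) / (2 * (1 + \<eta>))" by (simp add: k_def)
  ultimately show ?thesis unfolding h_def by simp
qed

lemma has_integral_one: "((\<lambda>x. 1::real) has_integral 1) {0..1::real}"
  using has_integral_const_real[of "1::real" 0 1] by simp

lemma has_integral_cos_powers:
  "((\<lambda>x. cos (pi * x)) has_integral 0) {0..1}"
  "((\<lambda>x. (cos (pi * x))\<^sup>2) has_integral 1/2) {0..1}"
  "((\<lambda>x. (cos (pi * x))^3) has_integral 0) {0..1}"
proof -
  have "((\<lambda>x. cos (pi * x)) has_integral (sin (pi * 1) / pi - sin (pi * 0) / pi)) {0..1}"
    by (rule fundamental_theorem_of_calculus)
      (auto intro!: derivative_eq_intros simp: has_real_derivative_iff_has_vector_derivative[symmetric])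
  then show "((\<lambda>x. cos (pi * x)) has_integral 0) {0..1}" by simp
  have "((\<lambda>x. (cos (pi * x))\<^sup>2) has_integral
      ((1 + sin (pi * 1) * cos (pi * 1) / pi) / 2 - (0 + sin (pi * 0) * cos (pi * 0) / pi) / 2)) {0..1}"
  proof (rule fundamental_theorem_of_calculus)
    fix x :: real
    have "((\<lambda>x. (x + sin (pi * x) * cos (pi * x) / pi) / 2) has_real_derivative
        (1 + (cos (pi * x) * pi * cos (pi * x) - sin (pi * x) * (sin (pi * x) * pi)) / pi) / 2) (at x within {0..1})"
      by (auto intro!: derivative_eq_intros simp: field_simps)
    moreover have "(1 + (cos (pi * x) * pi * cos (pi * x) - sin (pi * x) * (sin (pi * x) * pi)) / pi) / 2
        = (1 + (cos (pi * x))\<^sup>2 - (sin (pi * x))\<^sup>2) / 2"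
    proof -
      have "cos (pi * x) * pi * cos (pi * x) - sin (pi * x) * (sin (pi * x) * pi) = pi * ((cos (pi * x))\<^sup>2 - (sin (pi * x))\<^sup>2)"
        by (simp add: power2_eq_square algebra_simps)
      then show ?thesis by simp
    qed
    moreover have "\<dots> = (cos (pi * x))\<^sup>2" by (simp add: sin_squared_eq)
    ultimately show "((\<lambda>x. (x + sin (pi * x) * cos (pi * x) / pi) / 2) has_vector_derivative (cos (pi * x))\<^sup>2) (at x within {0..1})"
      by (simp add: has_real_derivative_iff_has_vector_derivative)
  qed simp
  then show "((\<lambda>x. (cos (pi * x))\<^sup>2) has_integral 1/2) {0..1}" by simp
  have "((\<lambda>x. (cos (pi * x))^3) has_integral
      ((sin (pi * 1) - (sin (pi * 1))^3 / 3) / pi - (sin (pi * 0) - (sin (pi * 0))^3 / 3) / pi)) {0..1}"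
  proof (rule fundamental_theorem_of_calculus)
    fix x :: real
    have "((\<lambda>x. (sin (pi * x) - (sin (pi * x))^3 / 3) / pi) has_real_derivative
        (cos (pi * x) * pi - 3 * (sin (pi * x))\<^sup>2 * (cos (pi * x) * pi) / 3) / pi) (at x within {0..1})"
      by (auto intro!: derivative_eq_intros)
    moreover have "(cos (pi * x) * pi - 3 * (sin (pi * x))\<^sup>2 * (cos (pi * x) * pi) / 3) / pi = (cos (pi * x))^3"
    proof -
      have "(cos (pi * x) * pi - 3 * (sin (pi * x))\<^sup>2 * (cos (pi * x) * pi) / 3) / pi = cos (pi * x) * (1 - (sin (pi * x))\<^sup>2)"
        by (simp add: field_simps)
      also have "1 - (sin (pi * x))\<^sup>2 = (cos (pi * x))\<^sup>2" by (simp add: sin_squared_eq)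
      finally show ?thesis by (simp add: power2_eq_square power3_eq_cube)
    qed
    ultimately show "((\<lambda>x. (sin (pi * x) - (sin (pi * x))^3 / 3) / pi) has_vector_derivative (cos (pi * x))^3) (at x within {0..1})"
      by (simp add: has_real_derivative_iff_has_vector_derivative)
  qed simp
  then show "((\<lambda>x. (cos (pi * x))^3) has_integral 0) {0..1}" by simp
qed

text \<open>A rotation of a constant towards the first nonconstant Neumann eigenfunction keeps the mass, and
  its energy is smaller once the mass exceeds the bifurcation value.\<close>

lemma constant_minimiser_mass:
  assumes min: "real_minimiser p \<mu> R R'" and p: "2 < p" "p \<le> 3" and \<mu>: "\<mu> > 0"
    and const: "\<And>x. x \<in> {0..1} \<Longrightarrow> R x = R 0" and pos: "R 0 > 0"
  shows "(p - 2) * \<mu> powr ((p - 2) / 2) \<le> pi\<^sup>2"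
proof -
  define r where "r = p / 2"
  have r: "1 < r" "r < 2" "p = 2 * r" using p by (auto simp: r_def)
  have eR: "(LINT x|unit_meas. F (R x)) = F (R 0)" for F :: "real \<Rightarrow> real"
  proof -
    have "(LINT x|unit_meas. F (R x)) = (LINT x|unit_meas. F (R 0))"
    proof (rule Bochner_Integration.integral_cong)
      fix x assume "x \<in> space unit_meas"
      then have "R x = R 0" by (intro const) simp
      then show "F (R x) = F (R 0)" by (rule arg_cong)
    qed simp
    then show ?thesis by (simp add: measure_unit)
  qed
  have R0: "(R 0)\<^sup>2 = \<mu>"
    using min eR[of "\<lambda>y. y\<^sup>2"] by (simp add: real_minimiser_def minimiser_def sq_norm_of_real)
  have "pot p (\<lambda>x. complex_of_real (R x)) = \<mu> powr r"
  proof -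
    have "pot p (\<lambda>x. complex_of_real (R x)) = \<bar>R 0\<bar> powr p"
      using eR[of "\<lambda>y. \<bar>y\<bar> powr p"] by (simp add: pot_def)
    also have "\<dots> = ((R 0)\<^sup>2) powr r"
      using pos powr_powr[of "R 0" 2 r] by (simp add: r)
    finally show ?thesis by (simp add: R0)
  qed
  then have enR: "- 1 / p * \<mu> powr r \<le> pair_energy p (\<lambda>x. complex_of_real (R x)) (\<lambda>x. complex_of_real (R' x))"
    using sq_norm_nonneg[of "\<lambda>x. complex_of_real (R' x)"] by (simp add: pair_energy_def)
  \<comment> \<open>The comparison at a fixed angle, with \<open>s\<close> its sine; the claim is the limit \<open>s \<rightarrow> 0\<close>.\<close>
  have main: "(p - 2) * \<mu> powr (r - 1) * (1 - s\<^sup>2) / (1 + 4 * s) \<le> pi\<^sup>2" if s: "0 < s" "s < 1/8" for s :: real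
  proof -
    define c where "c = sqrt (1 - s\<^sup>2)"
    have "s * s \<le> s * 1" using s by (intro mult_left_mono) auto
    then have s1: "s\<^sup>2 \<le> s" by (simp add: power2_eq_square)
    then have s2: "s\<^sup>2 \<le> s" "s\<^sup>2 < 1" using s by linarith+
    have c: "c\<^sup>2 = 1 - s\<^sup>2" "0 \<le> c" "c \<le> 1" using s2 by (auto simp: c_def)
    \<comment> \<open>The constant \<open>1\<close> rotated by a small angle towards the normalised eigenfunction \<open>sqrt 2 cos (pi x)\<close>; its square is \<open>1 + q\<close> with \<open>q\<close> of mean zero.\<close>
    define g where "g x = c + sqrt 2 * s * cos (pi * x)" for x
    define g' where "g' x = - (sqrt 2 * s * pi * sin (pi * x))" for x
    define q where "q x = (g x)\<^sup>2 - 1" for x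
    have cg: "continuous_on {0..1} g" "continuous_on {0..1} g'" unfolding g_def g'_def by (intro continuous_intros)+
    have dg: "(g has_real_derivative g' x) (at x)" for x
      unfolding g_def g'_def by (auto intro!: derivative_eq_intros)
    have q_eq: "q x = 2 * sqrt 2 * s * c * cos (pi * x) + s\<^sup>2 * (2 * (cos (pi * x))\<^sup>2 - 1)" for x
      using c(1) by (simp add: q_def g_def power2_sum power_mult_distrib algebra_simps)
    have "((\<lambda>x. 2 * sqrt 2 * s * c * cos (pi * x) + s\<^sup>2 * (2 * (cos (pi * x))\<^sup>2 - 1)) has_integral
        2 * sqrt 2 * s * c * 0 + s\<^sup>2 * (2 * (1/2) - 1)) {0..1}"
      by (intro has_integral_add has_integral_mult_right has_integral_diff has_integral_cos_powers has_integral_one)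
    then have iq: "(q has_integral 0) {0..1}" by (simp add: q_eq[abs_def])
    have ig: "((\<lambda>x. (g x)\<^sup>2) has_integral 1) {0..1}"
      using has_integral_add[OF iq has_integral_one] by (simp add: q_def)
    have ig': "((\<lambda>x. (g' x)\<^sup>2) has_integral pi\<^sup>2 * s\<^sup>2) {0..1}"
    proof -
      have "((\<lambda>x. 2 * s\<^sup>2 * pi\<^sup>2 * (1 - (cos (pi * x))\<^sup>2)) has_integral 2 * s\<^sup>2 * pi\<^sup>2 * (1 - 1/2)) {0..1}"
        by (intro has_integral_mult_right has_integral_diff has_integral_cos_powers has_integral_one)
      moreover have "(g' x)\<^sup>2 = 2 * s\<^sup>2 * pi\<^sup>2 * (1 - (cos (pi * x))\<^sup>2)" for x
        by (simp add: g'_def power_mult_distrib sin_squared_eq)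
      ultimately show ?thesis by (simp add: mult.commute)
    qed
    have qb: "\<bar>q x\<bar> \<le> 4 * s" for x
    proof -
      have "\<bar>q x\<bar> \<le> \<bar>2 * sqrt 2 * s * c * cos (pi * x)\<bar> + \<bar>s\<^sup>2 * (2 * (cos (pi * x))\<^sup>2 - 1)\<bar>"
        unfolding q_eq by (rule abs_triangle_ineq)
      also have "\<bar>2 * sqrt 2 * s * c * cos (pi * x)\<bar> \<le> 2 * sqrt 2 * s * 1 * 1"
        using c s unfolding abs_mult by (intro mult_mono) auto
      also have "\<bar>s\<^sup>2 * (2 * (cos (pi * x))\<^sup>2 - 1)\<bar> \<le> s\<^sup>2 * 1"
        unfolding abs_mult using cos_double_cos[of "pi * x"] by (intro mult_mono) (auto simp flip: cos_double_cos)
      also have "sqrt 2 \<le> 3/2" by (rule real_le_lsqrt) (auto simp: power2_eq_square)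
      finally show ?thesis using s s2 by (simp add: mult_right_mono)
    qed
    \<comment> \<open>Only the part of \<open>q\<^sup>2\<close> of order up to three in \<open>s\<close> is kept; the rest is a square.\<close>
    have lower: "1 + r * q x + r * (r - 1) / (2 * (1 + 4 * s)) * (8 * s\<^sup>2 * c\<^sup>2 * (cos (pi * x))\<^sup>2
        + 4 * sqrt 2 * s^3 * c * (2 * (cos (pi * x))^3 - cos (pi * x))) \<le> \<bar>g x\<bar> powr p" for x
    proof -
      have "8 * s\<^sup>2 * c\<^sup>2 * (cos (pi * x))\<^sup>2 + 4 * sqrt 2 * s^3 * c * (2 * (cos (pi * x))^3 - cos (pi * x))
          = (q x)\<^sup>2 - (s\<^sup>2 * (2 * (cos (pi * x))\<^sup>2 - 1))\<^sup>2"
        unfolding q_eq by (simp add: power2_eq_square power3_eq_cube algebra_simps)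
      then have "8 * s\<^sup>2 * c\<^sup>2 * (cos (pi * x))\<^sup>2 + 4 * sqrt 2 * s^3 * c * (2 * (cos (pi * x))^3 - cos (pi * x)) \<le> (q x)\<^sup>2"
        by simp
      then have "r * (r - 1) / (2 * (1 + 4 * s)) * (8 * s\<^sup>2 * c\<^sup>2 * (cos (pi * x))\<^sup>2
        + 4 * sqrt 2 * s^3 * c * (2 * (cos (pi * x))^3 - cos (pi * x))) \<le> r * (r - 1) / (2 * (1 + 4 * s)) * (q x)\<^sup>2"
        using r s by (intro mult_left_mono) auto
      moreover have "1 + r * q x + r * (r - 1) / (2 * (1 + 4 * s)) * (q x)\<^sup>2 \<le> (1 + q x) powr r"
        by (rule powr_second_order_bound[OF r(1,2) qb]) (use s in simp)
      moreover have "(1 + q x) powr r = \<bar>g x\<bar> powr p"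
        using powr_powr[of "\<bar>g x\<bar>" 2 r] by (simp add: q_def r)
      ultimately show ?thesis by linarith
    qed
    have i3: "((\<lambda>x. 1 + r * q x + r * (r - 1) / (2 * (1 + 4 * s)) * (8 * s\<^sup>2 * c\<^sup>2 * (cos (pi * x))\<^sup>2
        + 4 * sqrt 2 * s^3 * c * (2 * (cos (pi * x))^3 - cos (pi * x)))) has_integral
        1 + r * 0 + r * (r - 1) / (2 * (1 + 4 * s)) * (8 * s\<^sup>2 * c\<^sup>2 * (1/2)
        + 4 * sqrt 2 * s^3 * c * (2 * 0 - 0))) {0..1}"
      by (intro has_integral_add has_integral_mult_right has_integral_diff has_integral_cos_powers has_integral_one iq)
    have "continuous_on {0..1} (\<lambda>x. \<bar>g x\<bar> powr p)"
      using p cg by (intro continuous_on_powr' continuous_intros) auto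
    then have i4: "((\<lambda>x. \<bar>g x\<bar> powr p) has_integral integral {0..1} (\<lambda>x. \<bar>g x\<bar> powr p)) {0..1}"
      by (intro integrable_integral integrable_continuous_real)
    have P: "1 + r * (r - 1) * (2 * s\<^sup>2 * c\<^sup>2 / (1 + 4 * s)) \<le> integral {0..1} (\<lambda>x. \<bar>g x\<bar> powr p)"
    proof -
      have "r * (r - 1) / (2 * (1 + 4 * s)) * (8 * s\<^sup>2 * c\<^sup>2 * (1/2) + 4 * sqrt 2 * s^3 * c * (2 * 0 - 0))
          = r * (r - 1) * (2 * s\<^sup>2 * c\<^sup>2 / (1 + 4 * s))"
        using s by (simp add: field_simps)
      then show ?thesis using has_integral_le[OF i3 i4 lower] by simp
    qed
    define k where "k = sqrt \<mu>"
    have k: "k > 0" "k\<^sup>2 = \<mu>" "k powr p = \<mu> powr r"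
      using \<mu> powr_powr[of \<mu> "1/2" p] by (auto simp: k_def powr_half_sqrt r_def)
    have sp: "sobolev_pair (\<lambda>x. k *\<^sub>R complex_of_real (g x)) (\<lambda>x. k *\<^sub>R complex_of_real (g' x))"
      by (intro sobolev_pair_scaleR sobolev_pair_of_real cg dg)
    have "sq_norm (\<lambda>x. k *\<^sub>R complex_of_real (g x)) = \<mu>"
      using ig cg k by (simp only: sq_norm_scaleR sq_norm_eq_integral integral_unique mult_1_right)
    then have "pair_energy p (\<lambda>x. complex_of_real (R x)) (\<lambda>x. complex_of_real (R' x))
        \<le> pair_energy p (\<lambda>x. k *\<^sub>R complex_of_real (g x)) (\<lambda>x. k *\<^sub>R complex_of_real (g' x))"
      using min sp unfolding real_minimiser_def minimiser_def by blast
    also have "\<dots> = 1/2 * (\<mu> * (pi\<^sup>2 * s\<^sup>2)) - 1/p * (\<mu> powr r * integral {0..1} (\<lambda>x. \<bar>g x\<bar> powr p))"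
      unfolding pair_energy_def using ig' cg k p
      by (simp only: sq_norm_scaleR sq_norm_eq_integral integral_unique pot_scaleR) (simp add: pot_eq_integral cg)
    also have "\<dots> \<le> 1/2 * (\<mu> * (pi\<^sup>2 * s\<^sup>2)) - 1/p * (\<mu> powr r * (1 + r * (r - 1) * (2 * s\<^sup>2 * c\<^sup>2 / (1 + 4 * s))))"
      using P p by (intro diff_left_mono mult_left_mono) auto
    finally have f1: "1/p * (\<mu> powr r * (r * (r - 1) * (2 * s\<^sup>2 * c\<^sup>2 / (1 + 4 * s)))) \<le> 1/2 * (\<mu> * (pi\<^sup>2 * s\<^sup>2))"
      using enR by (simp add: algebra_simps)
    have f2: "1/p * (\<mu> powr r * (r * (r - 1) * (2 * s\<^sup>2 * c\<^sup>2 / (1 + 4 * s)))) = 1/2 * (\<mu> * s\<^sup>2) * ((p - 2) * \<mu> powr (r - 1) * (1 - s\<^sup>2) / (1 + 4 * s))"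
    proof -
      have m: "\<mu> powr r = \<mu> * \<mu> powr (r - 1)" using \<mu> by (simp add: powr_mult_base)
      have "1/p * (\<mu> powr r * (r * (r - 1) * (2 * s\<^sup>2 * c\<^sup>2 / (1 + 4 * s)))) = 1/2 * (\<mu> powr r * ((r - 1) * (2 * s\<^sup>2 * c\<^sup>2 / (1 + 4 * s))))"
        using r by simp
      also have "\<dots> = 1/2 * (\<mu> * s\<^sup>2) * (2 * (r - 1) * \<mu> powr (r - 1) * c\<^sup>2 / (1 + 4 * s))"
      proof -
        define K where "K = c\<^sup>2 / (1 + 4 * s)"
        have "2 * s\<^sup>2 * c\<^sup>2 / (1 + 4 * s) = 2 * s\<^sup>2 * K"
          "2 * (r - 1) * \<mu> powr (r - 1) * c\<^sup>2 / (1 + 4 * s) = 2 * (r - 1) * \<mu> powr (r - 1) * K"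
          by (simp_all add: K_def)
        then show ?thesis unfolding m by (simp only:) (simp add: algebra_simps)
      qed
      also have "2 * (r - 1) = p - 2" using r by simp
      finally show ?thesis by (simp only: c(1))
    qed
    have "1/2 * (\<mu> * (pi\<^sup>2 * s\<^sup>2)) = 1/2 * (\<mu> * s\<^sup>2) * pi\<^sup>2" by simp
    then have "1/2 * (\<mu> * s\<^sup>2) * ((p - 2) * \<mu> powr (r - 1) * (1 - s\<^sup>2) / (1 + 4 * s)) \<le> 1/2 * (\<mu> * s\<^sup>2) * pi\<^sup>2"
      using f1 unfolding f2 by (simp only:)
    moreover have "0 < 1/2 * (\<mu> * s\<^sup>2)" using \<mu> s by simp
    ultimately show ?thesis by (simp only: mult_le_cancel_left_pos)
  qed
  have "((\<lambda>s. (p - 2) * \<mu> powr (r - 1) * (1 - s\<^sup>2) / (1 + 4 * s)) \<longlongrightarrow> (p - 2) * \<mu> powr (r - 1) * (1 - 0\<^sup>2) / (1 + 4 * 0)) (at_right 0)"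
    by (intro tendsto_intros) auto
  moreover have "\<forall>\<^sub>F s in at_right 0. (p - 2) * \<mu> powr (r - 1) * (1 - s\<^sup>2) / (1 + 4 * s) \<le> pi\<^sup>2"
    unfolding eventually_at_right_field using main by (intro exI[of _ "1/8"]) auto
  ultimately have "(p - 2) * \<mu> powr (r - 1) * (1 - 0\<^sup>2) / (1 + 4 * 0) \<le> pi\<^sup>2"
    by (intro tendsto_upperbound) auto
  moreover have e: "(p - 2) / 2 = r - 1" by (simp add: r_def)
  ultimately show ?thesis unfolding e by simp
qed

section \<open>The period potential\<close>

lemma integral_id:
  "((\<lambda>s. s) has_integral 1/2) {0..1::real}"
proof -
  have "((\<lambda>s. s) has_integral (1\<^sup>2 / 2 - 0\<^sup>2 / 2)) {0..1::real}"
    by (rule fundamental_theorem_of_calculus)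
      (auto intro!: derivative_eq_intros simp: has_real_derivative_iff_has_vector_derivative[symmetric])
  then show ?thesis by simp
qed

lemma integral_square_id:
  "((\<lambda>s. s\<^sup>2) has_integral 1/3) {0..1::real}"
proof -
  have "((\<lambda>s. s\<^sup>2) has_integral (1^3 / 3 - 0^3 / 3)) {0..1::real}"
    by (rule fundamental_theorem_of_calculus)
      (auto intro!: derivative_eq_intros simp: has_real_derivative_iff_has_vector_derivative[symmetric])
  then show ?thesis by simp
qed

text \<open>The nonlinearity after scaling the equilibrium to \<open>1\<close>. Division by \<open>d\<close> makes the linearisation at the equilibrium independent of
  \<open>d\<close>, so that the half period of small orbits is always \<open>pi\<close>.\<close>

definition force :: "real \<Rightarrow> real \<Rightarrow> real" where
  "force d x = (x powr (1 + d) - x) / d"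

definition potential :: "real \<Rightarrow> real \<Rightarrow> real" where
  "potential d x = (x powr (2 + d) / (2 + d) - x\<^sup>2 / 2) / d + 1 / (2 * (2 + d))"

text \<open>In the variable \<open>X = x^d\<close> the potential is an integral from \<open>1\<close> to \<open>X\<close>; this affine parametrisation of the segment turns it into an integral
  over the unit interval.\<close>

definition weight :: "real \<Rightarrow> real \<Rightarrow> real \<Rightarrow> real" where
  "weight d x s = 1 - s + s * x powr d"

definition cdens :: "real \<Rightarrow> real \<Rightarrow> real \<Rightarrow> real" where
  "cdens d x s = s * (x powr (-2) * weight d x s powr (2 / d - 1))"

definition cdens' :: "real \<Rightarrow> real \<Rightarrow> real \<Rightarrow> real" where
  "cdens' d x s = - (s * (x powr (-3) * weight d x s powr (2 / d - 2) * (2 * (1 - s) + d * s * x powr d)))"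

text \<open>By Chicone's criterion the period of the orbits increases with the energy when the quotient \<open>potential / force\<^sup>2\<close> is convex.\<close>

definition chicone :: "real \<Rightarrow> real \<Rightarrow> real" where
  "chicone d x = integral {0..1} (cdens d x)"

definition chicone' :: "real \<Rightarrow> real \<Rightarrow> real" where
  "chicone' d x = integral {0..1} (cdens' d x)"

lemma force_eq:
  assumes "x > 0" shows "force d x = x * (x powr d - 1) / d"
proof -
  have "x powr (1 + d) = x * x powr d" using powr_mult_base[of x d] assms by simp
  then show ?thesis unfolding force_def by (simp only: right_diff_distrib mult_1_right)
qed

lemma weight_pos:
  assumes "x > 0" "s \<in> {0..1}" shows "weight d x s > 0"
proof (cases "s = 0")
  case False
  then have "s * x powr d > 0" using assms by auto
  then show ?thesis using assms by (simp add: weight_def)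
qed (simp add: weight_def)

lemma fst_powr_continuous:
  "continuous_on ({0<..} \<times> {0..1}) (\<lambda>p::real \<times> real. fst p powr m)"
  by (rule continuous_on_powr[OF continuous_on_fst[OF continuous_on_id] continuous_on_const]) auto

lemma snd_continuous: "continuous_on ({0<..} \<times> {0..1}) (\<lambda>p::real \<times> real. snd p)"
  by (rule continuous_on_snd[OF continuous_on_id])

lemma weight_continuous:
  "continuous_on ({0<..} \<times> {0..1}) (\<lambda>p. weight d (fst p) (snd p))"
  unfolding weight_def
  by (rule continuous_on_add[OF continuous_on_diff[OF continuous_on_const snd_continuous]
        continuous_on_mult[OF snd_continuous fst_powr_continuous]])

lemma weight_powr_continuous:
  "continuous_on ({0<..} \<times> {0..1}) (\<lambda>p. weight d (fst p) (snd p) powr m)"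
proof (rule continuous_on_powr[OF weight_continuous continuous_on_const])
  show "\<forall>p\<in>{0<..} \<times> {0..1}. weight d (fst p) (snd p) \<noteq> 0"
  proof
    fix p :: "real \<times> real" assume "p \<in> {0<..} \<times> {0..1}"
    then have "weight d (fst p) (snd p) > 0" by (intro weight_pos) auto
    then show "weight d (fst p) (snd p) \<noteq> 0" by simp
  qed
qed

lemma cdens_continuous:
  "continuous_on ({0<..} \<times> {0..1}) (\<lambda>(x, s). cdens d x s)"
  unfolding cdens_def case_prod_unfold
  by (rule continuous_on_mult[OF snd_continuous continuous_on_mult[OF fst_powr_continuous weight_powr_continuous]])

lemma cdens'_continuous:
  "continuous_on ({0<..} \<times> {0..1}) (\<lambda>(x, s). cdens' d x s)"
proof -
  have "continuous_on ({0<..} \<times> {0..1}) (\<lambda>p::real \<times> real. 2 * (1 - snd p) + d * snd p * fst p powr d)"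
    by (rule continuous_on_add[OF continuous_on_mult[OF continuous_on_const continuous_on_diff[OF continuous_on_const snd_continuous]]
          continuous_on_mult[OF continuous_on_mult[OF continuous_on_const snd_continuous] fst_powr_continuous]])
  then show ?thesis
    unfolding cdens'_def case_prod_unfold
    by (rule continuous_on_minus[OF continuous_on_mult[OF snd_continuous
          continuous_on_mult[OF continuous_on_mult[OF fst_powr_continuous weight_powr_continuous]]]])
qed

lemma cdens_continuous_s:
  assumes "x > 0" shows "continuous_on {0..1} (cdens d x)"
proof -
  have "continuous_on {0..1} (\<lambda>s. case (x, s) of (x, s) \<Rightarrow> cdens d x s)"
    by (rule continuous_on_compose2[OF cdens_continuous]) (use assms in \<open>auto intro!: continuous_intros\<close>)
  then show ?thesis by simp
qed

lemma cdens'_continuous_s: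
  assumes "x > 0" shows "continuous_on {0..1} (cdens' d x)"
proof -
  have "continuous_on {0..1} (\<lambda>s. case (x, s) of (x, s) \<Rightarrow> cdens' d x s)"
    by (rule continuous_on_compose2[OF cdens'_continuous]) (use assms in \<open>auto intro!: continuous_intros\<close>)
  then show ?thesis by simp
qed

lemma cdens_has_derivative:
  assumes x: "x > 0" and s: "s \<in> {0..1}" and d: "d > 0"
  shows "((\<lambda>x. cdens d x s) has_real_derivative cdens' d x s) (at x)"
proof -
  have W: "weight d x s > 0" by (rule weight_pos[OF x s])
  define m where "m = 2 / d - 1"
  have dW: "((\<lambda>x. weight d x s) has_real_derivative s * (d * x powr (d - 1))) (at x)"
    unfolding weight_def using x by (auto intro!: derivative_eq_intros)
  have 1: "((\<lambda>x. weight d x s powr m) has_real_derivative m * weight d x s powr (m - 1) * (s * (d * x powr (d - 1)))) (at x)"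
    using DERIV_fun_powr[OF dW W, of m] by simp
  have 2: "((\<lambda>x. x powr (-2)) has_real_derivative -2 * x powr (-3)) (at x)"
    using x by (auto intro!: derivative_eq_intros)
  have "((\<lambda>x. s * (x powr (-2) * weight d x s powr m)) has_real_derivative
     s * (-2 * x powr (-3) * weight d x s powr m + m * weight d x s powr (m - 1) * (s * (d * x powr (d - 1))) * x powr (-2))) (at x)"
    by (intro DERIV_cmult DERIV_mult 1 2)
  moreover have "s * (-2 * x powr (-3) * weight d x s powr m + m * weight d x s powr (m - 1) * (s * (d * x powr (d - 1))) * x powr (-2)) = cdens' d x s"
  proof -
    have e1: "weight d x s powr m = weight d x s powr (m - 1) * weight d x s"
      using powr_mult_base[of "weight d x s" "m - 1"] W by (simp add: mult.commute)
    have e2: "x powr (d - 1) * x powr (-2) = x powr (-3) * x powr d"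
      by (simp flip: powr_add)
    have "s * (-2 * x powr (-3) * weight d x s powr m + m * weight d x s powr (m - 1) * (s * (d * x powr (d - 1))) * x powr (-2))
        = s * weight d x s powr (m - 1) * (-2 * x powr (-3) * weight d x s + m * s * d * (x powr (d - 1) * x powr (-2)))"
      by (simp add: e1 algebra_simps)
    also have "\<dots> = s * weight d x s powr (m - 1) * (x powr (-3) * (-2 * weight d x s + m * s * d * x powr d))"
      unfolding e2 by (simp add: algebra_simps)
    also have "-2 * weight d x s + m * s * d * x powr d = - (2 * (1 - s) + d * s * x powr d)"
      using d by (simp add: weight_def m_def field_simps)
    also have "s * weight d x s powr (m - 1) * (x powr (-3) * - (2 * (1 - s) + d * s * x powr d)) = cdens' d x s"
    proof -
      have "m - 1 = 2 / d - 2" by (simp add: m_def)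
      then show ?thesis unfolding cdens'_def by (simp only:) (simp add: algebra_simps)
    qed
    finally show ?thesis .
  qed
  ultimately show ?thesis by (simp add: cdens_def m_def)
qed

lemma chicone_has_derivative:
  assumes x: "x > 0" and d: "d > 0"
  shows "(chicone d has_real_derivative chicone' d x) (at x)"
proof -
  have "((\<lambda>x. integral (cbox 0 1) (cdens d x)) has_field_derivative integral (cbox 0 1) (cdens' d x)) (at x within {0<..})"
  proof (rule leibniz_rule_field_derivative)
    show "((\<lambda>x. cdens d x t) has_real_derivative cdens' d x t) (at x within {0<..})"
      if "x \<in> {0<..}" "t \<in> cbox 0 1" for x t
      using cdens_has_derivative[of x t d] that d by (auto intro: has_field_derivative_at_within)
    show "cdens d x integrable_on cbox 0 1" if "x \<in> {0<..}" for x
      using cdens_continuous_s that by (intro integrable_continuous) auto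
    show "continuous_on ({0<..} \<times> cbox 0 1) (\<lambda>(x, t). cdens' d x t)"
      using cdens'_continuous by simp
  qed (use x in auto)
  moreover have "at x within {0<..} = at x" using x by (intro at_within_open) auto
  ultimately show ?thesis by (simp add: chicone_def[abs_def] chicone'_def)
qed

lemma chicone_continuous: "d > 0 \<Longrightarrow> continuous_on {0<..} (chicone d)"
proof (rule continuous_at_imp_continuous_on, rule ballI)
  fix x :: real assume "d > 0" "x \<in> {0<..}"
  then show "isCont (chicone d) x" by (intro DERIV_isCont[OF chicone_has_derivative]) auto
qed

lemma chicone'_continuous: "continuous_on {0<..} (chicone' d)"
proof -
  have "continuous_on {0<..} (\<lambda>x. integral (cbox 0 1) (cdens' d x))"
    by (rule integral_continuous_on_param) (use cdens'_continuous in simp)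
  then show ?thesis by (simp add: chicone'_def[abs_def])
qed

lemma chicone_lower_bound:
  assumes x: "x \<ge> 1" and d: "0 < d" "d \<le> 1"
  shows "x powr (-2) / 2 \<le> chicone d x"
proof -
  have i1: "((\<lambda>s. s * x powr (-2)) has_integral 1/2 * x powr (-2)) {0..1}"
    by (rule has_integral_mult_left[OF integral_id])
  have i2: "(cdens d x has_integral chicone d x) {0..1}"
    unfolding chicone_def using x by (intro integrable_integral integrable_continuous_real cdens_continuous_s) auto
  have le: "s * x powr (-2) \<le> cdens d x s" if "s \<in> {0..1}" for s
  proof -
    have "1 \<le> x powr d" using x d by (simp add: ge_one_powr_ge_zero)
    then have "s * 1 \<le> s * x powr d" using that by (intro mult_left_mono) auto
    then have "1 \<le> weight d x s" by (simp add: weight_def)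
    then have "1 \<le> weight d x s powr (2 / d - 1)" using d by (intro ge_one_powr_ge_zero) (auto simp: field_simps)
    then have "s * (x powr (-2) * 1) \<le> cdens d x s"
      unfolding cdens_def using that by (intro mult_left_mono) auto
    then show ?thesis by simp
  qed
  show ?thesis using has_integral_le[OF i1 i2 le] by simp
qed

lemma chicone_pos:
  assumes x: "x > 0" and d: "0 < d"
  shows "chicone d x > 0"
proof -
  have i: "integral {0..1} (cdens d x) \<noteq> 0"
  proof
    assume "integral {0..1} (cdens d x) = 0"
    then have "\<forall>s\<in>{0..1}. cdens d x s = 0"
      using integral_eq_0_iff[OF cdens_continuous_s[OF x, of d]] x by (auto simp: cdens_def)
    then have "cdens d x 1 = 0" by auto
    then show False using weight_pos[OF x, of 1 d] x by (simp add: cdens_def)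
  qed
  moreover have "0 \<le> integral {0..1} (cdens d x)"
    using x by (intro Henstock_Kurzweil_Integration.integral_nonneg integrable_continuous_real cdens_continuous_s) (auto simp: cdens_def)
  ultimately show ?thesis by (simp add: chicone_def)
qed

lemma chicone_1: "chicone d 1 = 1/2"
proof -
  have "cdens d 1 = (\<lambda>s. s)" by (simp add: cdens_def weight_def fun_eq_iff)
  then show ?thesis using integral_id by (simp add: chicone_def integral_unique)
qed

lemma potential_1: "d > 0 \<Longrightarrow> potential d 1 = 0"
proof -
  assume d: "d > 0"
  then have "1 / (2 + d) - 1 / 2 = - d / (2 * (2 + d))" by (simp add: field_simps)
  then show ?thesis using d by (simp add: potential_def)
qed

text \<open>The substitution that turns the segment from \<open>1\<close> to \<open>x^d\<close> into the unit interval cancels the square of the force. The resulting integral makes sense at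
  the equilibrium, where the quotient itself is of the form \<open>0 / 0\<close>, and shows that the quotient is smooth there and decreasing.\<close>

lemma potential_eq_chicone:
  assumes x: "x > 0" and d: "d > 0"
  shows "potential d x = chicone d x * (force d x)\<^sup>2"
proof (cases "x = 1")
  case True
  then show ?thesis using d by (simp add: potential_1 force_def)
next
  case False
  define X where "X = x powr d"
  define S where "S = X - 1"
  have X: "X > 0" "X \<noteq> 1" using x False d by (auto simp: X_def powr_eq_one_iff_gen)
  then have S: "S \<noteq> 0" by (simp add: S_def)
  have W: "weight d x s = 1 + S * s" for s by (simp add: weight_def S_def X_def algebra_simps)
  have Wp: "1 + S * s > 0" if "s \<in> {0..1}" for s using weight_pos[OF x that, of d] by (simp add: W)
  define a where "a = 2 / d"
  have a: "a > 0" using d by (simp add: a_def)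
  define F where "F s = ((1 + S * s) powr (a + 1) / (a + 1) - (1 + S * s) powr a / a) / S\<^sup>2" for s
  have dF: "(F has_real_derivative s * (1 + S * s) powr (a - 1)) (at s)" if s: "s \<in> {0..1}" for s
  proof -
    have dl: "((\<lambda>s. 1 + S * s) has_real_derivative S) (at s)" by (auto intro!: derivative_eq_intros)
    have "(F has_real_derivative (((a + 1) * (1 + S * s) powr (a + 1 - 1) * S) / (a + 1) - (a * (1 + S * s) powr (a - 1) * S) / a) / S\<^sup>2) (at s)"
      unfolding F_def using DERIV_fun_powr[OF dl Wp[OF s], of "a + 1"] DERIV_fun_powr[OF dl Wp[OF s], of a]
      by (intro DERIV_cdivide DERIV_diff) simp_all
    moreover have "(1 + S * s) powr a = (1 + S * s) * (1 + S * s) powr (a - 1)"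
      using powr_mult_base[of "1 + S * s" "a - 1"] Wp[OF s] by simp
    then have "(((a + 1) * (1 + S * s) powr (a + 1 - 1) * S) / (a + 1) - (a * (1 + S * s) powr (a - 1) * S) / a) / S\<^sup>2
        = ((1 + S * s) * (1 + S * s) powr (a - 1) * S - (1 + S * s) powr (a - 1) * S) / S\<^sup>2"
      using a by simp
    moreover have "\<dots> = s * (1 + S * s) powr (a - 1)" using S by (simp add: power2_eq_square field_simps)
    ultimately show ?thesis by simp
  qed
  have "((\<lambda>s. s * (1 + S * s) powr (a - 1)) has_integral F 1 - F 0) {0..1}"
    by (rule fundamental_theorem_of_calculus)
      (use dF in \<open>auto simp: has_real_derivative_iff_has_vector_derivative[symmetric] intro: has_field_derivative_at_within\<close>)
  then have "((\<lambda>s. (s * (1 + S * s) powr (a - 1)) * x powr (-2)) has_integral (F 1 - F 0) * x powr (-2)) {0..1}"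
    by (rule has_integral_mult_left)
  moreover have "(\<lambda>s. (s * (1 + S * s) powr (a - 1)) * x powr (-2)) = cdens d x"
    by (auto simp: cdens_def W a_def)
  ultimately have C: "chicone d x = (F 1 - F 0) * x powr (-2)" by (simp add: chicone_def integral_unique)
  have da: "d * a = 2" "d * (a + 1) = 2 + d" using d by (simp_all add: a_def field_simps)
  have Xa: "X powr a = x\<^sup>2" "X powr (a + 1) = x powr (2 + d)"
    using x unfolding X_def powr_powr da by simp_all
  have "chicone d x * (force d x)\<^sup>2 = (F 1 - F 0) * S\<^sup>2 / d\<^sup>2"
  proof -
    have "x powr (-2) = 1 / x\<^sup>2" using x by (simp add: powr_minus powr_numeral divide_inverse)
    moreover have "force d x = x * S / d" using x by (simp add: force_eq S_def X_def)
    ultimately show ?thesis using x by (simp add: C power_mult_distrib power_divide)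
  qed
  also have "(F 1 - F 0) * S\<^sup>2 = x powr (2 + d) / (a + 1) - x\<^sup>2 / a - (1 / (a + 1) - 1 / a)"
  proof -
    have "1 + S * 1 = X" by (simp add: S_def)
    then have "F 1 = (x powr (2 + d) / (a + 1) - x\<^sup>2 / a) / S\<^sup>2" "F 0 = (1 / (a + 1) - 1 / a) / S\<^sup>2"
      unfolding F_def by (simp_all only: Xa) simp
    then show ?thesis using S by (simp add: diff_divide_distrib[symmetric])
  qed
  also have "(x powr (2 + d) / (a + 1) - x\<^sup>2 / a - (1 / (a + 1) - 1 / a)) / d\<^sup>2 = potential d x"
  proof -
    have a1: "y / (a + 1) = d * (y / (2 + d))" "y / a = d * (y / 2)" for y
      using d by (simp_all add: a_def field_simps)
    have h: "1 / (2 + d) - 1 / 2 = - d / (2 * (2 + d))" using d by (simp add: field_simps)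
    have "x powr (2 + d) / (a + 1) - x\<^sup>2 / a - (1 / (a + 1) - 1 / a)
        = d * (x powr (2 + d) / (2 + d) - x\<^sup>2 / 2 - (1 / (2 + d) - 1 / 2))"
      unfolding a1 by (simp add: algebra_simps)
    then show ?thesis
      unfolding h potential_def using d by (simp add: power2_eq_square add_divide_distrib)
  qed
  finally show ?thesis by simp
qed

lemma potential_has_derivative:
  assumes "x > 0" "d > 0"
  shows "(potential d has_real_derivative force d x) (at x)"
proof -
  have "(potential d has_real_derivative ((2 + d) * x powr (2 + d - 1) / (2 + d) - 2 * x / 2) / d) (at x)"
    unfolding potential_def[abs_def] using assms by (auto intro!: derivative_eq_intros)
  moreover have "2 + d - 1 = 1 + d" by simp
  ultimately show ?thesis using assms by (simp add: force_def)
qed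

lemma force_has_derivative:
  assumes "x > 0" "d > 0"
  shows "(force d has_real_derivative ((1 + d) * x powr d - 1) / d) (at x)"
proof -
  have "(force d has_real_derivative ((1 + d) * x powr (1 + d - 1) - 1) / d) (at x)"
    unfolding force_def[abs_def] using assms by (auto intro!: derivative_eq_intros)
  then show ?thesis by simp
qed

text \<open>The signed square root of the potential. In the coordinates \<open>Z U\<close> and \<open>U' / sqrt 2\<close> the orbit of energy \<open>A\<^sup>2\<close> is a circle of radius \<open>A\<close>,
  so it is parametrised by an angle \<open>t\<close> with \<open>Z U = A sin t\<close>.\<close>

definition Z :: "real \<Rightarrow> real \<Rightarrow> real" where
  "Z d x = force d x * sqrt (chicone d x)"

lemma Z_squared:
  assumes "x > 0" "d > 0" shows "(Z d x)\<^sup>2 = potential d x"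
proof -
  have "(Z d x)\<^sup>2 = (force d x)\<^sup>2 * chicone d x"
    unfolding Z_def power_mult_distrib using chicone_pos[OF assms] by simp
  then show ?thesis using potential_eq_chicone[OF assms] by (simp only: mult.commute)
qed

lemma Z_1: "Z d 1 = 0" by (simp add: Z_def force_def)

text \<open>The derivative of \<open>potential = chicone force\<^sup>2\<close>, divided by the force.\<close>

lemma chicone_identity:
  assumes "x > 0" "d > 0"
  shows "chicone' d x * force d x + 2 * chicone d x * (((1 + d) * x powr d - 1) / d) = 1"
proof (cases "x = 1")
  case True
  then show ?thesis using assms by (simp add: force_def chicone_1)
next
  case False
  have f: "force d x \<noteq> 0"
  proof -
    have "x powr d \<noteq> 1" using False assms by (auto simp: powr_eq_one_iff_gen)
    then show ?thesis using assms by (simp add: force_eq)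
  qed
  have "((\<lambda>x. chicone d x * (force d x)\<^sup>2) has_real_derivative
      chicone' d x * (force d x)\<^sup>2 + 2 * force d x * (((1 + d) * x powr d - 1) / d) * chicone d x) (at x)"
    by (rule DERIV_cong[OF DERIV_mult[OF chicone_has_derivative[OF assms] DERIV_power[OF force_has_derivative[OF assms], of 2]]])
      (simp add: power2_eq_square algebra_simps)
  then have "(potential d has_real_derivative
      chicone' d x * (force d x)\<^sup>2 + 2 * force d x * (((1 + d) * x powr d - 1) / d) * chicone d x) (at x)"
    by (rule has_field_derivative_transform_within_open[of _ _ _ "{0<..}"])
      (use assms potential_eq_chicone in auto)
  then have "force d x = chicone' d x * (force d x)\<^sup>2 + 2 * force d x * (((1 + d) * x powr d - 1) / d) * chicone d x"
    using DERIV_unique[OF potential_has_derivative[OF assms]] by blast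
  also have "\<dots> = force d x * (chicone' d x * force d x + 2 * chicone d x * (((1 + d) * x powr d - 1) / d))"
    by (simp add: power2_eq_square algebra_simps)
  finally show ?thesis using f by (metis mult_cancel_left mult.right_neutral)
qed

lemma Z_has_derivative:
  assumes "x > 0" "d > 0"
  shows "(Z d has_real_derivative 1 / (2 * sqrt (chicone d x))) (at x)"
proof -
  define c f' where "c = chicone d x" and "f' = ((1 + d) * x powr d - 1) / d"
  have c: "c > 0" using chicone_pos[OF assms] by (simp add: c_def)
  have ds: "((\<lambda>x. sqrt (chicone d x)) has_real_derivative chicone' d x / (2 * sqrt c)) (at x)"
    using DERIV_chain2[OF DERIV_real_sqrt chicone_has_derivative[OF assms]] c
    by (simp add: c_def field_simps)
  have "(Z d has_real_derivative f' * sqrt c + chicone' d x / (2 * sqrt c) * force d x) (at x)"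
    unfolding Z_def[abs_def] using DERIV_mult[OF force_has_derivative[OF assms] ds] by (simp add: c_def f'_def)
  moreover have "f' * sqrt c + chicone' d x / (2 * sqrt c) * force d x = (chicone' d x * force d x + 2 * c * f') / (2 * sqrt c)"
  proof -
    have "2 * c * f' / (2 * sqrt c) = f' * sqrt c"
      using c real_div_sqrt[of c] by (simp add: field_simps)
    then show ?thesis by (simp add: add_divide_distrib)
  qed
  ultimately show ?thesis using chicone_identity[OF assms] by (simp add: c_def f'_def)
qed

lemma chicone'_nonpos:
  assumes "x > 0" "d > 0" shows "chicone' d x \<le> 0"
proof -
  have "0 \<le> integral {0..1} (\<lambda>s. - cdens' d x s)"
    using assms by (intro Henstock_Kurzweil_Integration.integral_nonneg integrable_neg integrable_continuous_real cdens'_continuous_s)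
      (auto simp: cdens'_def)
  then show ?thesis by (simp add: chicone'_def)
qed

lemma chicone_antimono:
  assumes "0 < x" "x \<le> y" "d > 0" shows "chicone d y \<le> chicone d x"
proof (rule DERIV_nonpos_imp_nonincreasing[OF assms(2)])
  fix z assume "x \<le> z" "z \<le> y"
  then have "z > 0" using assms by simp
  then show "\<exists>l. (chicone d has_real_derivative l) (at z) \<and> l \<le> 0"
    using chicone_has_derivative chicone'_nonpos assms(3) by blast
qed

lemma cdens'_eq:
  assumes "x > 0" "s \<in> {0..1}"
  shows "- cdens' d x s = cdens d x s / x * ((2 * (1 - s) + d * s * x powr d) / weight d x s)"
proof -
  have W: "weight d x s > 0" by (rule weight_pos[OF assms])
  have "weight d x s powr (2 / d - 2) = weight d x s powr (2 / d - 1) / weight d x s"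
    using W powr_diff[of "weight d x s" "2 / d - 1" 1] by simp
  moreover have "x powr (-3) = x powr (-2) / x"
    using assms powr_diff[of x "-2" 1] by simp
  ultimately show ?thesis by (simp add: cdens'_def cdens_def)
qed

text \<open>A quantitative form of convexity across the equilibrium. Minus the derivative of the density is the density divided by \<open>x\<close> times a factor, which
  is at least \<open>2 (1 - s) + d s\<close> for \<open>x = b\<close> and at most that for \<open>x = a\<close>. So the gap is at least \<open>1 / b - 1\<close> times the integral of \<open>2 (1 - s)\<close>
  against the density at \<open>b\<close>. That density is \<open>s\<close> times a function that decreases in \<open>s\<close>, and \<open>1 - s\<close> has mean \<open>1/3\<close>
  with respect to the weight \<open>s\<close>, so by Chebyshev's inequality the factor \<open>1 - s\<close> may be replaced by \<open>1/3\<close>.\<close>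

lemma chicone'_gap:
  assumes b: "0 < b" "b \<le> 1" and a: "1 \<le> a" and d: "0 < d" "d \<le> 1"
  shows "2 / 3 * (1 / b - 1) * chicone d b \<le> chicone' d a - chicone' d b"
proof -
  define \<psi> where "\<psi> s = b powr (-2) * weight d b s powr (2 / d - 1)" for s
  have X: "b powr d \<le> 1" "1 \<le> a powr d"
    using a b d by (auto intro: powr_le1 ge_one_powr_ge_zero)
  have m: "0 \<le> 2 / d - 1" using d by (simp add: field_simps)
  have pt: "2 * (1 / b - 1) * ((1/3) * cdens d b s + s * (2/3 - s) * \<psi> (2/3)) \<le> cdens' d a s - cdens' d b s"
    if s: "s \<in> {0..1}" for s
  proof -
    define \<rho> where "\<rho> = 2 * (1 - s) + d * s"
    have Wb: "weight d b s > 0" "weight d b s \<le> 1" and Wa: "1 \<le> weight d a s"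
      using weight_pos[of b s d] b s X mult_left_mono[of "b powr d" 1 s] mult_left_mono[of 1 "a powr d" s]
      by (auto simp: weight_def)
    have cb: "0 \<le> cdens d b s" using s by (simp add: cdens_def)
    have ca: "0 \<le> cdens d a s" using s by (simp add: cdens_def)
    have rho: "0 \<le> \<rho>" "2 * (1 - s) \<le> \<rho>" using s d by (auto simp: \<rho>_def)
    have rb: "\<rho> \<le> (2 * (1 - s) + d * s * b powr d) / weight d b s"
    proof -
      have "\<rho> * weight d b s - (2 * (1 - s) + d * s * b powr d) = - ((2 - d) * (1 - s) * s * (1 - b powr d))"
        by (simp add: \<rho>_def weight_def algebra_simps)
      moreover have "0 \<le> (2 - d) * (1 - s) * s * (1 - b powr d)"
        using d s X by (intro mult_nonneg_nonneg) auto
      ultimately show ?thesis using Wb by (simp add: le_divide_eq)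
    qed
    have ra: "(2 * (1 - s) + d * s * a powr d) / weight d a s \<le> \<rho>"
    proof -
      have "\<rho> * weight d a s - (2 * (1 - s) + d * s * a powr d) = (2 - d) * (1 - s) * s * (a powr d - 1)"
        by (simp add: \<rho>_def weight_def algebra_simps)
      moreover have "0 \<le> (2 - d) * (1 - s) * s * (a powr d - 1)"
        using d s X by (intro mult_nonneg_nonneg) auto
      ultimately show ?thesis using Wa by (simp add: divide_le_eq)
    qed
    have cab: "cdens d a s \<le> cdens d b s"
    proof -
      have mono: "(cdens d y s) \<le> cdens d x s" if "0 < x" "x \<le> y" for x y
      proof (rule DERIV_nonpos_imp_nonincreasing[OF that(2)])
        fix z assume "x \<le> z" "z \<le> y"
        then have z: "z > 0" using that by simp
        have "cdens' d z s \<le> 0" using z s d by (simp add: cdens'_def mult_nonneg_nonneg)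
        then show "\<exists>l. ((\<lambda>x. cdens d x s) has_real_derivative l) (at z) \<and> l \<le> 0"
          using cdens_has_derivative[OF z s d(1)] by blast
      qed
      show ?thesis by (rule mono) (use a b in auto)
    qed
    have A: "- cdens' d a s \<le> cdens d b s * \<rho>"
    proof -
      have "- cdens' d a s \<le> cdens d a s / a * \<rho>"
        unfolding cdens'_eq[of a s d, OF less_le_trans[OF zero_less_one a] s]
        using ra ca a by (intro mult_left_mono) auto
      also have "\<dots> \<le> cdens d b s / 1 * \<rho>"
        using cab ca cb a rho by (intro mult_right_mono frac_le) auto
      finally show ?thesis by simp
    qed
    have B: "cdens d b s / b * \<rho> \<le> - cdens' d b s"
      unfolding cdens'_eq[of b s d, OF b(1) s] using rb cb b by (intro mult_left_mono) auto
    have "2 * (1 / b - 1) * ((1 - s) * cdens d b s) = (1 / b - 1) * (2 * (1 - s) * cdens d b s)"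
      by (simp add: algebra_simps)
    also have "\<dots> \<le> (1 / b - 1) * (\<rho> * cdens d b s)"
      using rho b cb by (intro mult_left_mono mult_right_mono) auto
    also have "\<dots> = cdens d b s / b * \<rho> - cdens d b s * \<rho>" by (simp add: algebra_simps)
    also have "\<dots> \<le> cdens' d a s - cdens' d b s" using A B by linarith
    finally have 1: "2 * (1 / b - 1) * ((1 - s) * cdens d b s) \<le> cdens' d a s - cdens' d b s" .
    have "s * ((2/3 - s) * \<psi> (2/3)) \<le> s * ((2/3 - s) * \<psi> s)"
    proof (rule mult_left_mono)
      show "(2/3 - s) * \<psi> (2/3) \<le> (2/3 - s) * \<psi> s"
      proof (cases "s \<le> 2/3")
        case True
        have "weight d b (2/3) \<le> weight d b s"
        proof -
          have "(2/3 - s) * b powr d \<le> (2/3 - s) * 1" using True X by (intro mult_left_mono) auto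
          then show ?thesis by (simp add: weight_def algebra_simps)
        qed
        then have "\<psi> (2/3) \<le> \<psi> s" unfolding \<psi>_def
          using weight_pos[OF b(1), of "2/3" d] m by (intro mult_left_mono powr_mono2) auto
        then show ?thesis using True by (intro mult_left_mono) auto
      next
        case False
        have "weight d b s \<le> weight d b (2/3)"
        proof -
          have "(s - 2/3) * b powr d \<le> (s - 2/3) * 1" using False X by (intro mult_left_mono) auto
          then show ?thesis by (simp add: weight_def algebra_simps)
        qed
        then have "\<psi> s \<le> \<psi> (2/3)" unfolding \<psi>_def
          using Wb m by (intro mult_left_mono powr_mono2) auto
        then show ?thesis using False by (intro mult_left_mono_neg) auto
      qed
    qed (use s in auto)
    then have "(1/3) * cdens d b s + s * (2/3 - s) * \<psi> (2/3) \<le> (1 - s) * cdens d b s"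
      by (simp add: cdens_def \<psi>_def algebra_simps)
    then have "2 * (1 / b - 1) * ((1/3) * cdens d b s + s * (2/3 - s) * \<psi> (2/3)) \<le> 2 * (1 / b - 1) * ((1 - s) * cdens d b s)"
      using b by (intro mult_left_mono) (simp_all add: le_divide_eq)
    then show ?thesis using 1 by linarith
  qed
  have a0: "0 < a" using a by simp
  have ib: "(cdens d b has_integral chicone d b) {0..1}"
    unfolding chicone_def using b by (intro integrable_integral integrable_continuous_real cdens_continuous_s)
  have i': "(cdens' d x has_integral chicone' d x) {0..1}" if "x > 0" for x
    unfolding chicone'_def using that by (intro integrable_integral integrable_continuous_real cdens'_continuous_s)
  have "((\<lambda>s. (s * (2/3) - s\<^sup>2) * \<psi> (2/3)) has_integral (1/2 * (2/3) - 1/3) * \<psi> (2/3)) {0..1}"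
    by (rule has_integral_mult_left[OF has_integral_diff[OF has_integral_mult_left[OF integral_id] integral_square_id]])
  moreover have "(\<lambda>s. (s * (2/3) - s\<^sup>2) * \<psi> (2/3)) = (\<lambda>s. s * (2/3 - s) * \<psi> (2/3))"
    by (simp add: fun_eq_iff power2_eq_square right_diff_distrib)
  ultimately have i0: "((\<lambda>s. s * (2/3 - s) * \<psi> (2/3)) has_integral 0) {0..1}"
    by simp
  have "((\<lambda>s. 2 * (1 / b - 1) * ((1/3) * cdens d b s + s * (2/3 - s) * \<psi> (2/3))) has_integral
      2 * (1 / b - 1) * ((1/3) * chicone d b + 0)) {0..1}"
    by (rule has_integral_mult_right[OF has_integral_add[OF has_integral_mult_right[OF ib] i0]])
  from has_integral_le[OF this has_integral_diff[OF i'[OF a0] i'[OF b(1)]] pt]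
  show ?thesis by simp
qed

text \<open>On the left of the equilibrium the force is at least \<open>x - 1\<close>, whatever \<open>d\<close> is. This bounds the coordinate \<open>Z\<close> by the distance to the
  equilibrium.\<close>

lemma potential_le_left:
  assumes b: "0 < b" "b \<le> 1" and d: "0 < d"
  shows "potential d b \<le> (1 - b)\<^sup>2 / 2"
proof -
  have "(1 - 1)\<^sup>2 / 2 - potential d 1 \<le> (1 - b)\<^sup>2 / 2 - potential d b"
  proof (rule DERIV_nonpos_imp_nonincreasing[OF b(2)])
    fix x assume "b \<le> x" "x \<le> 1"
    then have x: "0 < x" "x \<le> 1" using b by auto
    have "((\<lambda>x. (1 - x)\<^sup>2 / 2) has_real_derivative - (1 - x)) (at x)"
      by (auto intro!: derivative_eq_intros)
    from DERIV_diff[OF this potential_has_derivative[OF x(1) d]]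
    have "((\<lambda>x. (1 - x)\<^sup>2 / 2 - potential d x) has_real_derivative - (1 - x) - force d x) (at x)" .
    moreover have "- (1 - x) - force d x \<le> 0"
    proof -
      have "1 + d * ln x \<le> exp (d * ln x)" by (rule exp_ge_add_one_self)
      then have "1 + d * ln x \<le> x powr d" using x by (simp add: powr_def)
      moreover have "1 - 1 / x \<le> ln x"
        using ln_le_minus_one[of "1 / x"] x by (simp add: ln_div)
      ultimately have "d * (1 - 1 / x) \<le> x powr d - 1" using d mult_left_mono[of "1 - 1/x" "ln x" d] by linarith
      then have "x * (d * (1 - 1 / x)) \<le> x * (x powr d - 1)" using x by (intro mult_left_mono) auto
      moreover have "x * (d * (1 - 1 / x)) = d * (x - 1)" using x by (simp add: field_simps)
      moreover have "x * (x powr d - 1) = d * force d x"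
        using d x by (simp add: force_eq)
      ultimately have "d * (x - 1) \<le> d * force d x" by simp
      then have "x - 1 \<le> force d x" using d by (simp only: mult_le_cancel_left_pos)
      then show ?thesis by simp
    qed
    ultimately show "\<exists>l. ((\<lambda>x. (1 - x)\<^sup>2 / 2 - potential d x) has_real_derivative l) (at x) \<and> l \<le> 0" by blast
  qed
  then show ?thesis using d by (simp add: potential_1)
qed

section \<open>Half period and mass as functions of the amplitude\<close>

text \<open>The coordinate \<open>Psi d\<close> recovers \<open>U\<close> from \<open>Z U\<close>. It is meaningful only on \<open>zrange d\<close>, which is bounded below.\<close>

definition Psi :: "real \<Rightarrow> real \<Rightarrow> real" where
  "Psi d = inv_into {0<..} (Z d)"

definition zrange :: "real \<Rightarrow> real set" where
  "zrange d = Z d ` {0<..}"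

text \<open>The time element of the orbit with respect to the angle: for \<open>U'' = - force d U\<close> and \<open>Z U = A sin t\<close>, the absolute value of the
  derivative of time with respect to \<open>t\<close> is \<open>qf d (A sin t)\<close>.\<close>

definition qf :: "real \<Rightarrow> real \<Rightarrow> real" where
  "qf d z = sqrt (2 * chicone d (Psi d z))"

definition qf' :: "real \<Rightarrow> real \<Rightarrow> real" where
  "qf' d z = sqrt 2 * chicone' d (Psi d z)"

definition wint :: "(real \<Rightarrow> real) \<Rightarrow> real \<Rightarrow> real \<Rightarrow> real" where
  "wint w d A = integral {- pi/2..pi/2} (\<lambda>t. w t * qf d (A * sin t))"

definition wint' :: "(real \<Rightarrow> real) \<Rightarrow> real \<Rightarrow> real \<Rightarrow> real" where
  "wint' w d A = integral {- pi/2..pi/2} (\<lambda>t. w t * (qf' d (A * sin t) * sin t))"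

definition half_period :: "real \<Rightarrow> real \<Rightarrow> real" where
  "half_period d = wint (\<lambda>t. 1) d"

definition half_period' :: "real \<Rightarrow> real \<Rightarrow> real" where
  "half_period' d = wint' (\<lambda>t. 1) d"

definition cos_moment :: "real \<Rightarrow> real \<Rightarrow> real" where
  "cos_moment d = wint (\<lambda>t. (cos t)\<^sup>2) d"

definition cos_moment' :: "real \<Rightarrow> real \<Rightarrow> real" where
  "cos_moment' d = wint' (\<lambda>t. (cos t)\<^sup>2) d"

definition orbit_mass :: "real \<Rightarrow> real \<Rightarrow> real" where
  "orbit_mass d A = integral {- pi/2..pi/2} (\<lambda>t. (Psi d (A * sin t))\<^sup>2 * qf d (A * sin t))"

text \<open>The logarithm of the mass of the solution on the unit interval, up to a constant that depends on \<open>d\<close> only.\<close>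

definition log_mass :: "real \<Rightarrow> real \<Rightarrow> real" where
  "log_mass d A = (4 / d - 1) * ln (half_period d A) + ln (orbit_mass d A)"

text \<open>The level \<open>A\<^sup>2\<close> of the potential is attained on both sides of the equilibrium, so the orbit of that energy is closed; \<open>A = 0\<close> is the equilibrium.\<close>

definition admissible :: "real \<Rightarrow> real \<Rightarrow> bool" where
  "admissible d A \<longleftrightarrow> 0 \<le> A \<and> A \<in> zrange d \<and> - A \<in> zrange d"

text \<open>The bound \<open>1/4\<close> makes \<open>(4 / d - 1) / 6\<close> exceed \<open>4 d\<close>, which is what the monotonicity of the mass comes down to.\<close>

locale near_linear =
  fixes d :: real
  assumes d: "0 < d" "d \<le> 1 / 4"
begin

lemma d1: "d \<le> 1" using d by simp

lemma Z_less:
  assumes "0 < x" "x < y" shows "Z d x < Z d y"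
proof (rule DERIV_pos_imp_increasing[OF assms(2)])
  fix z assume "x \<le> z" "z \<le> y"
  then have z: "z > 0" using assms(1) by simp
  then show "\<exists>l. (Z d has_real_derivative l) (at z) \<and> 0 < l"
    using Z_has_derivative[OF z d(1)] chicone_pos[OF z d(1)]
    by (intro exI[of _ "1 / (2 * sqrt (chicone d z))"]) simp
qed

lemma Z_le_iff: "0 < x \<Longrightarrow> 0 < y \<Longrightarrow> Z d x \<le> Z d y \<longleftrightarrow> x \<le> y"
  using Z_less[of x y] Z_less[of y x] by (cases x y rule: linorder_cases) auto

lemma Z_inj: "inj_on (Z d) {0<..}"
proof (rule inj_onI)
  fix x y assume "x \<in> {0<..}" "y \<in> {0<..}" "Z d x = Z d y"
  then show "x = y" using Z_le_iff[of x y] Z_le_iff[of y x] by simp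
qed

lemma Psi_Z: "x > 0 \<Longrightarrow> Psi d (Z d x) = x"
  unfolding Psi_def using Z_inj by (intro inv_into_f_f) auto

lemma Psi_pos: "z \<in> zrange d \<Longrightarrow> Psi d z > 0"
  using inv_into_into[of z "Z d" "{0<..}"] by (simp add: Psi_def zrange_def)

lemma Z_Psi: "z \<in> zrange d \<Longrightarrow> Z d (Psi d z) = z"
  unfolding Psi_def zrange_def by (rule f_inv_into_f)

lemma Z_in_zrange: "x > 0 \<Longrightarrow> Z d x \<in> zrange d"
  by (simp add: zrange_def)

lemma zrange_interval:
  assumes "z1 \<in> zrange d" "z2 \<in> zrange d" "z1 \<le> z" "z \<le> z2" shows "z \<in> zrange d"
proof -
  have "continuous_on {0<..} (Z d)"
    using DERIV_isCont[OF Z_has_derivative[OF _ d(1)]] by (intro continuous_at_imp_continuous_on) auto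
  then have "connected (zrange d)" unfolding zrange_def by (rule connected_continuous_image) auto
  then show ?thesis using assms unfolding connected_iff_interval by blast
qed

lemma Psi_mono:
  assumes "z1 \<in> zrange d" "z2 \<in> zrange d" "z1 \<le> z2" shows "Psi d z1 \<le> Psi d z2"
  using Z_le_iff[OF Psi_pos[OF assms(1)] Psi_pos[OF assms(2)]] Z_Psi assms by simp

lemma Psi_0: "0 \<in> zrange d" "Psi d 0 = 1"
  using Psi_Z[of 1] Z_in_zrange[of 1] by (simp_all add: Z_1)

lemma Psi_has_derivative:
  assumes z: "z \<in> zrange d"
  shows "(Psi d has_real_derivative 2 * sqrt (chicone d (Psi d z))) (at z)"
proof -
  define x where "x = Psi d z"
  have x: "x > 0" "Z d x = z" using Psi_pos[OF z] Z_Psi[OF z] by (auto simp: x_def)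
  have isc: "isCont (Psi d) (Z d x)"
  proof (rule isCont_inverse_function2[of "x/2" x "2*x"])
    show "Psi d (Z d y) = y" if "x/2 \<le> y" "y \<le> 2*x" for y using that x by (intro Psi_Z) auto
    show "isCont (Z d) y" if "x/2 \<le> y" "y \<le> 2*x" for y
      using that x by (intro DERIV_isCont[OF Z_has_derivative[OF _ d(1)]]) auto
  qed (use x in auto)
  have "(Psi d has_real_derivative inverse (1 / (2 * sqrt (chicone d (Psi d z))))) (at z)"
  proof (rule DERIV_inverse_function[where a = "Z d (x/2)" and b = "Z d (2*x)"])
    show "(Z d has_real_derivative 1 / (2 * sqrt (chicone d (Psi d z)))) (at (Psi d z))"
      using x by (intro Z_has_derivative d) (simp add: x_def)
    show "1 / (2 * sqrt (chicone d (Psi d z))) \<noteq> 0"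
      using chicone_pos[OF x(1) d(1)] by (simp add: x_def)
    show "Z d (x/2) < z" "z < Z d (2*x)" using x Z_less[of "x/2" x] Z_less[of x "2*x"] by auto
    show "isCont (Psi d) z" using isc x by simp
    show "Z d (Psi d y) = y" if "Z d (x/2) < y" "y < Z d (2*x)" for y
      by (rule Z_Psi[OF zrange_interval[OF Z_in_zrange[of "x/2"] Z_in_zrange[of "2*x"]]]) (use that x in auto)
  qed
  then show ?thesis by simp
qed

lemma Psi_continuous: "continuous_on (zrange d) (Psi d)"
  by (intro continuous_at_imp_continuous_on ballI DERIV_isCont[OF Psi_has_derivative])

lemma qf_pos: "z \<in> zrange d \<Longrightarrow> qf d z > 0"
  using chicone_pos[OF Psi_pos d(1)] by (simp add: qf_def)

lemma qf_eq: "qf d z = sqrt 2 * sqrt (chicone d (Psi d z))"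
  by (simp add: qf_def real_sqrt_mult)

lemma Psi_has_derivative_qf:
  assumes z: "z \<in> zrange d" shows "(Psi d has_real_derivative sqrt 2 * qf d z) (at z)"
  using Psi_has_derivative[OF z] by (simp add: qf_eq mult.assoc[symmetric])

lemma qf_has_derivative:
  assumes z: "z \<in> zrange d" shows "(qf d has_real_derivative qf' d z) (at z)"
proof -
  define c where "c = chicone d (Psi d z)"
  have c: "c > 0" using chicone_pos[OF Psi_pos[OF z] d(1)] by (simp add: c_def)
  have dc: "((\<lambda>z. chicone d (Psi d z)) has_real_derivative chicone' d (Psi d z) * (2 * sqrt c)) (at z)"
    using DERIV_chain2[OF chicone_has_derivative[OF Psi_pos[OF z] d(1)] Psi_has_derivative[OF z]] by (simp add: c_def)
  have "((\<lambda>z. sqrt (chicone d (Psi d z))) has_real_derivative (inverse (sqrt c) / 2) * (chicone' d (Psi d z) * (2 * sqrt c))) (at z)"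
    by (rule DERIV_chain2[OF _ dc]) (use DERIV_real_sqrt[OF c] in \<open>simp add: c_def\<close>)
  from DERIV_cmult[OF this, of "sqrt 2"]
  have 1: "(qf d has_real_derivative sqrt 2 * (inverse (sqrt c) / 2 * (chicone' d (Psi d z) * (2 * sqrt c)))) (at z)"
    by (simp add: qf_eq[abs_def])
  have e: "inverse (sqrt c) / 2 * (chicone' d (Psi d z) * (2 * sqrt c)) = chicone' d (Psi d z)"
    using c by (simp add: field_simps)
  show ?thesis using 1 unfolding e qf'_def .
qed

lemma qf_continuous: "continuous_on (zrange d) (qf d)"
  by (intro continuous_at_imp_continuous_on ballI DERIV_isCont[OF qf_has_derivative])

lemma qf'_continuous: "continuous_on (zrange d) (qf' d)"
proof -
  have "continuous_on (zrange d) (\<lambda>z. chicone' d (Psi d z))"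
    by (rule continuous_on_compose2[OF chicone'_continuous Psi_continuous]) (use Psi_pos in auto)
  then show ?thesis unfolding qf'_def[abs_def] by (intro continuous_intros)
qed

lemma admissible_range:
  assumes "admissible d B" "\<bar>z\<bar> \<le> B" shows "z \<in> zrange d"
  by (rule zrange_interval[of "- B" B]) (use assms in \<open>auto simp: admissible_def\<close>)

lemma admissible_sin:
  assumes "admissible d B" "A \<in> {0..B}" shows "A * sin t \<in> zrange d" "- A * \<bar>sin t\<bar> \<in> zrange d"
proof -
  have "\<bar>A * sin t\<bar> \<le> B * 1"
    unfolding abs_mult using assms by (intro mult_mono) auto
  then show "A * sin t \<in> zrange d" "- A * \<bar>sin t\<bar> \<in> zrange d"
    using admissible_range[OF assms(1)] by (simp_all add: abs_mult)
qed

lemma admissible_mono: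
  assumes "admissible d B" "A \<in> {0..B}" shows "admissible d A"
  using admissible_range[OF assms(1), of A] admissible_range[OF assms(1), of "- A"] assms(2) by (auto simp: admissible_def)

lemma wint_has_derivative:
  assumes B: "admissible d B" and A: "A \<in> {0..B}" and w: "continuous_on {- pi/2..pi/2} w"
  shows "(wint w d has_real_derivative wint' w d A) (at A within {0..B})"
proof -
  have "((\<lambda>A. integral (cbox (- pi/2) (pi/2)) (\<lambda>t. w t * qf d (A * sin t))) has_field_derivative
      integral (cbox (- pi/2) (pi/2)) (\<lambda>t. w t * (qf' d (A * sin t) * sin t))) (at A within {0..B})"
  proof (rule leibniz_rule_field_derivative[OF _ _ _ A])
    fix A t assume A: "A \<in> {0..B}"
    have "((\<lambda>A. A * sin t) has_real_derivative sin t) (at A)" by (auto intro!: derivative_eq_intros)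
    from DERIV_cmult[OF DERIV_chain2[OF qf_has_derivative[OF admissible_sin(1)[OF B A]] this], of "w t"]
    show "((\<lambda>A. w t * qf d (A * sin t)) has_real_derivative w t * (qf' d (A * sin t) * sin t)) (at A within {0..B})"
      by (rule has_field_derivative_at_within)
  next
    fix A assume A: "A \<in> {0..B}"
    have "continuous_on {- pi/2..pi/2} (\<lambda>t. qf d (A * sin t))"
      by (rule continuous_on_compose2[OF qf_continuous]) (use admissible_sin(1)[OF B A] in \<open>auto intro!: continuous_intros\<close>)
    then show "(\<lambda>t. w t * qf d (A * sin t)) integrable_on cbox (- pi/2) (pi/2)"
      using w by (intro integrable_continuous continuous_intros) auto
  next
    have c: "continuous_on ({0..B} \<times> {- pi/2..pi/2}) (\<lambda>p. qf' d (fst p * sin (snd p)))"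
    proof (rule continuous_on_compose2[OF qf'_continuous])
      show "continuous_on ({0..B} \<times> {- pi/2..pi/2}) (\<lambda>p. fst p * sin (snd p))" by (intro continuous_intros)
      show "(\<lambda>p. fst p * sin (snd p)) ` ({0..B} \<times> {- pi/2..pi/2}) \<subseteq> zrange d"
        using admissible_sin(1)[OF B] by auto
    qed
    have "continuous_on ({0..B} \<times> {- pi/2..pi/2}) (\<lambda>p. w (snd p))"
      by (rule continuous_on_compose2[OF w]) (auto intro!: continuous_intros)
    then show "continuous_on ({0..B} \<times> cbox (- pi/2) (pi/2)) (\<lambda>(A, t). w t * (qf' d (A * sin t) * sin t))"
      unfolding case_prod_unfold using c by (intro continuous_intros) auto
  qed auto
  then show ?thesis by (simp add: wint_def[abs_def] wint'_def)
qed

context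
  fixes A assumes A: "admissible d A"
begin

lemma A_sin: "A * sin t \<in> zrange d" "- A * \<bar>sin t\<bar> \<in> zrange d"
  using admissible_sin[OF A, of A t] A by (auto simp: admissible_def)

lemma cont_Psi_sin: "continuous_on S (\<lambda>t. Psi d (A * sin t))"
  by (rule continuous_on_compose2[OF Psi_continuous]) (use A_sin in \<open>auto intro!: continuous_intros\<close>)

lemma cont_qf_sin: "continuous_on S (\<lambda>t. qf d (A * sin t))"
  by (rule continuous_on_compose2[OF qf_continuous]) (use A_sin in \<open>auto intro!: continuous_intros\<close>)

lemma cont_qf'_sin: "continuous_on S (\<lambda>t. qf' d (A * sin t))"
  by (rule continuous_on_compose2[OF qf'_continuous]) (use A_sin in \<open>auto intro!: continuous_intros\<close>)

lemma wint_has_integral: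
  assumes "continuous_on {- pi/2..pi/2} w"
  shows "((\<lambda>t. w t * qf d (A * sin t)) has_integral wint w d A) {- pi/2..pi/2}"
    "((\<lambda>t. w t * (qf' d (A * sin t) * sin t)) has_integral wint' w d A) {- pi/2..pi/2}"
  unfolding wint_def wint'_def
  by (intro integrable_integral integrable_continuous_real continuous_intros assms cont_qf_sin cont_qf'_sin)+

lemma half_period_has_integral:
  "((\<lambda>t. qf d (A * sin t)) has_integral half_period d A) {- pi/2..pi/2}"
  "((\<lambda>t. qf' d (A * sin t) * sin t) has_integral half_period' d A) {- pi/2..pi/2}"
  using wint_has_integral[of "\<lambda>t. 1"] by (simp_all add: half_period_def half_period'_def)

lemma cos_moment_has_integral:
  "((\<lambda>t. (cos t)\<^sup>2 * qf d (A * sin t)) has_integral cos_moment d A) {- pi/2..pi/2}"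
  "((\<lambda>t. (cos t)\<^sup>2 * (qf' d (A * sin t) * sin t)) has_integral cos_moment' d A) {- pi/2..pi/2}"
  unfolding cos_moment_def cos_moment'_def by (intro wint_has_integral continuous_intros)+

lemma dsin: "((\<lambda>t. A * sin t) has_real_derivative A * cos t) (at t)"
  by (auto intro!: derivative_eq_intros)

text \<open>This is the relation \<open>J' = 2 A T\<close> between the action \<open>J = 2 A\<^sup>2 K\<close> and the half period \<open>T\<close>, where \<open>K\<close> is the cosine moment.\<close>

lemma action_identity: "2 * cos_moment d A - half_period d A + A * cos_moment' d A = 0"
proof -
  have "((\<lambda>t. (cos t * cos t - sin t * sin t) * qf d (A * sin t) + qf' d (A * sin t) * (A * cos t) * (cos t * sin t)) has_integral
      (cos (pi/2) * sin (pi/2) * qf d (A * sin (pi/2)) - cos (- pi/2) * sin (- pi/2) * qf d (A * sin (- pi/2)))) {- pi/2..pi/2}"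
  proof (rule fundamental_theorem_of_calculus)
    fix t :: real
    have cs: "((\<lambda>t. cos t * sin t) has_real_derivative cos t * cos t - sin t * sin t) (at t)"
      by (auto intro!: derivative_eq_intros)
    have "((\<lambda>t. cos t * sin t * qf d (A * sin t)) has_real_derivative
        (cos t * cos t - sin t * sin t) * qf d (A * sin t) + qf' d (A * sin t) * (A * cos t) * (cos t * sin t)) (at t)"
      by (rule DERIV_mult[OF cs DERIV_chain2[OF qf_has_derivative[OF A_sin(1)] dsin]])
    then show "((\<lambda>t. cos t * sin t * qf d (A * sin t)) has_vector_derivative
        (cos t * cos t - sin t * sin t) * qf d (A * sin t) + qf' d (A * sin t) * (A * cos t) * (cos t * sin t)) (at t within {- pi/2..pi/2})"
      by (simp add: has_real_derivative_iff_has_vector_derivative has_vector_derivative_at_within)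
  qed simp
  moreover have "(\<lambda>t. (cos t * cos t - sin t * sin t) * qf d (A * sin t) + qf' d (A * sin t) * (A * cos t) * (cos t * sin t))
      = (\<lambda>t. 2 * ((cos t)\<^sup>2 * qf d (A * sin t)) - qf d (A * sin t) + A * ((cos t)\<^sup>2 * (qf' d (A * sin t) * sin t)))"
  proof
    fix t :: real
    have "cos t * cos t - sin t * sin t = 2 * (cos t)\<^sup>2 - 1"
      using sin_cos_squared_add[of t] by (simp add: power2_eq_square)
    then show "(cos t * cos t - sin t * sin t) * qf d (A * sin t) + qf' d (A * sin t) * (A * cos t) * (cos t * sin t)
      = 2 * ((cos t)\<^sup>2 * qf d (A * sin t)) - qf d (A * sin t) + A * ((cos t)\<^sup>2 * (qf' d (A * sin t) * sin t))"
      by (simp only:) (simp add: power2_eq_square algebra_simps)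
  qed
  ultimately have "((\<lambda>t. 2 * ((cos t)\<^sup>2 * qf d (A * sin t)) - qf d (A * sin t) + A * ((cos t)\<^sup>2 * (qf' d (A * sin t) * sin t))) has_integral 0) {- pi/2..pi/2}"
    by simp
  moreover have "((\<lambda>t. 2 * ((cos t)\<^sup>2 * qf d (A * sin t)) - qf d (A * sin t) + A * ((cos t)\<^sup>2 * (qf' d (A * sin t) * sin t))) has_integral
      2 * cos_moment d A - half_period d A + A * cos_moment' d A) {- pi/2..pi/2}"
    by (rule has_integral_add[OF has_integral_diff[OF has_integral_mult_right[OF cos_moment_has_integral(1)] half_period_has_integral(1)]
          has_integral_mult_right[OF cos_moment_has_integral(2)]])
  ultimately show ?thesis by (rule has_integral_unique[symmetric])
qed

text \<open>The energy relation expresses the power \<open>Psi^(2 + d)\<close> by \<open>z\<close> and \<open>Psi\<^sup>2\<close>, so that no power with exponent \<open>d\<close> remains.\<close>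

lemma Psi_force:
  assumes z: "z \<in> zrange d"
  shows "z * Psi d z = ((2 + d) * z\<^sup>2 - 1/2 + (Psi d z)\<^sup>2 / 2) * qf d z / sqrt 2"
proof -
  define x where "x = Psi d z"
  have x: "x > 0" "Z d x = z" using Psi_pos[OF z] Z_Psi[OF z] by (auto simp: x_def)
  have "z\<^sup>2 = potential d x" using Z_squared[OF x(1) d(1)] x(2) by simp
  moreover have "d * potential d x = x powr (2 + d) / (2 + d) - x\<^sup>2 / 2 + d / (2 * (2 + d))"
    using d by (simp add: potential_def distrib_left)
  moreover define k where "k = d / (2 * (2 + d))"
  ultimately have "x powr (2 + d) / (2 + d) = d * z\<^sup>2 - k + x\<^sup>2 / 2" by simp
  moreover have "x powr (2 + d) = (2 + d) * (x powr (2 + d) / (2 + d))" using d by simp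
  ultimately have "x powr (2 + d) = (2 + d) * (d * z\<^sup>2 - k + x\<^sup>2 / 2)" by (simp only:)
  moreover have "(2 + d) * k = d / 2" using d by (simp add: k_def field_simps)
  moreover have "(2 + d) * (d * z\<^sup>2 - k + x\<^sup>2 / 2) = (2 + d) * (d * z\<^sup>2 + x\<^sup>2 / 2) - (2 + d) * k"
    by (simp add: algebra_simps)
  ultimately have "x powr (2 + d) = (2 + d) * (d * z\<^sup>2 + x\<^sup>2 / 2) - d / 2" by (simp only:)
  also have "\<dots> = d * ((2 + d) * z\<^sup>2 - 1/2 + x\<^sup>2 / 2) + x\<^sup>2"
    by (simp add: algebra_simps add_divide_distrib)
  finally have p: "x powr (2 + d) = d * ((2 + d) * z\<^sup>2 - 1/2 + x\<^sup>2 / 2) + x\<^sup>2" .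
  have "x * force d x = (x powr (2 + d) - x\<^sup>2) / d"
    using x powr_mult_base[of x "1 + d"] by (simp add: force_def right_diff_distrib power2_eq_square add.assoc[symmetric])
  then have f: "x * force d x = (2 + d) * z\<^sup>2 - 1/2 + x\<^sup>2 / 2" using p d by simp
  have "z = force d x * (qf d z / sqrt 2)"
    using x(2) by (simp add: Z_def qf_eq x_def)
  then have "z * x = (force d x * (qf d z / sqrt 2)) * x" by (rule arg_cong[of _ _ "\<lambda>y. y * x"])
  also have "\<dots> = (x * force d x) * (qf d z / sqrt 2)" by (simp only: mult_ac)
  also have "\<dots> = ((2 + d) * z\<^sup>2 - 1/2 + x\<^sup>2 / 2) * qf d z / sqrt 2" by (simp only: f times_divide_eq_right)
  finally show ?thesis by (simp only: x_def)
qed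

text \<open>The integral of \<open>(U U')'\<close> over the half period vanishes; with the energy relation this expresses the mass through
  the half period and the action.\<close>

lemma orbit_mass_eq:
  "orbit_mass d A = (1 - (4 + 2 * d) * A\<^sup>2) * half_period d A + 2 * (4 + d) * A\<^sup>2 * cos_moment d A"
proof -
  let ?P = "\<lambda>t. Psi d (A * sin t)" and ?q = "\<lambda>t. qf d (A * sin t)"
  have "((\<lambda>t. - sin t * (A * ?P t) + A * (sqrt 2 * ?q t * (A * cos t)) * cos t) has_integral
      (cos (pi/2) * (A * ?P (pi/2)) - cos (- pi/2) * (A * ?P (- pi/2)))) {- pi/2..pi/2}"
  proof (rule fundamental_theorem_of_calculus)
    fix t :: real
    have "((\<lambda>t. cos t * (A * ?P t)) has_real_derivative
        - sin t * (A * ?P t) + A * (sqrt 2 * ?q t * (A * cos t)) * cos t) (at t)"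
      by (rule DERIV_mult[OF DERIV_cos DERIV_cmult[OF DERIV_chain2[OF Psi_has_derivative_qf[OF A_sin(1)] dsin]]])
    then show "((\<lambda>t. cos t * (A * ?P t)) has_vector_derivative
        - sin t * (A * ?P t) + A * (sqrt 2 * ?q t * (A * cos t)) * cos t) (at t within {- pi/2..pi/2})"
      by (simp add: has_real_derivative_iff_has_vector_derivative has_vector_derivative_at_within)
  qed simp
  then have 0: "((\<lambda>t. - sin t * (A * ?P t) + A * (sqrt 2 * ?q t * (A * cos t)) * cos t) has_integral 0) {- pi/2..pi/2}" by simp
  \<comment> \<open>The last summand is a multiple of the exact derivative above, so its integral vanishes.\<close>
  have eq: "(?P t)\<^sup>2 * ?q t = (1 - (4 + 2 * d) * A\<^sup>2) * ?q t + 2 * (4 + d) * A\<^sup>2 * ((cos t)\<^sup>2 * ?q t)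
      + (- (2 * sqrt 2)) * (- sin t * (A * ?P t) + A * (sqrt 2 * ?q t * (A * cos t)) * cos t)" for t
  proof -
    define P q where "P = ?P t" and "q = ?q t"
    define X where "X = - sin t * (A * P) + A * (sqrt 2 * q * (A * cos t)) * cos t"
    have f1: "(2 * sqrt 2) * (A * sin t * P) = 2 * (((2 + d) * (A * sin t)\<^sup>2 - 1/2 + P\<^sup>2 / 2) * q)"
      using Psi_force[OF A_sin(1), of t] by (simp add: P_def q_def)
    have s2: "(A * sin t)\<^sup>2 = A\<^sup>2 * (1 - (cos t)\<^sup>2)" by (simp add: power_mult_distrib sin_squared_eq)
    have f3: "(2 * sqrt 2) * (A * (sqrt 2 * q * (A * cos t)) * cos t) = 4 * A\<^sup>2 * (cos t)\<^sup>2 * q"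
    proof -
      have "(2 * sqrt 2) * (A * (sqrt 2 * q * (A * cos t)) * cos t) = 2 * (sqrt 2 * sqrt 2) * (A * A) * (cos t * cos t) * q" by (simp only: mult_ac)
      then show ?thesis by (simp add: power2_eq_square)
    qed
    have "(2 * sqrt 2) * X = (2 * sqrt 2) * (A * (sqrt 2 * q * (A * cos t)) * cos t) - (2 * sqrt 2) * (A * sin t * P)"
      by (simp add: X_def algebra_simps)
    then have "(2 * sqrt 2) * X = 4 * A\<^sup>2 * (cos t)\<^sup>2 * q - 2 * (((2 + d) * (A\<^sup>2 * (1 - (cos t)\<^sup>2)) - 1/2 + P\<^sup>2 / 2) * q)"
      unfolding f3 f1 s2 .
    moreover have "(- (2 * sqrt 2)) * X = - ((2 * sqrt 2) * X)" by simp
    ultimately have "(- (2 * sqrt 2)) * X = - (4 * A\<^sup>2 * (cos t)\<^sup>2 * q - 2 * (((2 + d) * (A\<^sup>2 * (1 - (cos t)\<^sup>2)) - 1/2 + P\<^sup>2 / 2) * q))"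
      by (simp only:)
    then show ?thesis
      unfolding P_def[symmetric] q_def[symmetric] X_def[symmetric] by (simp only:) (simp add: algebra_simps)
  qed
  have "((\<lambda>t. (?P t)\<^sup>2 * ?q t) has_integral
      (1 - (4 + 2 * d) * A\<^sup>2) * half_period d A + 2 * (4 + d) * A\<^sup>2 * cos_moment d A + (- (2 * sqrt 2)) * 0) {- pi/2..pi/2}"
    unfolding eq
    by (rule has_integral_add[OF has_integral_add[OF has_integral_mult_right[OF half_period_has_integral(1)]
          has_integral_mult_right[OF cos_moment_has_integral(1)]] has_integral_mult_right[OF 0]])
  then show ?thesis by (simp add: orbit_mass_def integral_unique)
qed

lemma energy_bound: "(4 + 2 * d) * A\<^sup>2 \<le> 1"
proof -
  have mA: "- A \<in> zrange d" "0 \<le> A" using A by (auto simp: admissible_def)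
  define b where "b = Psi d (- A)"
  have b: "0 < b" "Z d b = - A" using Psi_pos[OF mA(1)] Z_Psi[OF mA(1)] by (auto simp: b_def)
  have b1: "b \<le> 1" using Z_le_iff[of b 1] b mA(2) by (simp add: Z_1)
  have "b powr (2 + d) \<le> b powr 2" using b b1 d by (intro powr_mono') auto
  then have "b powr (2 + d) \<le> b\<^sup>2" using b by simp
  then have "b powr (2 + d) / (2 + d) \<le> b\<^sup>2 / 2" using d by (intro frac_le) auto
  then have "potential d b \<le> 1 / (2 * (2 + d))" using d by (simp add: potential_def divide_nonpos_pos)
  moreover have "A\<^sup>2 = potential d b" using Z_squared[OF b(1) d(1)] b(2) by simp
  ultimately have "A\<^sup>2 \<le> 1 / (4 + 2 * d)" by simp
  then show ?thesis using d by (simp add: le_divide_eq mult.commute)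
qed

lemma half_period_pos: "half_period d A > 0"
proof -
  have "half_period d A \<noteq> 0"
  proof
    assume "half_period d A = 0"
    then have "integral {- pi/2..pi/2} (\<lambda>t. qf d (A * sin t)) = 0"
      using half_period_has_integral(1) by (simp add: integral_unique)
    then have "\<forall>t\<in>{- pi/2..pi/2}. qf d (A * sin t) = 0"
      using integral_eq_0_iff[OF cont_qf_sin[of "{- pi/2..pi/2}"]] qf_pos[OF A_sin(1)] by (auto simp: less_imp_le)
    then have "qf d (A * sin 0) = 0" using pi_gt_zero by (intro bspec[of _ _ 0]) auto
    then show False using qf_pos[OF A_sin(1), of 0] by simp
  qed
  moreover have "0 \<le> half_period d A"
    by (rule has_integral_nonneg[OF half_period_has_integral(1)]) (use qf_pos[OF A_sin(1)] in \<open>simp add: less_imp_le\<close>)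
  ultimately show ?thesis by simp
qed

text \<open>Half of the orbit lies in \<open>U \<ge> 1\<close>, where \<open>qf \<ge> 1 / U\<close>.\<close>

lemma orbit_mass_ge: "pi / 2 \<le> orbit_mass d A"
proof -
  let ?f = "\<lambda>t. (Psi d (A * sin t))\<^sup>2 * qf d (A * sin t)"
  have c: "continuous_on S ?f" for S by (intro continuous_intros cont_Psi_sin cont_qf_sin)
  have i: "?f integrable_on S" if "S = {a..b}" for S a b unfolding that by (intro integrable_continuous_real c)
  have "pi / 2 = integral {0..pi/2} (\<lambda>t. 1 :: real)" by simp
  also have "\<dots> \<le> integral {0..pi/2} ?f"
  proof (rule integral_le)
    fix t :: real assume t: "t \<in> {0..pi/2}"
    define a where "a = Psi d (A * sin t)"
    have "0 \<le> A * sin t" using t A sin_ge_zero[of t] by (auto simp: admissible_def)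
    then have a: "1 \<le> a" using Psi_mono[OF Psi_0(1) A_sin(1)] Psi_0(2) by (simp add: a_def)
    have "a powr (-2) = (1 / a)\<^sup>2"
      using a powr_minus_divide[of a 2] powr_numeral[of a "Num.Bit0 Num.One"] by (simp add: power_divide)
    then have "sqrt (2 * (a powr (-2) / 2)) = \<bar>1 / a\<bar>" by (simp only: real_sqrt_abs nonzero_mult_div_cancel_left times_divide_eq_right zero_neq_numeral not_False_eq_True)
    then have "1 / a = sqrt (2 * (a powr (-2) / 2))" using a by (simp only: abs_of_nonneg zero_le_divide_1_iff)
    also have "\<dots> \<le> sqrt (2 * chicone d a)"
      using chicone_lower_bound[OF a d(1) d1] by simp
    also have "\<dots> = qf d (A * sin t)" by (simp add: qf_def a_def)
    finally have "a\<^sup>2 * (1 / a) \<le> a\<^sup>2 * qf d (A * sin t)" by (rule mult_left_mono) simp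
    moreover have "a\<^sup>2 * (1 / a) = a" using a by (simp add: power2_eq_square)
    ultimately show "1 \<le> ?f t" using a by (simp add: a_def)
  qed (auto intro!: i)
  also have "\<dots> \<le> integral {- pi/2..pi/2} ?f"
    using qf_pos[OF A_sin(1)] by (intro integral_subset_le i[OF refl]) (auto simp: less_imp_le)
  finally show ?thesis by (simp add: orbit_mass_def)
qed

lemma chicone'_gap_orbit:
  assumes z: "0 \<le> z" "z \<le> A"
  shows "2 / 3 * (sqrt 2 * z) * chicone d (Psi d (- z)) \<le> chicone' d (Psi d z) - chicone' d (Psi d (- z))"
proof -
  have zr: "z \<in> zrange d" "- z \<in> zrange d" using admissible_range[OF A] z by auto
  define a b where "a = Psi d z" and "b = Psi d (- z)"
  have ab: "0 < a" "0 < b" "Z d a = z" "Z d b = - z"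
    using Psi_pos[OF zr(1)] Psi_pos[OF zr(2)] Z_Psi[OF zr(1)] Z_Psi[OF zr(2)] by (auto simp: a_def b_def)
  have a1: "1 \<le> a" and b1: "b \<le> 1"
    using Z_le_iff[of 1 a] Z_le_iff[of b 1] ab z by (auto simp: Z_1)
  have "(sqrt 2 * z)\<^sup>2 \<le> (1 - b)\<^sup>2"
    using potential_le_left[OF ab(2) b1 d(1)] Z_squared[OF ab(2) d(1)] ab(4) by (simp add: power_mult_distrib)
  then have "sqrt 2 * z \<le> 1 - b" by (rule power2_le_imp_le) (use b1 in simp)
  also have "\<dots> \<le> 1 / b - 1"
  proof -
    have "(1 - b) * b \<le> (1 - b) * 1" using b1 by (intro mult_left_mono) auto
    then show ?thesis using ab(2) by (simp add: field_simps)
  qed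
  finally have "2 / 3 * (sqrt 2 * z) * chicone d b \<le> 2 / 3 * (1 / b - 1) * chicone d b"
    using chicone_pos[OF ab(2) d(1)] by (intro mult_right_mono mult_left_mono) auto
  also have "\<dots> \<le> chicone' d a - chicone' d b"
    by (rule chicone'_gap[OF ab(2) b1 a1 d(1) d1])
  finally show ?thesis by (simp add: a_def b_def)
qed

lemma has_integral_sin_squared_centred:
  "((\<lambda>t. (sin t)\<^sup>2 - 1/2) has_integral 0) {- pi/2..pi/2}"
proof -
  have "((\<lambda>t. (sin t)\<^sup>2 - 1/2) has_integral (- sin (pi/2) * cos (pi/2) / 2 - (- sin (- pi/2) * cos (- pi/2) / 2))) {- pi/2..pi/2}"
  proof (rule fundamental_theorem_of_calculus)
    fix t :: real
    have "((\<lambda>t. - sin t * cos t / 2) has_real_derivative ((sin t)\<^sup>2 - (cos t)\<^sup>2) / 2) (at t)"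
      by (auto intro!: derivative_eq_intros simp: power2_eq_square field_simps)
    moreover have "((sin t)\<^sup>2 - (cos t)\<^sup>2) / 2 = (sin t)\<^sup>2 - 1/2" by (simp add: cos_squared_eq)
    ultimately have "((\<lambda>t. - sin t * cos t / 2) has_real_derivative (sin t)\<^sup>2 - 1/2) (at t)" by simp
    then show "((\<lambda>t. - sin t * cos t / 2) has_vector_derivative (sin t)\<^sup>2 - 1/2) (at t within {- pi/2..pi/2})"
      by (simp add: has_real_derivative_iff_has_vector_derivative has_vector_derivative_at_within)
  qed simp
  then show ?thesis by simp
qed

text \<open>The derivative of the half period pairs the angles \<open>t\<close> and \<open>- t\<close>, so
  that the convexity gap applies; the bound by the square of the half period is then the Cauchy-Schwarz inequality, after the weight
  \<open>sin\<^sup>2\<close> has been replaced by its mean, which is possible because the remaining factor increases with \<open>\<bar>sin t\<bar>\<close>.\<close>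

lemma half_period'_ge: "A / (6 * pi) * (half_period d A)\<^sup>2 \<le> half_period' d A"
proof -
  let ?I = "{- pi/2..pi/2}"
  have A0: "0 \<le> A" using A by (simp add: admissible_def)
  define G where "G t = chicone d (Psi d (- A * \<bar>sin t\<bar>))" for t
  have cG: "continuous_on ?I G"
    unfolding G_def using A_sin(2) Psi_pos
    by (intro continuous_on_compose2[OF chicone_continuous[OF d(1)]] continuous_on_compose2[OF Psi_continuous] continuous_intros) auto
  define IG where "IG = integral ?I G"
  have iG: "(G has_integral IG) ?I" unfolding IG_def by (intro integrable_integral integrable_continuous_real cG)
  have Gpos: "0 \<le> G t" for t unfolding G_def using chicone_pos[OF Psi_pos[OF A_sin(2)] d(1)] by (simp add: less_imp_le)
  have csG: "continuous_on ?I (\<lambda>t. (sin t)\<^sup>2 * G t)" by (intro continuous_intros cG)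
  define IS where "IS = integral ?I (\<lambda>t. (sin t)\<^sup>2 * G t)"
  have iS: "((\<lambda>t. (sin t)\<^sup>2 * G t) has_integral IS) ?I" unfolding IS_def by (intro integrable_integral integrable_continuous_real csG)
  \<comment> \<open>Both angles \<open>t\<close> and \<open>- t\<close> are integrated, which gives twice the derivative.\<close>
  let ?F = "\<lambda>t. qf' d (A * sin t) * sin t"
  have iF: "(?F has_integral half_period' d A) ?I" by (rule half_period_has_integral(2))
  have "((\<lambda>t. ?F (- t)) has_integral half_period' d A) {- (pi/2)..- (- pi/2)}"
    using iF by (subst has_integral_reflect_real) auto
  then have iF': "((\<lambda>t. ?F (- t)) has_integral half_period' d A) ?I" by simp
  have pt: "4/3 * A * ((sin t)\<^sup>2 * G t) \<le> ?F t + ?F (- t)" for t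
  proof -
    define s where "s = \<bar>sin t\<bar>"
    have s: "0 \<le> s" "s \<le> 1" by (auto simp: s_def)
    then have As: "0 \<le> A * s" "A * s \<le> A" using A0 by (auto intro: mult_left_le)
    have 1: "?F t + ?F (- t) = sqrt 2 * s * (chicone' d (Psi d (A * s)) - chicone' d (Psi d (- (A * s))))"
    proof (cases "sin t \<ge> 0")
      case True
      then have "s = sin t" by (simp add: s_def)
      then show ?thesis by (simp add: qf'_def right_diff_distrib mult_ac)
    next
      case False
      then have "s = - sin t" by (simp add: s_def)
      then show ?thesis by (simp add: qf'_def right_diff_distrib mult_ac)
    qed
    have 2: "sqrt 2 * s * (2 / 3 * (sqrt 2 * (A * s)) * chicone d (Psi d (- (A * s))))
        \<le> sqrt 2 * s * (chicone' d (Psi d (A * s)) - chicone' d (Psi d (- (A * s))))"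
      using s by (intro mult_left_mono chicone'_gap_orbit[OF As]) auto
    have 3: "sqrt 2 * s * (2 / 3 * (sqrt 2 * (A * s)) * chicone d (Psi d (- (A * s)))) = 4/3 * A * ((sin t)\<^sup>2 * G t)"
    proof -
      have "sqrt 2 * s * (2 / 3 * (sqrt 2 * (A * s)) * chicone d (Psi d (- (A * s)))) = (sqrt 2 * sqrt 2) * (2/3) * A * ((s * s) * chicone d (Psi d (- (A * s))))"
        by (simp only: mult_ac)
      then show ?thesis by (simp add: G_def s_def power2_eq_square)
    qed
    show ?thesis using 1 2 unfolding 3 by (simp only:)
  qed
  have h1: "4/3 * A * IS \<le> half_period' d A + half_period' d A"
    by (rule has_integral_le[OF has_integral_mult_right[OF iS] has_integral_add[OF iF iF'] pt])
  have h2: "IG / 2 \<le> IS"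
  proof -
    \<comment> \<open>The value of \<open>G\<close> where \<open>sin\<^sup>2\<close> equals its mean \<open>1/2\<close>: subtracting it makes the product of the two differences nonnegative.\<close>
    define g where "g = chicone d (Psi d (- A * sqrt (1/2)))"
    have zr: "- A * sqrt (1/2) \<in> zrange d"
      using A0 real_sqrt_le_1_iff[of "1/2"] by (intro admissible_range[OF A]) (auto simp: abs_mult intro!: mult_left_le)
    have "((sin t)\<^sup>2 - 1/2) * g \<le> (sin t)\<^sup>2 * G t - 1/2 * G t" for t
    proof -
      have "0 \<le> ((sin t)\<^sup>2 - 1/2) * (G t - g)"
      proof (cases "(sin t)\<^sup>2 \<ge> 1/2")
        case True
        then have "sqrt (1/2) \<le> \<bar>sin t\<bar>" using real_sqrt_le_mono[of "1/2" "(sin t)\<^sup>2"] by simp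
        then have "- A * \<bar>sin t\<bar> \<le> - A * sqrt (1/2)" using A0 by (simp add: mult_left_mono)
        then have "g \<le> G t" unfolding g_def G_def
          using Psi_mono[OF A_sin(2) zr] Psi_pos[OF A_sin(2)] by (intro chicone_antimono d) auto
        then show ?thesis using True by simp
      next
        case False
        then have "\<bar>sin t\<bar> \<le> sqrt (1/2)" using real_sqrt_le_mono[of "(sin t)\<^sup>2" "1/2"] by simp
        then have "- A * sqrt (1/2) \<le> - A * \<bar>sin t\<bar>" using A0 by (simp add: mult_left_mono)
        then have "G t \<le> g" unfolding g_def G_def
          using Psi_mono[OF zr A_sin(2)] Psi_pos[OF zr] by (intro chicone_antimono d) auto
        then show ?thesis using False by (intro mult_nonpos_nonpos) auto
      qed
      then show ?thesis by (simp add: algebra_simps diff_divide_distrib)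
    qed
    from has_integral_le[OF has_integral_mult_left[OF has_integral_sin_squared_centred, of g]
        has_integral_diff[OF iS has_integral_mult_right[OF iG, of "1/2"]] this]
    show ?thesis by simp
  qed
  have h3: "(half_period d A)\<^sup>2 \<le> 2 * pi * IG"
  proof -
    \<comment> \<open>The mean of \<open>qf\<close>; the Cauchy-Schwarz inequality is the nonnegativity of the integral of \<open>(qf - m)\<^sup>2\<close>.\<close>
    define m where "m = half_period d A / pi"
    have i1: "((\<lambda>t. 2 * m * qf d (A * sin t) - m\<^sup>2) has_integral 2 * m * half_period d A - m\<^sup>2 * pi) ?I"
    proof -
      have "((\<lambda>t. m\<^sup>2) has_integral m\<^sup>2 * pi) ?I" using has_integral_const_real[of "m\<^sup>2" "- pi/2" "pi/2"] by (simp add: mult.commute)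
      then show ?thesis by (rule has_integral_diff[OF has_integral_mult_right[OF half_period_has_integral(1)]])
    qed
    have pq: "2 * m * qf d (A * sin t) - m\<^sup>2 \<le> 2 * G t" for t
    proof -
      have "2 * m * qf d (A * sin t) - m\<^sup>2 \<le> (qf d (A * sin t))\<^sup>2"
        using zero_le_power2[of "qf d (A * sin t) - m"] by (simp add: power2_eq_square algebra_simps)
      also have "\<dots> = 2 * chicone d (Psi d (A * sin t))"
        using chicone_pos[OF Psi_pos[OF A_sin(1)] d(1)] by (simp add: qf_def less_imp_le)
      also have "chicone d (Psi d (A * sin t)) \<le> G t"
      proof -
        have "- A * \<bar>sin t\<bar> \<le> A * sin t" using A0 abs_ge_minus_self[of "A * sin t"] by (simp add: abs_mult)
        then show ?thesis unfolding G_def using Psi_mono[OF A_sin(2) A_sin(1)] Psi_pos[OF A_sin(2)]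
          by (intro chicone_antimono d) auto
      qed
      finally show ?thesis by simp
    qed
    have "2 * m * half_period d A - m\<^sup>2 * pi \<le> 2 * IG"
      by (rule has_integral_le[OF i1 has_integral_mult_right[OF iG] pq])
    then show ?thesis by (simp add: m_def power2_eq_square field_simps)
  qed
  have "A / (6 * pi) * (half_period d A)\<^sup>2 \<le> A / (6 * pi) * (2 * pi * IG)"
    using h3 A0 by (intro mult_left_mono) auto
  also have "\<dots> = 2/3 * A * (IG / 2)" by simp
  also have "\<dots> \<le> 2/3 * A * IS" using h2 A0 by (intro mult_left_mono) auto
  also have "\<dots> \<le> half_period' d A" using h1 by simp
  finally show ?thesis .
qed

end

lemma half_period_has_derivative:
  assumes "admissible d B" "A \<in> {0..B}"
  shows "(half_period d has_real_derivative half_period' d A) (at A within {0..B})"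
  unfolding half_period_def half_period'_def by (intro wint_has_derivative assms continuous_intros)

text \<open>The relation \<open>J' = 2 A T\<close> eliminates the action. What may be negative carries the small factor \<open>d\<close>, because the coefficient of the derivative of the half period is
  nonnegative by the energy bound.\<close>

lemma orbit_mass_has_derivative:
  assumes B: "admissible d B" and A: "A \<in> {0..B}"
  shows "(orbit_mass d has_real_derivative
    (1 - (4 + 2 * d) * A\<^sup>2) * half_period' d A - 2 * d * A * half_period d A) (at A within {0..B})"
proof -
  have adm: "admissible d A" by (rule admissible_mono[OF B A])
  have dK: "(cos_moment d has_real_derivative cos_moment' d A) (at A within {0..B})"
    unfolding cos_moment_def cos_moment'_def by (intro wint_has_derivative B A continuous_intros)
  have sq: "((\<lambda>A. A\<^sup>2) has_real_derivative 2 * A) (at A within {0..B})"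
    using DERIV_power[OF DERIV_ident, where n = 2 and x = A and s = "{0..B}"] by simp
  have d1: "((\<lambda>A. 1 - (4 + 2 * d) * A\<^sup>2) has_real_derivative - (4 + 2 * d) * (2 * A)) (at A within {0..B})"
    using DERIV_diff[OF DERIV_const[where k = 1] DERIV_cmult[OF sq, of "4 + 2 * d"]] by (simp only: minus_mult_left diff_0)
  have d2: "((\<lambda>A. 2 * (4 + d) * A\<^sup>2) has_real_derivative 2 * (4 + d) * (2 * A)) (at A within {0..B})"
    by (rule DERIV_cmult[OF sq])
  have "((\<lambda>A. (1 - (4 + 2 * d) * A\<^sup>2) * half_period d A + 2 * (4 + d) * A\<^sup>2 * cos_moment d A) has_real_derivative
      (- (4 + 2 * d) * (2 * A) * half_period d A + half_period' d A * (1 - (4 + 2 * d) * A\<^sup>2))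
      + (2 * (4 + d) * (2 * A) * cos_moment d A + cos_moment' d A * (2 * (4 + d) * A\<^sup>2))) (at A within {0..B})"
    by (intro DERIV_add DERIV_mult d1 d2 dK half_period_has_derivative B A)
  moreover have "(- (4 + 2 * d) * (2 * A) * half_period d A + half_period' d A * (1 - (4 + 2 * d) * A\<^sup>2))
      + (2 * (4 + d) * (2 * A) * cos_moment d A + cos_moment' d A * (2 * (4 + d) * A\<^sup>2))
      = (1 - (4 + 2 * d) * A\<^sup>2) * half_period' d A - 2 * d * A * half_period d A"
  proof -
    have "A * cos_moment' d A = half_period d A - 2 * cos_moment d A" using action_identity[OF adm] by linarith
    moreover have "cos_moment' d A * (2 * (4 + d) * A\<^sup>2) = 2 * (4 + d) * A * (A * cos_moment' d A)"
      by (simp add: power2_eq_square)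
    ultimately have "cos_moment' d A * (2 * (4 + d) * A\<^sup>2) = 2 * (4 + d) * A * (half_period d A - 2 * cos_moment d A)" by simp
    then show ?thesis by (simp add: algebra_simps)
  qed
  ultimately have "((\<lambda>A. (1 - (4 + 2 * d) * A\<^sup>2) * half_period d A + 2 * (4 + d) * A\<^sup>2 * cos_moment d A) has_real_derivative
      (1 - (4 + 2 * d) * A\<^sup>2) * half_period' d A - 2 * d * A * half_period d A) (at A within {0..B})" by (simp only:)
  then show ?thesis
    by (rule has_field_derivative_transform_within[OF _ zero_less_one A]) (use orbit_mass_eq[OF admissible_mono[OF B]] in simp)
qed

text \<open>With \<open>T' \<ge> x T\<^sup>2 / (6 pi)\<close>, \<open>M \<ge> pi / 2\<close> and \<open>M' \<ge> - 2 d x T\<close> the derivative is at least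
  \<open>((4 / d - 1) / 6 - 4 d) x T / pi\<close>.\<close>

lemma log_mass_strict_mono:
  assumes B: "admissible d B" and A: "0 \<le> A1" "A1 < B"
  shows "log_mass d A1 < log_mass d B"
proof -
  have der: "(log_mass d has_real_derivative (4 / d - 1) * (1 / half_period d A * half_period' d A)
      + 1 / orbit_mass d A * ((1 - (4 + 2 * d) * A\<^sup>2) * half_period' d A - 2 * d * A * half_period d A)) (at A within {0..B})"
    if A: "A \<in> {0..B}" for A
  proof -
    have adm: "admissible d A" by (rule admissible_mono[OF B A])
    have p: "half_period d A > 0" "orbit_mass d A > 0"
      using half_period_pos[OF adm] orbit_mass_ge[OF adm] pi_gt_zero by linarith+
    show ?thesis
      unfolding log_mass_def[abs_def]
      by (intro DERIV_add DERIV_cmult DERIV_chain2[OF DERIV_ln_divide] half_period_has_derivative orbit_mass_has_derivative B A p)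
  qed
  show ?thesis
  proof (rule DERIV_pos_imp_increasing_open[OF A(2)])
    fix x assume x: "A1 < x" "x < B"
    then have xB: "x \<in> {0..B}" "x > 0" using A by auto
    have adm: "admissible d x" by (rule admissible_mono[OF B xB(1)])
    define T M T' where "T = half_period d x" and "M = orbit_mass d x" and "T' = half_period' d x"
    have T: "T > 0" and M: "M \<ge> pi / 2" and T': "x / (6 * pi) * T\<^sup>2 \<le> T'" and E: "(4 + 2 * d) * x\<^sup>2 \<le> 1"
      using half_period_pos[OF adm] orbit_mass_ge[OF adm] half_period'_ge[OF adm] energy_bound[OF adm]
      by (auto simp: T_def M_def T'_def)
    have M0: "M > 0" using M pi_gt_zero by linarith
    have T'0: "0 \<le> T'" using T' xB T by (intro order_trans[OF _ T']) auto
    have k: "4 / d - 1 > 0" using d by (simp add: field_simps)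
    have "(4 / d - 1) * (x / (6 * pi) * T) \<le> (4 / d - 1) * (1 / T * T')"
    proof -
      have "1 / T * (x / (6 * pi) * T\<^sup>2) \<le> 1 / T * T'" using T' T by (intro mult_left_mono) auto
      moreover have "1 / T * (x / (6 * pi) * T\<^sup>2) = x / (6 * pi) * T" using T by (simp add: power2_eq_square)
      ultimately show ?thesis using k by (intro mult_left_mono) auto
    qed
    moreover have "- (4 * d * x * T / pi) \<le> 1 / M * ((1 - (4 + 2 * d) * x\<^sup>2) * T' - 2 * d * x * T)"
    proof -
      have "1 / M * (2 * d * x * T) \<le> 1 / (pi / 2) * (2 * d * x * T)"
        by (intro mult_right_mono divide_left_mono M mult_pos_pos mult_nonneg_nonneg M0) (use d xB T pi_gt_zero in auto)
      moreover have "0 \<le> 1 / M * ((1 - (4 + 2 * d) * x\<^sup>2) * T')" using M0 E T'0 by simp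
      ultimately show ?thesis by (simp add: right_diff_distrib)
    qed
    moreover have "0 < (4 / d - 1) * (x / (6 * pi) * T) - 4 * d * x * T / pi"
    proof -
      have "4 / d \<ge> 16" using d by (simp add: field_simps)
      then have "(4 / d - 1) / 6 - 4 * d > 0" using d by simp
      then have "0 < ((4 / d - 1) / 6 - 4 * d) * (x * T / pi)" using xB T by simp
      also have "\<dots> = (4 / d - 1) * (x / (6 * pi) * T) - 4 * d * x * T / pi"
      proof -
        have "(k / 6 - 4 * d) * (x * T / pi) = k * (x / (6 * pi) * T) - 4 * d * x * T / pi" for k
          by (simp add: left_diff_distrib diff_divide_distrib)
        then show ?thesis .
      qed
      finally show ?thesis .
    qed
    ultimately have "0 < (4 / d - 1) * (1 / T * T') + 1 / M * ((1 - (4 + 2 * d) * x\<^sup>2) * T' - 2 * d * x * T)" by linarith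
    moreover have "at x within {0..B} = at x" using x A by (intro at_within_Icc_at) auto
    ultimately show "\<exists>y. (log_mass d has_real_derivative y) (at x) \<and> 0 < y"
      using der[OF xB(1)] by (auto simp: T_def M_def T'_def)
  next
    have "continuous_on {0..B} (log_mass d)"
      by (rule DERIV_continuous_on) (use der in blast)
    then show "continuous_on {A1..B} (log_mass d)" by (rule continuous_on_subset) (use A in auto)
  qed
qed

lemma log_mass_0: "log_mass d 0 = 4 / d * ln pi"
proof -
  have q: "qf d 0 = 1" by (simp add: qf_def Psi_0 chicone_1)
  have "half_period d 0 = pi" by (simp add: half_period_def wint_def q)
  moreover have "orbit_mass d 0 = pi" by (simp add: orbit_mass_def q Psi_0)
  ultimately show ?thesis by (simp add: log_mass_def algebra_simps)
qed

end

section \<open>Decreasing solutions as orbits\<close>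

text \<open>Between the two zeros of \<open>R'\<close> the right-hand side of the equation vanishes somewhere.\<close>

lemma neumann_multiplier_pos:
  assumes sol: "positive_sol lam p R R'"
  shows "lam > 0"
proof -
  note s = positive_solD[OF sol]
  have "\<exists>z. 0 < z \<and> z < 1 \<and> (\<lambda>h. h * (lam * R z - R z powr (p - 1))) = (\<lambda>v. 0)"
  proof (rule Rolle_deriv[OF zero_less_one])
    show "R' 0 = R' 1" using s(3,4) by simp
    show "(R' has_derivative (\<lambda>h. h * (lam * R x - R x powr (p - 1)))) (at x)" if "0 < x" "x < 1" for x
      using s(7)[of x] that by (simp add: has_field_derivative_def mult.commute[of _ "lam * R x - R x powr (p - 1)"])
  qed (use s(2) in auto)
  then obtain z where z: "0 < z" "z < 1" and eq: "(\<lambda>h. h * (lam * R z - R z powr (p - 1))) = (\<lambda>v. 0)" by blast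
  have "1 * (lam * R z - R z powr (p - 1)) = 0" by (rule fun_cong[OF eq])
  then have "lam * R z = R z powr (p - 1)" by simp
  moreover have "R z > 0" "R z powr (p - 1) > 0" using s(5)[of z] z by auto
  ultimately show ?thesis using zero_less_mult_pos2[of lam "R z"] by simp
qed

context near_linear
begin

context
  fixes U U' :: "real \<Rightarrow> real" and l :: real
  assumes l: "l > 0"
    and cU: "continuous_on {0..1} U" and cU': "continuous_on {0..1} U'"
    and bd: "U' 0 = 0" "U' 1 = 0"
    and Upos: "\<And>x. x \<in> {0..1} \<Longrightarrow> U x > 0"
    and dU: "\<And>x. x \<in> {0<..<1} \<Longrightarrow> (U has_real_derivative U' x) (at x)"
    and dU': "\<And>x. x \<in> {0<..<1} \<Longrightarrow> (U' has_real_derivative - (l\<^sup>2 * force d (U x))) (at x)"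
    and dec: "\<And>x. x \<in> {0<..<1} \<Longrightarrow> U' x < 0"
begin

lemma U_less: "0 \<le> x \<Longrightarrow> x < y \<Longrightarrow> y \<le> 1 \<Longrightarrow> U y < U x"
proof -
  assume x: "0 \<le> x" "x < y" "y \<le> 1"
  show ?thesis
  proof (rule DERIV_neg_imp_decreasing_open[OF x(2)])
    show "\<exists>l. (U has_real_derivative l) (at z) \<and> l < 0" if "x < z" "z < y" for z
      using dU[of z] dec[of z] that x by auto
    show "continuous_on {x..y} U" by (rule continuous_on_subset[OF cU]) (use x in auto)
  qed
qed

lemma first_integral:
  assumes x: "x \<in> {0..1}"
  shows "(U' x)\<^sup>2 = 2 * l\<^sup>2 * ((Z d (U 0))\<^sup>2 - (Z d (U x))\<^sup>2)"
proof -
  define E where "E x = (U' x)\<^sup>2 + 2 * l\<^sup>2 * potential d (U x)" for x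
  have "E x = E 0"
  proof (rule DERIV_isconst2[OF zero_less_one])
    have "continuous_on {0<..} (potential d)"
      by (intro continuous_at_imp_continuous_on ballI DERIV_isCont[OF potential_has_derivative[OF _ d(1)]]) auto
    then have "continuous_on {0..1} (\<lambda>x. potential d (U x))"
      by (rule continuous_on_compose2[OF _ cU]) (use Upos in auto)
    then show "continuous_on {0..1} E" unfolding E_def by (intro continuous_intros cU')
    show "(E has_real_derivative 0) (at y)" if "0 < y" "y < 1" for y
    proof -
      have y: "y \<in> {0<..<1}" "U y > 0" using that Upos by auto
      have "(E has_real_derivative 2 * U' y * (- (l\<^sup>2 * force d (U y))) + 2 * l\<^sup>2 * (force d (U y) * U' y)) (at y)"
        unfolding E_def[abs_def]
        using DERIV_add[OF DERIV_power[OF dU'[OF y(1)], of 2]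
            DERIV_cmult[OF DERIV_chain2[OF potential_has_derivative[OF y(2) d(1)] dU[OF y(1)]], of "2 * l\<^sup>2"]]
        by (simp add: mult_ac)
      then show ?thesis by (simp add: mult_ac)
    qed
  qed (use x in auto)
  moreover have "potential d (U x) = (Z d (U x))\<^sup>2" "potential d (U 0) = (Z d (U 0))\<^sup>2"
    using Z_squared[OF Upos d(1)] x by simp_all
  ultimately show ?thesis using bd by (simp add: E_def algebra_simps)
qed

lemma orbit_amplitude: "Z d (U 1) = - Z d (U 0)" "Z d (U 0) > 0" "admissible d (Z d (U 0))"
proof -
  have lt: "Z d (U 1) < Z d (U 0)" using Upos by (intro Z_less U_less) auto
  have "(Z d (U 1))\<^sup>2 = (Z d (U 0))\<^sup>2" using first_integral[of 1] bd l by simp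
  then show 1: "Z d (U 1) = - Z d (U 0)" using lt by (auto simp: power2_eq_iff)
  then show 2: "Z d (U 0) > 0" using lt by simp
  show "admissible d (Z d (U 0))"
    unfolding admissible_def using 2 Z_in_zrange[of "U 0"] Z_in_zrange[of "U 1"] Upos 1 by auto
qed

text \<open>The angle \<open>\<theta>\<close> with \<open>Z (U x) = A sin \<theta>\<close> runs from \<open>pi / 2\<close> down to \<open>- pi / 2\<close>, with derivative \<open>- l / qf\<close> by the first integral. The statement is this change of
  variables, for an arbitrary function of the position.\<close>

lemma angular_integral:
  assumes w: "continuous_on (zrange d) w"
  shows "integral {- pi/2..pi/2} (\<lambda>t. w (Z d (U 0) * sin t) * qf d (Z d (U 0) * sin t)) = l * integral {0..1} (\<lambda>x. w (Z d (U x)))"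
proof -
  define A where "A = Z d (U 0)"
  define z where "z x = Z d (U x)" for x
  define \<theta> where "\<theta> x = arcsin (z x / A)" for x
  have A: "A > 0" "admissible d A" using orbit_amplitude by (simp_all add: A_def)
  have z01: "z 0 = A" "z 1 = - A" using orbit_amplitude by (simp_all add: A_def z_def)
  have zin: "- A < z x" "z x < A" if "x \<in> {0<..<1}" for x
    using Z_less[OF Upos U_less, of 1 x] Z_less[OF Upos U_less, of x 0] that z01 by (auto simp: z_def)
  have zle: "\<bar>z x\<bar> \<le> A" if "x \<in> {0..1}" for x
    using zin[of x] z01 A that by (cases "x = 0 \<or> x = 1") auto
  have zb: "- A \<le> z x" "z x \<le> A" if "x \<in> {0..1}" for x using zle[OF that] by auto
  have zr: "z x \<in> zrange d" if "x \<in> {0..1}" for x using Z_in_zrange Upos that by (simp add: z_def)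
  have PsiZ: "Psi d (z x) = U x" if "x \<in> {0..1}" for x using Psi_Z Upos that by (simp add: z_def)
  have cz: "continuous_on {0..1} z"
  proof -
    have "continuous_on {0<..} (Z d)"
      by (intro continuous_at_imp_continuous_on ballI DERIV_isCont[OF Z_has_derivative[OF _ d(1)]]) auto
    then show ?thesis unfolding z_def by (rule continuous_on_compose2[OF _ cU]) (use Upos in auto)
  qed
  have ct: "continuous_on {0..1} \<theta>"
    unfolding \<theta>_def using zb A by (intro continuous_intros cz) (auto simp: field_simps)
  have \<theta>sin: "A * sin (\<theta> x) = z x" if "x \<in> {0..1}" for x
    using zb[OF that] A by (simp add: \<theta>_def field_simps sin_arcsin)
  have \<theta>r: "\<theta> x \<in> {- pi/2..pi/2}" if "x \<in> {0..1}" for x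
    using zb[OF that] A arcsin_bounded[of "z x / A"] by (auto simp: \<theta>_def field_simps)
  have \<theta>i: "\<theta> x \<in> {- pi/2<..<pi/2}" if "x \<in> {0<..<1}" for x
    using zin[OF that] A arcsin_lt_bounded[of "z x / A"] by (auto simp: \<theta>_def field_simps)
  have d\<theta>: "(\<theta> has_real_derivative - l / qf d (z x)) (at x)" if x: "x \<in> {0<..<1}" for x
  proof -
    have Ux: "U x > 0" using Upos x by auto
    define C S where "C = sqrt (chicone d (U x))" and "S = sqrt (A\<^sup>2 - (z x)\<^sup>2)"
    have C: "C > 0" using chicone_pos[OF Ux d(1)] by (simp add: C_def)
    have "\<bar>z x\<bar> < A" using zin[OF x] by auto
    then have zA: "(z x)\<^sup>2 < A\<^sup>2" using power_strict_mono[of "\<bar>z x\<bar>" A 2] by simp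
    have S: "S > 0" using zA by (simp add: S_def)
    have U': "U' x = - (sqrt 2 * l * S)"
    proof -
      have "(- U' x)\<^sup>2 = 2 * l\<^sup>2 * (A\<^sup>2 - (z x)\<^sup>2)" using first_integral[of x] x by (simp add: A_def z_def)
      then have "sqrt ((- U' x)\<^sup>2) = sqrt 2 * l * S" using l by (simp only: real_sqrt_mult real_sqrt_abs S_def abs_of_pos)
      then show ?thesis using dec[OF x] by simp
    qed
    have "(z has_real_derivative 1 / (2 * C) * U' x) (at x)"
      unfolding z_def[abs_def] C_def by (rule DERIV_chain2[OF Z_has_derivative[OF Ux d(1)] dU[OF x]])
    from DERIV_cdivide[OF this, of A]
    have "((\<lambda>x. z x / A) has_real_derivative 1 / (2 * C) * U' x / A) (at x)" .
    moreover have "- 1 < z x / A" "z x / A < 1" using zin[OF x] A by (auto simp: field_simps)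
    ultimately have "(\<theta> has_real_derivative inverse (sqrt (1 - (z x / A)\<^sup>2)) * (1 / (2 * C) * U' x / A)) (at x)"
      unfolding \<theta>_def[abs_def] by (intro DERIV_chain2[OF DERIV_arcsin])
    moreover have "sqrt (1 - (z x / A)\<^sup>2) = S / A"
    proof -
      have "1 - (z x / A)\<^sup>2 = (A\<^sup>2 - (z x)\<^sup>2) / A\<^sup>2" using A by (simp add: power_divide diff_divide_distrib)
      then show ?thesis using A by (simp add: real_sqrt_divide S_def)
    qed
    moreover have "inverse (S / A) * (1 / (2 * C) * U' x / A) = - l / qf d (z x)"
    proof -
      have "qf d (z x) = sqrt 2 * C" using x PsiZ[of x] by (simp add: qf_eq C_def)
      moreover have "2 = sqrt 2 * sqrt (2 :: real)" by simp
      then have "1 / (2 * C) * (sqrt 2 * l * S) = l * S / (sqrt 2 * C)" using C by (simp add: field_simps)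
      ultimately show ?thesis unfolding U' using A S by (simp add: field_simps)
    qed
    ultimately show ?thesis by (simp only:)
  qed
  define g where "g t = w (A * sin t) * qf d (A * sin t)" for t
  have cg: "continuous_on {- pi/2..pi/2} g"
    unfolding g_def
    by (intro continuous_intros cont_qf_sin[OF A(2)] continuous_on_compose2[OF w]) (use A_sin(1)[OF A(2)] in auto)
  define H where "H t = integral {- pi/2..t} g" for t
  have dH: "(H has_real_derivative g t) (at t)" if t: "t \<in> {- pi/2<..<pi/2}" for t
  proof -
    have "(H has_vector_derivative g t) (at t within {- pi/2..pi/2})"
      unfolding H_def[abs_def] by (rule integral_has_vector_derivative[OF cg]) (use t in auto)
    then show ?thesis using t
      by (simp add: has_real_derivative_iff_has_vector_derivative at_within_Icc_at)
  qed
  have cH: "continuous_on {- pi/2..pi/2} H"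
    unfolding H_def by (rule indefinite_integral_continuous_1) (rule integrable_continuous_real[OF cg])
  have "((\<lambda>x. - l * w (z x)) has_integral (H (\<theta> 1) - H (\<theta> 0))) {0..1}"
  proof (rule fundamental_theorem_of_calculus_interior)
    show "continuous_on {0..1} (\<lambda>x. H (\<theta> x))"
      by (rule continuous_on_compose2[OF cH ct]) (use \<theta>r in auto)
    fix x :: real assume x: "x \<in> {0<..<1}"
    have q: "qf d (z x) > 0" using qf_pos zr x by auto
    have "((\<lambda>x. H (\<theta> x)) has_real_derivative g (\<theta> x) * (- l / qf d (z x))) (at x)"
      by (rule DERIV_chain2[OF dH[OF \<theta>i[OF x]] d\<theta>[OF x]])
    moreover have "g (\<theta> x) * (- l / qf d (z x)) = - l * w (z x)"
      using \<theta>sin[of x] x q by (simp add: g_def)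
    ultimately show "((\<lambda>x. H (\<theta> x)) has_vector_derivative - l * w (z x)) (at x)"
      by (simp add: has_real_derivative_iff_has_vector_derivative)
  qed simp
  moreover have "\<theta> 0 = pi/2" "\<theta> 1 = - pi/2" using z01 A by (simp_all add: \<theta>_def arcsin_minus)
  moreover have "H (- pi/2) = 0" by (simp add: H_def)
  ultimately have "((\<lambda>x. - l * w (z x)) has_integral - H (pi/2)) {0..1}" by simp
  from has_integral_neg[OF this] have "((\<lambda>x. l * w (z x)) has_integral H (pi/2)) {0..1}" by simp
  from integral_unique[OF this] have "l * integral {0..1} (\<lambda>x. w (z x)) = H (pi/2)" by simp
  then show ?thesis by (simp only: H_def g_def[abs_def] A_def z_def)
qed

lemma half_period_orbit: "half_period d (Z d (U 0)) = l"
  using angular_integral[of "\<lambda>_. 1"] by (simp add: half_period_def wint_def)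

lemma orbit_mass_orbit: "orbit_mass d (Z d (U 0)) = l * integral {0..1} (\<lambda>x. (U x)\<^sup>2)"
proof -
  have "integral {0..1} (\<lambda>x. (Psi d (Z d (U x)))\<^sup>2) = integral {0..1} (\<lambda>x. (U x)\<^sup>2)"
    using Psi_Z[OF Upos] by (intro integral_cong) auto
  then show ?thesis
    using angular_integral[of "\<lambda>z. (Psi d z)\<^sup>2"] Psi_continuous
    by (simp add: orbit_mass_def continuous_on_power)
qed

end

text \<open>The amplitude of the orbit determines the multiplier, the initial value and the mass.\<close>

lemma decreasing_solution_orbit:
  assumes sol: "positive_sol lam (2 + d) R R'" and dec: "\<And>x. x \<in> {0<..<1} \<Longrightarrow> R' x < 0"
  obtains A where "A > 0" "admissible d A" "lam = (half_period d A)\<^sup>2 / d" "R 0 = lam powr (1 / d) * Psi d A"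
    "ln (integral {0..1} (\<lambda>x. (R x)\<^sup>2)) = log_mass d A - 2 / d * ln d"
proof -
  note s = positive_solD[OF sol]
  have lam: "lam > 0" by (rule neumann_multiplier_pos[OF sol])
  define k l where "k = lam powr (1 / d)" and "l = sqrt (lam * d)"
  have k: "k > 0" "k powr d = lam" using lam d by (simp_all add: k_def powr_powr)
  have l: "l > 0" "l\<^sup>2 = lam * d" using lam d by (simp_all add: l_def)
  define U U' where "U x = R x / k" and "U' x = R' x / k" for x
  have cU: "continuous_on {0..1} U" "continuous_on {0..1} U'"
    unfolding U_def U'_def using k by (intro continuous_intros s; simp)+
  have Upos: "U x > 0" if "x \<in> {0..1}" for x using s(5)[OF that] k by (simp add: U_def)
  have dU: "(U has_real_derivative U' x) (at x)" if "x \<in> {0<..<1}" for x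
    unfolding U_def[abs_def] U'_def by (rule DERIV_cdivide[OF s(6)[OF that]])
  have dU': "(U' has_real_derivative - (l\<^sup>2 * force d (U x))) (at x)" if x: "x \<in> {0<..<1}" for x
  proof -
    have Ux: "U x > 0" using Upos x by auto
    have "R x powr (2 + d - 1) = k * lam * U x powr (1 + d)"
    proof -
      have "R x = k * U x" using k by (simp add: U_def)
      then have "R x powr (1 + d) = k powr (1 + d) * U x powr (1 + d)" using k Ux by (simp add: powr_mult)
      moreover have "k powr (1 + d) = k * lam" using k powr_mult_base[of k d] by simp
      moreover have "2 + d - 1 = 1 + d" by simp
      ultimately show ?thesis by (simp only:)
    qed
    moreover have "R x = k * U x" using k by (simp add: U_def)
    ultimately have "(lam * R x - R x powr (2 + d - 1)) / k = lam * (U x - U x powr (1 + d))"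
      using k by (simp add: field_simps)
    also have "\<dots> = - (l\<^sup>2 * force d (U x))"
      using d by (simp add: l(2) force_def right_diff_distrib diff_divide_distrib)
    finally have "(lam * R x - R x powr (2 + d - 1)) / k = - (l\<^sup>2 * force d (U x))" .
    moreover have "(U' has_real_derivative (lam * R x - R x powr (2 + d - 1)) / k) (at x)"
      unfolding U'_def[abs_def] by (rule DERIV_cdivide[OF s(7)[OF x]])
    ultimately show ?thesis by (simp only:)
  qed
  have bd: "U' 0 = 0" "U' 1 = 0" using s(3,4) by (simp_all add: U'_def)
  have decU: "U' x < 0" if "x \<in> {0<..<1}" for x using dec[OF that] k by (simp add: U'_def divide_neg_pos)
  note orbit = l(1) cU bd Upos dU dU' decU
  define A where "A = Z d (U 0)"
  have A: "A > 0" "admissible d A" using orbit_amplitude(2,3)[OF orbit] by (simp_all add: A_def)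
  have hp: "half_period d A = l" using half_period_orbit[OF orbit] by (simp add: A_def)
  have om: "orbit_mass d A = l * integral {0..1} (\<lambda>x. (U x)\<^sup>2)" using orbit_mass_orbit[OF orbit] by (simp add: A_def)
  have M: "orbit_mass d A > 0" using orbit_mass_ge[OF A(2)] pi_gt_zero by linarith
  show ?thesis
  proof (rule that[OF A])
    show "lam = (half_period d A)\<^sup>2 / d" using d by (simp add: hp l(2))
    have "Psi d A = U 0" using Psi_Z[OF Upos[of 0]] by (simp add: A_def)
    then show "R 0 = lam powr (1 / d) * Psi d A" using k(1) by (simp add: U_def k_def)
    have "integral {0..1} (\<lambda>x. (R x)\<^sup>2) = integral {0..1} (\<lambda>x. k\<^sup>2 * (U x)\<^sup>2)"
      using k(1) by (simp add: U_def power_divide)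
    also have "\<dots> = k\<^sup>2 * (orbit_mass d A / l)" using om l(1) by simp
    finally have "ln (integral {0..1} (\<lambda>x. (R x)\<^sup>2)) = ln (k\<^sup>2 * (orbit_mass d A / l))" by simp
    also have "\<dots> = 2 * ln k + (ln (orbit_mass d A) - ln l)"
      using k(1) M l(1) by (simp add: ln_mult ln_div ln_realpow)
    also have "2 * ln k = 2 / d * ln lam" using lam by (simp add: k_def ln_powr)
    also have "ln lam = 2 * ln l - ln d"
    proof -
      have "2 * ln l = ln (l\<^sup>2)" using l(1) by (simp add: ln_realpow)
      also have "\<dots> = ln lam + ln d" using lam d by (simp add: l(2) ln_mult)
      finally show ?thesis by simp
    qed
    finally show "ln (integral {0..1} (\<lambda>x. (R x)\<^sup>2)) = log_mass d A - 2 / d * ln d"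
      by (simp add: log_mass_def hp algebra_simps)
  qed
qed

lemma decreasing_solution_unique:
  assumes solR: "positive_sol lam (2 + d) R R'" and decR: "\<And>x. x \<in> {0<..<1} \<Longrightarrow> R' x < 0"
    and solS: "positive_sol lam' (2 + d) S S'" and decS: "\<And>x. x \<in> {0<..<1} \<Longrightarrow> S' x < 0"
    and mass: "integral {0..1} (\<lambda>x. (R x)\<^sup>2) = integral {0..1} (\<lambda>x. (S x)\<^sup>2)"
    and x: "x \<in> {0..1}"
  shows "R x = S x"
proof -
  obtain A where A: "A > 0" "admissible d A" "lam = (half_period d A)\<^sup>2 / d" "R 0 = lam powr (1 / d) * Psi d A"
    "ln (integral {0..1} (\<lambda>x. (R x)\<^sup>2)) = log_mass d A - 2 / d * ln d"
    using decreasing_solution_orbit[OF solR decR] by blast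
  obtain B where B: "B > 0" "admissible d B" "lam' = (half_period d B)\<^sup>2 / d" "S 0 = lam' powr (1 / d) * Psi d B"
    "ln (integral {0..1} (\<lambda>x. (S x)\<^sup>2)) = log_mass d B - 2 / d * ln d"
    using decreasing_solution_orbit[OF solS decS] by blast
  have "log_mass d A = log_mass d B" using A(5) B(5) mass by simp
  then have AB: "A = B"
    using log_mass_strict_mono[OF B(2), of A] log_mass_strict_mono[OF A(2), of B] A(1) B(1)
    by (cases A B rule: linorder_cases) auto
  then have lam: "lam = lam'" using A(3) B(3) by simp
  have R0: "R 0 = S 0" using A(4) B(4) AB lam by simp
  note r = positive_solD[OF solR] and s = positive_solD[OF solS[folded lam]]
  have p: "2 + d > 2" using d by simp
  show ?thesis
    using positive_ode_unique[OF r(1,2) s(1,2) r(5) s(5) r(6,7) s(6,7), of 0 x] R0 r(3) s(3) p x by simp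
qed

text \<open>The mass exceeds the limit of the mass for vanishing amplitude, at which the decreasing solutions bifurcate from the constants.\<close>

lemma decreasing_solution_mass:
  assumes sol: "positive_sol lam (2 + d) R R'" and dec: "\<And>x. x \<in> {0<..<1} \<Longrightarrow> R' x < 0"
    and mass: "integral {0..1} (\<lambda>x. (R x)\<^sup>2) = \<mu>" and \<mu>: "\<mu> > 0"
  shows "pi\<^sup>2 < d * \<mu> powr (d / 2)"
proof -
  obtain A where A: "A > 0" "admissible d A" 
    "ln (integral {0..1} (\<lambda>x. (R x)\<^sup>2)) = log_mass d A - 2 / d * ln d"
    using decreasing_solution_orbit[OF sol dec] by blast
  have "4 / d * ln pi - 2 / d * ln d < ln \<mu>"
    using log_mass_strict_mono[OF A(2), of 0] A(1,3) mass by (simp add: log_mass_0)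
  then have "d / 2 * (4 / d * ln pi - 2 / d * ln d) < d / 2 * ln \<mu>" using d by (intro mult_strict_left_mono) auto
  moreover have "d / 2 * (4 / d * ln pi - 2 / d * ln d) = 2 * ln pi - ln d" using d by (simp add: right_diff_distrib)
  moreover have "ln (pi\<^sup>2) = 2 * ln pi" by (simp add: ln_realpow)
  moreover have "ln (d * \<mu> powr (d / 2)) = ln d + d / 2 * ln \<mu>" using d \<mu> by (simp add: ln_mult ln_powr)
  ultimately have "ln (pi\<^sup>2) < ln (d * \<mu> powr (d / 2))" by linarith
  then show ?thesis using d \<mu> by (subst (asm) ln_less_cancel_iff) auto
qed

end

section \<open>Existence and uniqueness\<close>

lemma AE_unit_reflect:
  assumes "AE x in unit_meas. P x"
  shows "AE x in unit_meas. P (1 - x)"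
proof -
  have "AE x in lebesgue. x \<in> {0<..<1} \<longrightarrow> P x"
    using assms by (subst (asm) AE_restrict_space_iff) auto
  then obtain N where N: "negligible N" "{x. \<not> (x \<in> {0<..<1} \<longrightarrow> P x)} \<subseteq> N"
    unfolding eventually_ae_filter_negligible by blast
  have "negligible ((\<lambda>x. 1 - x) ` N)"
    by (rule negligible_differentiable_image_negligible[OF _ N(1)]) (auto intro!: derivative_intros)
  moreover have "{x. \<not> (x \<in> {0<..<1} \<longrightarrow> P (1 - x))} \<subseteq> (\<lambda>x. 1 - x) ` N"
  proof
    fix x assume "x \<in> {x. \<not> (x \<in> {0<..<1} \<longrightarrow> P (1 - x))}"
    then have "1 - x \<in> N" using N(2) by auto
    then show "x \<in> (\<lambda>x. 1 - x) ` N" by (rule rev_image_eqI) simp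
  qed
  ultimately have "AE x in lebesgue. x \<in> {0<..<1} \<longrightarrow> P (1 - x)"
    unfolding eventually_ae_filter_negligible by blast
  then show ?thesis by (subst AE_restrict_space_iff) auto
qed

text \<open>What remains of a ground state when its phase is removed and it is reflected if it increases.\<close>

definition standard_minimiser :: "real \<Rightarrow> real \<Rightarrow> (real \<Rightarrow> real) \<Rightarrow> bool" where
  "standard_minimiser p \<mu> R \<longleftrightarrow> (\<exists>lam R'. positive_sol lam p R R' \<and> real_minimiser p \<mu> R R' \<and>
     ((\<forall>x\<in>{0..1}. R x = R 0) \<or> (\<forall>x\<in>{0<..<1}. R' x < 0)))"

lemma ground_state_standard_form:
  assumes gs: "energy_ground_state p \<mu> w" and p: "2 < p" and \<mu>: "\<mu> > 0"
  obtains c R where "standard_minimiser p \<mu> R" "cmod c = 1"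
    "(AE x in unit_meas. w x = c * complex_of_real (R x)) \<or> (AE x in unit_meas. w x = c * complex_of_real (R (1 - x)))"
proof -
  obtain u v where uv: "minimiser p \<mu> u v" "AE x in unit_meas. w x = u x"
    using minimiser_if_ground_state[OF gs] p by auto
  obtain lam c R R' where R: "positive_sol lam p R R'" "real_minimiser p \<mu> R R'" "cmod c = 1"
    "\<And>x. x \<in> {0..1} \<Longrightarrow> u x = c * complex_of_real (R x)"
    by (rule minimiser_phase[OF uv(1) p \<mu>]) blast
  have "AE x in unit_meas. x \<in> {0<..<1}" by (rule AE_I2) simp
  with uv(2) have w: "AE x in unit_meas. w x = c * complex_of_real (R x)"
    by eventually_elim (use R(4) in auto)
  from minimiser_constant_or_monotone[OF R(1,2) p] show ?thesis
  proof (elim disjE)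
    assume "\<forall>x\<in>{0..1}. R x = R 0"
    then have "standard_minimiser p \<mu> R" using R(1,2) unfolding standard_minimiser_def by blast
    then show ?thesis using that R(3) w by blast
  next
    assume "\<forall>x\<in>{0<..<1}. R' x < 0"
    then have "standard_minimiser p \<mu> R" using R(1,2) unfolding standard_minimiser_def by blast
    then show ?thesis using that R(3) w by blast
  next
    assume inc: "\<forall>x\<in>{0<..<1}. R' x > 0"
    have "\<forall>x\<in>{0<..<1}. - R' (1 - x) < 0" using inc by auto
    then have "standard_minimiser p \<mu> (\<lambda>x. R (1 - x))"
      using positive_sol_reflect[OF R(1)] real_minimiser_reflect[OF R(2,1) p]
      unfolding standard_minimiser_def by blast
    moreover have "AE x in unit_meas. w x = c * complex_of_real (R (1 - (1 - x)))" using w by simp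
    ultimately show ?thesis using that[of "\<lambda>x. R (1 - x)" c] R(3) by blast
  qed
qed

lemma standard_minimiser_unique:
  assumes R: "standard_minimiser p \<mu> R" and S: "standard_minimiser p \<mu> S"
    and p: "2 < p" "p \<le> 2 + 1/4" and \<mu>: "\<mu> > 0" and x: "x \<in> {0..1}"
  shows "R x = S x"
proof -
  interpret near_linear "p - 2" by unfold_locales (use p in auto)
  have p2: "2 + (p - 2) = p" by simp
  have mass: "integral {0..1} (\<lambda>x. (Q x)\<^sup>2) = \<mu>"
    if "positive_sol lam p Q Q'" "real_minimiser p \<mu> Q Q'" for lam Q Q'
    using that(2) sq_norm_eq_integral[OF positive_solD(1)[OF that(1)]]
    by (simp add: real_minimiser_def minimiser_def)
  have const: "Q x = sqrt \<mu>" if "positive_sol lam p Q Q'" "real_minimiser p \<mu> Q Q'" "\<forall>x\<in>{0..1}. Q x = Q 0" for lam Q Q'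
  proof -
    have "integral {0..1} (\<lambda>x. (Q x)\<^sup>2) = integral {0..1} (\<lambda>x::real. (Q 0)\<^sup>2)"
      by (intro Henstock_Kurzweil_Integration.integral_cong arg_cong[where f = "\<lambda>y. y\<^sup>2"] bspec[OF that(3)])
    then have "(Q 0)\<^sup>2 = \<mu>" using mass[OF that(1,2)] by simp
    then have "Q 0 = sqrt \<mu>" using positive_solD(5)[OF that(1), of 0] by auto
    then show ?thesis using bspec[OF that(3) x] by (rule trans[rotated])
  qed
  have excl: False
    if Q: "positive_sol lam p Q Q'" "real_minimiser p \<mu> Q Q'" "\<forall>x\<in>{0..1}. Q x = Q 0"
      and T: "positive_sol lam' p T T'" "real_minimiser p \<mu> T T'" "\<forall>x\<in>{0<..<1}. T' x < 0"
    for lam lam' Q Q' T T'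
  proof -
    have "(p - 2) * \<mu> powr ((p - 2) / 2) \<le> pi\<^sup>2"
    proof (rule constant_minimiser_mass[OF Q(2) p(1) _ \<mu>])
      show "p \<le> 3" using p(2) by simp
      show "Q x = Q 0" if "x \<in> {0..1}" for x by (rule bspec[OF Q(3) that])
      show "Q 0 > 0" by (rule positive_solD(5)[OF Q(1)]) simp
    qed
    moreover have "pi\<^sup>2 < (p - 2) * \<mu> powr ((p - 2) / 2)"
    proof (rule decreasing_solution_mass[OF _ _ mass[OF T(1,2)] \<mu>])
      show "positive_sol lam' (2 + (p - 2)) T T'" unfolding p2 by (rule T(1))
      show "T' x < 0" if "x \<in> {0<..<1}" for x by (rule bspec[OF T(3) that])
    qed
    ultimately show False by simp
  qed
  obtain lam R' where R': "positive_sol lam p R R'" "real_minimiser p \<mu> R R'"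
    "(\<forall>x\<in>{0..1}. R x = R 0) \<or> (\<forall>x\<in>{0<..<1}. R' x < 0)"
    using R unfolding standard_minimiser_def by blast
  obtain lam' S' where S': "positive_sol lam' p S S'" "real_minimiser p \<mu> S S'"
    "(\<forall>x\<in>{0..1}. S x = S 0) \<or> (\<forall>x\<in>{0<..<1}. S' x < 0)"
    using S unfolding standard_minimiser_def by blast
  show ?thesis
  proof (cases "\<forall>x\<in>{0..1}. R x = R 0")
    case True
    have "\<forall>x\<in>{0..1}. S x = S 0" using excl[OF R'(1,2) True S'(1,2)] S'(3) by blast
    from const[OF S'(1,2) this] const[OF R'(1,2) True] show ?thesis by (rule trans[OF _ sym, rotated])
  next
    case False
    then have decR: "\<forall>x\<in>{0<..<1}. R' x < 0" using R'(3) by blast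
    have decS: "\<forall>x\<in>{0<..<1}. S' x < 0" using excl[OF S'(1,2) _ R'(1,2) decR] S'(3) by blast
    show ?thesis
    proof (rule decreasing_solution_unique[OF _ _ _ _ _ x])
      show "integral {0..1} (\<lambda>x. (R x)\<^sup>2) = integral {0..1} (\<lambda>x. (S x)\<^sup>2)"
        using mass[OF R'(1,2)] mass[OF S'(1,2)] by simp
      show "positive_sol lam (2 + (p - 2)) R R'" "positive_sol lam' (2 + (p - 2)) S S'"
        unfolding p2 by (rule R'(1) S'(1))+
      show "R' y < 0" "S' y < 0" if "y \<in> {0<..<1}" for y
        by (rule bspec[OF decR that] bspec[OF decS that])+
    qed
  qed
qed

lemma ground_state_unique:
  assumes gs: "energy_ground_state p \<mu> u" "energy_ground_state p \<mu> v"
    and p: "2 < p" "p \<le> 2 + 1/4" and \<mu>: "\<mu> > 0"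
  shows "eq_up_to_phase_reflection u v"
proof -
  obtain c R where c: "cmod c = 1" and R: "standard_minimiser p \<mu> R"
    "(AE x in unit_meas. u x = c * complex_of_real (R x)) \<or> (AE x in unit_meas. u x = c * complex_of_real (R (1 - x)))"
    by (rule ground_state_standard_form[OF gs(1) p(1) \<mu>])
  obtain e S where e: "cmod e = 1" and S: "standard_minimiser p \<mu> S"
    "(AE x in unit_meas. v x = e * complex_of_real (S x)) \<or> (AE x in unit_meas. v x = e * complex_of_real (S (1 - x)))"
    by (rule ground_state_standard_form[OF gs(2) p(1) \<mu>])
  have RS: "S x = R x" if "x \<in> {0..1}" for x
    by (rule standard_minimiser_unique[OF S(1) R(1) p \<mu> that])
  have c0: "c \<noteq> 0" using c by auto
  have ec: "cmod (e / c) = 1" using c e by (simp add: norm_divide)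
  have I: "AE x in unit_meas. x \<in> {0<..<1}" by (rule AE_I2) simp
  have aligned: "AE x in unit_meas. v x = e / c * u x"
    if "AE x in unit_meas. u x = c * complex_of_real (R (h x))" "AE x in unit_meas. v x = e * complex_of_real (S (h x))"
      "\<And>x. x \<in> {0<..<1} \<Longrightarrow> h x \<in> {0..1}" for h
    using that(1,2) I by eventually_elim (use RS that(3) c0 in simp)
  have mirrored: "AE x in unit_meas. v x = e / c * u (1 - x)"
    if "AE x in unit_meas. u x = c * complex_of_real (R (h x))" "AE x in unit_meas. v x = e * complex_of_real (S (h (1 - x)))"
      "\<And>x. x \<in> {0<..<1} \<Longrightarrow> h x \<in> {0..1}" for h
    using AE_unit_reflect[OF that(1)] that(2) I
  proof eventually_elim
    case (elim x)
    have "h (1 - x) \<in> {0..1}" using that(3)[of "1 - x"] elim(3) by simp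
    then show ?case using elim RS c0 by simp
  qed
  have "(AE x in unit_meas. v x = e / c * u x) \<or> (AE x in unit_meas. v x = e / c * u (1 - x))"
    using R(2) S(2)
  proof (elim disjE)
    assume "AE x in unit_meas. u x = c * complex_of_real (R x)" "AE x in unit_meas. v x = e * complex_of_real (S x)"
    then show ?thesis by (intro disjI1 aligned[of "\<lambda>x. x"]) auto
  next
    assume "AE x in unit_meas. u x = c * complex_of_real (R (1 - x))" "AE x in unit_meas. v x = e * complex_of_real (S (1 - x))"
    then show ?thesis by (intro disjI1 aligned[of "\<lambda>x. 1 - x"]) auto
  next
    assume "AE x in unit_meas. u x = c * complex_of_real (R x)" "AE x in unit_meas. v x = e * complex_of_real (S (1 - x))"
    then show ?thesis by (intro disjI2 mirrored[of "\<lambda>x. x"]) auto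
  next
    assume "AE x in unit_meas. u x = c * complex_of_real (R (1 - x))" "AE x in unit_meas. v x = e * complex_of_real (S x)"
    then show ?thesis by (intro disjI2 mirrored[of "\<lambda>x. 1 - x"]) auto
  qed
  then show ?thesis unfolding eq_up_to_phase_reflection_def using ec by blast
qed

theorem theorem1p5:
  shows "\<exists>\<epsilon>>0::real. \<forall>p \<mu> :: real. 2 < p \<and> p < 2 + \<epsilon> \<and> \<mu> > 0 \<longrightarrow>
           (\<exists>u. energy_ground_state p \<mu> u) \<and>
           (\<forall>u v. energy_ground_state p \<mu> u \<and> energy_ground_state p \<mu> v \<longrightarrow>
              eq_up_to_phase_reflection u v)"
proof (intro exI[of _ "1/4"] conjI allI impI)
  fix p \<mu> :: real assume "2 < p \<and> p < 2 + 1/4 \<and> \<mu> > 0"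
  then have p: "2 < p" "p \<le> 3" "p \<le> 2 + 1/4" "\<mu> > 0" by auto
  obtain u v where "minimiser p \<mu> u v" using minimiser_exists[OF p(1,2,4)] by blast
  then have "energy_ground_state p \<mu> u" by (rule ground_state_if_minimiser) (use p in simp)
  then show "\<exists>u. energy_ground_state p \<mu> u" by blast
  show "eq_up_to_phase_reflection u v" if "energy_ground_state p \<mu> u \<and> energy_ground_state p \<mu> v" for u v
    by (rule ground_state_unique[OF conjunct1[OF that] conjunct2[OF that] p(1,3,4)])
qed simp

end
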